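(* Let $L$ be a Lelek fan and let $Y$ be a non-degenerate continuum. The following are equivalent: 1. there is an embedding $e:Y\to L$ and a retraction $r:L\to e(Y)$ that is an open map; 2. there is an open surjective map $f:L\to Y$; 3. $Y$ is a Lelek fan.
   Context: A continuum is a nonempty compact connected metric space; it is non-degenerate if it has more than one point. A dendroid is an arcwise connected, hereditarily unicoherent continuum. A point $x$ of a dendroid $X$ is a ramification point if $x$ is the top (the branch point) of some simple triod in $X$. A fan is a dendroid with at most one ramification point; this point, if it exists, is called the top of the fan. For a fan $X$, a point $x$ is an end point of $X$ if $x$ is an end point of every arc in $X$ containing $x$; $E(X)$ denotes the set of end points of $X$. A fan $X$ with top $v$ is smooth if for every $x\in X$ and every sequence $x_n\to x$ in $X$, the arcs from $v$ to $x_n$ converge (in the Hausdorff metric) to the arc from $v$ to $x$. A Lelek fan is a smooth fan $X$ with $\mathrm{Cl}(E(X))=X$. A continuous map $f:X\to Z$ between continua is open if the image of every open subset of $X$ is open in $f(X)$. A retraction from $X$ onto a subspace $Y$ is a continuous map $r:X\to Y$ with $r(y)=y$ for all $y\in Y$. An embedding is a continuous map that is a homeomorphism onto its image. *)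

theory Defs
  imports "HOL-Analysis.Analysis"
begin

definition continuum :: "'a::metric_space set \<Rightarrow> bool" where
  "continuum X \<longleftrightarrow> X \<noteq> {} \<and> compact X \<and> connected X"

definition nondegenerate :: "'a set \<Rightarrow> bool" where
  "nondegenerate X \<longleftrightarrow> (\<exists>x\<in>X. \<exists>y\<in>X. x \<noteq> y)"

definition arcwise_connected :: "'a::metric_space set \<Rightarrow> bool" where
  "arcwise_connected X \<longleftrightarrow>
     (\<forall>x\<in>X. \<forall>y\<in>X. x \<noteq> y \<longrightarrow>
        (\<exists>g. arc g \<and> path_image g \<subseteq> X \<and> pathstart g = x \<and> pathfinish g = y))"

definition hereditarily_unicoherent :: "'a::metric_space set \<Rightarrow> bool" where
  "hereditarily_unicoherent X \<longleftrightarrow>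
     (\<forall>A B. A \<subseteq> X \<and> B \<subseteq> X \<and> continuum A \<and> continuum B \<longrightarrow> connected (A \<inter> B))"

definition dendroid :: "'a::metric_space set \<Rightarrow> bool" where
  "dendroid X \<longleftrightarrow> continuum X \<and> arcwise_connected X \<and> hereditarily_unicoherent X"

definition ramification_point :: "'a::metric_space set \<Rightarrow> 'a \<Rightarrow> bool" where
  "ramification_point X x \<longleftrightarrow>
     (\<exists>g1 g2 g3. arc g1 \<and> arc g2 \<and> arc g3 \<and>
        pathstart g1 = x \<and> pathstart g2 = x \<and> pathstart g3 = x \<and>
        path_image g1 \<subseteq> X \<and> path_image g2 \<subseteq> X \<and> path_image g3 \<subseteq> X \<and>
        path_image g1 \<inter> path_image g2 = {x} \<and>
        path_image g1 \<inter> path_image g3 = {x} \<and>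
        path_image g2 \<inter> path_image g3 = {x})"

definition fan :: "'a::metric_space set \<Rightarrow> bool" where
  "fan X \<longleftrightarrow> dendroid X \<and>
     (\<forall>x y. ramification_point X x \<and> ramification_point X y \<longrightarrow> x = y)"

definition end_point :: "'a::metric_space set \<Rightarrow> 'a \<Rightarrow> bool" where
  "end_point X x \<longleftrightarrow> x \<in> X \<and>
     (\<forall>g. arc g \<and> path_image g \<subseteq> X \<and> x \<in> path_image g \<longrightarrow>
          x = pathstart g \<or> x = pathfinish g)"

definition arc_in :: "'a::metric_space set \<Rightarrow> 'a \<Rightarrow> 'a \<Rightarrow> 'a set \<Rightarrow> bool" where
  "arc_in X v x A \<longleftrightarrow> A \<subseteq> X \<and>
     (if x = v then A = {v}
      else (\<exists>g. arc g \<and> path_image g = A \<and> pathstart g = v \<and> pathfinish g = x))"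

text \<open>The (unique, in a dendroid) arc from v to x in X.\<close>
definition arc_from :: "'a::metric_space set \<Rightarrow> 'a \<Rightarrow> 'a \<Rightarrow> 'a set" where
  "arc_from X v x = (THE A. arc_in X v x A)"

text \<open>Hausdorff distance (meant for nonempty compact sets).\<close>
definition hausdorff_dist :: "'a::metric_space set \<Rightarrow> 'a set \<Rightarrow> real" where
  "hausdorff_dist A B = max (SUP a\<in>A. infdist a B) (SUP b\<in>B. infdist b A)"

definition smooth_fan :: "'a::metric_space set \<Rightarrow> bool" where
  "smooth_fan X \<longleftrightarrow> fan X \<and>
     (\<exists>v. ramification_point X v \<and>
        (\<forall>x s. x \<in> X \<and> (\<forall>n. s n \<in> X) \<and> s \<longlonglongrightarrow> x \<longrightarrow>
           (\<lambda>n. hausdorff_dist (arc_from X v (s n)) (arc_from X v x)) \<longlonglongrightarrow> 0))"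

definition lelek_fan :: "'a::metric_space set \<Rightarrow> bool" where
  "lelek_fan X \<longleftrightarrow> smooth_fan X \<and> closure {x. end_point X x} = X"

definition open_map_on :: "'a::topological_space set \<Rightarrow> ('a \<Rightarrow> 'b::topological_space) \<Rightarrow> bool" where
  "open_map_on X f \<longleftrightarrow>
     (\<forall>U. openin (top_of_set X) U \<longrightarrow> openin (top_of_set (f ` X)) (f ` U))"

definition embedding_into :: "'b::topological_space set \<Rightarrow> 'a::topological_space set \<Rightarrow> ('b \<Rightarrow> 'a) \<Rightarrow> bool" where
  "embedding_into Y L e \<longleftrightarrow> e ` Y \<subseteq> L \<and> (\<exists>e'. homeomorphism Y (e ` Y) e e')"

end

theory Submission
  imports Defs
begin

text \<open>
  A smooth fan \<open>X\<close> with top \<open>v\<close> is encoded by the order \<open>y \<le> x \<longleftrightarrow> y \<in> A x\<close>, where \<open>A x\<close> is the arc from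
  \<open>v\<close> to \<open>x\<close>; smoothness says that \<open>A\<close> is continuous, and the end points are the maximal elements.

  Let \<open>f\<close> be an open map of a Lelek fan onto \<open>Y\<close>. Since open maps are confluent, the continua in \<open>Y\<close> that
  contain the image of an end point and miss \<open>f v\<close> are nested. End points being dense, the images of
  segments \<open>[s, x]\<close> and \<open>[t, r]\<close> with \<open>f x = f r\<close> are nested as well, which forces \<open>f\<close> to be monotone on
  every leg and \<open>f x = f v\<close> to hold for \<open>x = v\<close> only. So \<open>f ` A x\<close> depends only on \<open>f x\<close>, and these sets
  make \<open>Y\<close> a Lelek fan.

  Conversely any two Lelek fans are homeomorphic. The legs of a Lelek fan are coded by points of the
  Cantor set, and the fan is determined by the upper semicontinuous function that gives the length of
  each leg. For two such functions a back-and-forth argument on clopen partitions yields a bijection of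
  the legs that changes lengths by a continuous factor: a clopen set of legs is split off from another
  one with any prescribed smaller supremum of lengths, up to a factor close to 1.
\<close>

section \<open>Fans as ordered spaces\<close>

text \<open>The obstacle is that nestedness of continua is available only at images of end points,
  where a lifted continuum has to lie on one leg, while the order on \<open>Y\<close> has to be
  defined through arbitrary points. Openness bridges the gap: an end point near \<open>x\<close> can
  be matched with a point near any other \<open>r\<close> in the fibre of \<open>x\<close>, and
  non-inclusion survives small perturbations. Fans enter as ordered spaces because the same axioms
  are derived for \<open>L\<close> from its arcs and for \<open>Y\<close> from \<open>f\<close>,
  where no arcs are at hand yet; arcs are rebuilt from the order afterwards. In the uniqueness proof
  lengths are compared by factors and not by differences, since then each leg is rescaled linearly;
  logarithms of factors change by at most \<open>(1/2)^n\<close> at stage \<open>n\<close>, so they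
  converge. A bound on the factors is what gives continuity at \<open>v\<close>, where the codes of
  the legs carry no information.\<close>

lemma compact_dense_sequence:
  fixes X :: "'a::metric_space set"
  assumes "compact X" "X \<noteq> {}"
  shows "\<exists>q::nat \<Rightarrow> 'a. range q \<subseteq> X \<and> (\<forall>x\<in>X. \<forall>e>0. \<exists>n. dist x (q n) < e)"
proof -
  have "\<exists>k. finite k \<and> k \<subseteq> X \<and> X \<subseteq> (\<Union>x\<in>k. ball x (1 / Suc n))" for n
    using seq_compact_imp_totally_bounded[of X] assms(1) compact_eq_seq_compact_metric
    by (metis of_nat_0_less_iff zero_less_Suc zero_less_divide_1_iff)
  then obtain k where k: "\<And>n. finite (k n)" "\<And>n. k n \<subseteq> X" "\<And>n. X \<subseteq> (\<Union>x\<in>k n. ball x (1 / Suc n))"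
    by metis
  define D where "D = (\<Union>n. k n)"
  have D: "countable D" "D \<subseteq> X" "D \<noteq> {}"
    using k assms(2) by (auto simp: D_def countable_finite)
  have "\<exists>n. dist x (from_nat_into D n) < e" if x: "x \<in> X" and e: "0 < e" for x e
  proof -
    obtain n where n: "1 / Suc n < e"
      using nat_approx_posE[OF e] by metis
    obtain y where "y \<in> k n" "dist y x < 1 / Suc n"
      using k(3)[of n] x by auto
    then have "y \<in> D" "dist x y < e"
      using n by (auto simp: D_def dist_commute)
    then show ?thesis
      using from_nat_into_surj[OF D(1)] by metis
  qed
  moreover have "range (from_nat_into D) \<subseteq> X"
    using D by (metis range_from_nat_into)
  ultimately show ?thesis
    by blast
qed

lemma infdist_attained:
  fixes S :: "'a::metric_space set"
  assumes "compact S" "S \<noteq> {}"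
  shows "\<exists>z\<in>S. infdist x S = dist x z"
proof -
  obtain z where z: "z \<in> S" "\<And>y. y \<in> S \<Longrightarrow> dist x z \<le> dist x y"
    using continuous_attains_inf[OF assms, of "dist x"] continuous_on_dist[OF continuous_on_const continuous_on_id]
    by blast
  then have "dist x z \<le> infdist x S"
    using assms by (auto simp: infdist_notempty intro: cINF_greatest)
  then show ?thesis
    using z infdist_le[of z S x] by (intro bexI[of _ z]) auto
qed

lemma compact_level_Icc:
  fixes F :: "real \<Rightarrow> 'b::metric_space"
  assumes "continuous_on {a..b} F" "closed K"
  shows "compact {t \<in> {a..b}. F t \<in> K}"
proof -
  have "closed ({a..b} \<inter> F -` K)"
    using continuous_closed_preimage[OF assms(1) closed_atLeastAtMost assms(2)] .
  then have "compact ({a..b} \<inter> ({a..b} \<inter> F -` K))"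
    by (rule compact_Int_closed[OF compact_Icc])
  moreover have "{a..b} \<inter> ({a..b} \<inter> F -` K) = {t \<in> {a..b}. F t \<in> K}"
    by auto
  ultimately show ?thesis
    by simp
qed

text \<open>In a compact Hausdorff space components and quasicomponents coincide, so two closed sets
  that no connected set joins are separated by a clopen partition. This serves both to lift continua
  through an open map and to code legs.\<close>

lemma compact_separation:
  fixes X :: "'a::metric_space set"
  assumes X: "compact X" and S: "closed S" "S \<subseteq> X" and T: "closed T" "T \<subseteq> X"
    and dis: "\<And>C. connected C \<Longrightarrow> C \<subseteq> X \<Longrightarrow> C \<inter> S = {} \<or> C \<inter> T = {}"
  shows "\<exists>U V. U \<union> V = X \<and> U \<inter> V = {} \<and> S \<subseteq> U \<and> T \<subseteq> V \<and> compact U \<and> compact V"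
proof -
  have "separated_between (top_of_set X) S T"
  proof (rule cut_wire_fence_theorem)
    show "compact_space (top_of_set X)"
      using X by (simp add: compact_space_subtopology)
    show "Hausdorff_space (top_of_set X)"
      by (simp add: Hausdorff_space_subtopology)
    show "closedin (top_of_set X) S" "closedin (top_of_set X) T"
      using S T by (auto intro: closed_subset)
    show "disjnt C S \<or> disjnt C T" if "connectedin (top_of_set X) C" for C
      using that dis[of C] by (auto simp: connectedin_subtopology disjnt_def)
  qed
  then obtain U V where UV: "openin (top_of_set X) U" "openin (top_of_set X) V" "U \<union> V = X"
    "U \<inter> V = {}" "S \<subseteq> U" "T \<subseteq> V"
    unfolding separated_between_def disjnt_def by auto
  then have "U = X - V" "V = X - U"
    by auto
  then have "closedin (top_of_set X) U" "closedin (top_of_set X) V"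
    using UV by (metis closedin_diff closedin_topspace topspace_euclidean_subtopology)+
  then have "compact U" "compact V"
    using X closedin_compact by blast+
  then show ?thesis
    using UV by blast
qed

text \<open>Think of \<open>A x\<close> as the arc from \<open>v\<close> to \<open>x\<close>, so that \<open>y \<in> A x\<close> is the order of the fan. The last
  two assumptions take the place of hereditary unicoherence and of the absence of ramification
  points other than \<open>v\<close>.\<close>
locale rooted_fan =
  fixes X :: "'a::metric_space set" and v :: 'a and A :: "'a \<Rightarrow> 'a set"
  assumes X_compact: "compact X" and root_in: "v \<in> X"
    and A_sub: "x \<in> X \<Longrightarrow> A x \<subseteq> X"
    and A_compact: "x \<in> X \<Longrightarrow> compact (A x)"
    and A_connected: "x \<in> X \<Longrightarrow> connected (A x)"
    and A_self: "x \<in> X \<Longrightarrow> x \<in> A x"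
    and A_root: "x \<in> X \<Longrightarrow> v \<in> A x"
    and A_of_root: "A v = {v}"
    and A_trans: "x \<in> X \<Longrightarrow> y \<in> A x \<Longrightarrow> A y \<subseteq> A x"
    and A_linear: "x \<in> X \<Longrightarrow> y \<in> A x \<Longrightarrow> z \<in> A x \<Longrightarrow> y \<in> A z \<or> z \<in> A y"
    and A_antisym: "x \<in> X \<Longrightarrow> y \<in> A x \<Longrightarrow> x \<in> A y \<Longrightarrow> x = y"
    and A_usc: "closed F \<Longrightarrow> closed {x \<in> X. A x \<inter> F \<noteq> {}}"
    and A_lsc: "open U \<Longrightarrow> openin (top_of_set X) {x \<in> X. A x \<inter> U \<noteq> {}}"
    and continuum_root: "continuum K \<Longrightarrow> K \<subseteq> X \<Longrightarrow> v \<in> K \<Longrightarrow> x \<in> K \<Longrightarrow> A x \<subseteq> K"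
    and continuum_chain:
      "continuum K \<Longrightarrow> K \<subseteq> X \<Longrightarrow> v \<notin> K \<Longrightarrow> x \<in> K \<Longrightarrow> y \<in> K \<Longrightarrow> x \<in> A y \<or> y \<in> A x"
begin

lemma A_in: "x \<in> X \<Longrightarrow> y \<in> A x \<Longrightarrow> y \<in> X"
  using A_sub by blast

text \<open>Missing a closed ball about \<open>q\<close> is an open condition on \<open>x\<close> by
  \<open>A_usc\<close> and preserves lower bounds; hitting an open ball is open by
  \<open>A_lsc\<close> and preserves upper bounds.\<close>

lemma continuous_infdist_A: "continuous_on X (\<lambda>x. infdist q (A x))"
  unfolding continuous_on_def
proof (intro ballI order_tendstoI)
  fix x a assume x: "x \<in> X" and a: "a < infdist q (A x)"
  have "closed {y \<in> X. A y \<inter> cball q a \<noteq> {}}"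
    by (rule A_usc) simp
  moreover have "x \<notin> {y \<in> X. A y \<inter> cball q a \<noteq> {}}"
    using a infdist_le[of _ "A x" q] by force
  moreover have "a < infdist q (A y)" if y: "y \<in> X" "y \<notin> {y \<in> X. A y \<inter> cball q a \<noteq> {}}" for y
  proof -
    obtain z where "z \<in> A y" "infdist q (A y) = dist q z"
      using infdist_attained[of "A y" q] A_compact A_self y by blast
    then show ?thesis
      using that by fastforce
  qed
  ultimately show "\<forall>\<^sub>F y in at x within X. a < infdist q (A y)"
    unfolding eventually_at_topological
    by (intro exI[of _ "- {y \<in> X. A y \<inter> cball q a \<noteq> {}}"]) auto
next
  fix x a assume x: "x \<in> X" and a: "infdist q (A x) < a"
  have "openin (top_of_set X) {y \<in> X. A y \<inter> ball q a \<noteq> {}}"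
    by (rule A_lsc) simp
  then obtain O' where O': "open O'" "{y \<in> X. A y \<inter> ball q a \<noteq> {}} = X \<inter> O'"
    unfolding openin_open by blast
  obtain z where "z \<in> A x" "infdist q (A x) = dist q z"
    using infdist_attained[of "A x" q] A_compact A_self x by blast
  then have "x \<in> O'"
    using a x O' by fastforce
  moreover have "infdist q (A y) < a" if y: "y \<in> X" "y \<in> O'" for y
  proof -
    have "y \<in> {y \<in> X. A y \<inter> ball q a \<noteq> {}}"
      unfolding O'(2) using y by blast
    then obtain z where "z \<in> A y" "dist q z < a"
      by auto
    then show ?thesis
      using infdist_le[of z "A y" q] by simp
  qed
  ultimately show "\<forall>\<^sub>F y in at x within X. infdist q (A y) < a"
    unfolding eventually_at_topological using O'(1) by blast
qed

text \<open>A Whitney-type function: summing the distances from a dense sequence to \<open>A x\<close> detects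
  every proper inclusion between the sets \<open>A x\<close>.\<close>
lemma height_function_exists:
  "\<exists>m. continuous_on X m \<and> m v = (0::real) \<and> (\<forall>x\<in>X. \<forall>y\<in>A x. y \<noteq> x \<longrightarrow> m y < m x)"
proof -
  obtain q :: "nat \<Rightarrow> 'a" where q: "range q \<subseteq> X" "\<And>x e. x \<in> X \<Longrightarrow> 0 < e \<Longrightarrow> \<exists>n. dist x (q n) < e"
    using compact_dense_sequence[OF X_compact] root_in by blast
  obtain D where D: "\<And>x y. x \<in> X \<Longrightarrow> y \<in> X \<Longrightarrow> dist x y \<le> D"
    using compact_imp_bounded[OF X_compact] bounded_two_points by metis
  define g where "g n x = (1/2)^n * (dist (q n) v - infdist (q n) (A x))" for n x
  have g_bound: "0 \<le> g n x \<and> g n x \<le> (1/2)^n * D" if "x \<in> X" for n x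
  proof -
    have "infdist (q n) (A x) \<le> dist (q n) v"
      using infdist_le A_root[OF that] by blast
    moreover have "dist (q n) v \<le> D"
      using D q root_in by blast
    ultimately show ?thesis
      using infdist_nonneg[of "q n" "A x"] by (auto simp: g_def)
  qed
  have sumM: "summable (\<lambda>n. (1/2)^n * D :: real)"
    by (intro summable_mult2 summable_geometric) simp
  have summ: "summable (\<lambda>n. g n x)" if "x \<in> X" for x
    by (rule summable_comparison_test'[OF sumM, of 0]) (use g_bound[OF that] in simp)
  define m where "m x = (\<Sum>n. g n x)" for x
  have "continuous_on X m"
    unfolding m_def
  proof (rule uniform_limit_theorem)
    show "uniform_limit X (\<lambda>n x. \<Sum>i<n. g i x) (\<lambda>x. \<Sum>i. g i x) sequentially"
      by (rule Weierstrass_m_test[OF _ sumM]) (use g_bound in auto)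
    show "\<forall>\<^sub>F n in sequentially. continuous_on X (\<lambda>x. \<Sum>i<n. g i x)"
      unfolding g_def by (intro always_eventually allI continuous_intros continuous_infdist_A)
  qed simp
  moreover have "m v = 0"
    by (simp add: m_def g_def A_of_root)
  moreover have "m y < m x" if x: "x \<in> X" and y: "y \<in> A x" "y \<noteq> x" for x y
  proof -
    have yX: "y \<in> X"
      using x y A_in by blast
    have sub: "A y \<subseteq> A x"
      using A_trans x y by blast
    have "x \<notin> A y"
      using A_antisym x y by blast
    then have pos: "0 < infdist x (A y)"
      using A_compact[OF yX] A_self[OF yX] compact_imp_closed infdist_pos_not_in_closed by blast
    \<comment> \<open>The point \<open>q n\<close> is within half of \<open>infdist x (A y)\<close>
      of \<open>x\<close>, so it is strictly nearer to \<open>A x\<close> than to \<open>A y\<close>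
      and the \<open>n\<close>-th summand drops strictly; the other summands are monotone.\<close>
    obtain n where n: "dist x (q n) < infdist x (A y) / 2"
      using q(2)[OF x, of "infdist x (A y) / 2"] pos by auto
    have "infdist (q n) (A x) \<le> dist x (q n)"
      using infdist_le[OF A_self[OF x], of "q n"] by (simp add: dist_commute)
    moreover have "infdist x (A y) \<le> infdist (q n) (A y) + dist x (q n)"
      by (rule infdist_triangle)
    ultimately have strict: "g n y < g n x"
      using n by (simp add: g_def)
    have le: "g i y \<le> g i x" for i
      using infdist_mono[OF sub, of "q i"] A_self[OF yX] by (auto simp: g_def)
    have "0 < (\<Sum>i. g i x - g i y)"
      by (rule suminf_pos2[of _ n]) (use strict le summ x yX in \<open>auto intro!: summable_diff\<close>)
    then show ?thesis
      using suminf_diff[OF summ[OF x] summ[OF yX]] by (simp add: m_def)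
  qed
  ultimately show ?thesis
    by blast
qed

section \<open>Heights and the parametrization of legs\<close>

definition mu :: "'a \<Rightarrow> real" where
  "mu = (SOME m. continuous_on X m \<and> m v = (0::real) \<and> (\<forall>x\<in>X. \<forall>y\<in>A x. y \<noteq> x \<longrightarrow> m y < m x))"

lemma mu_continuous: "continuous_on X mu" and mu_root: "mu v = 0"
  and mu_less: "\<lbrakk>x \<in> X; y \<in> A x; y \<noteq> x\<rbrakk> \<Longrightarrow> mu y < mu x"
proof -
  note * = someI_ex[OF height_function_exists, folded mu_def]
  show "continuous_on X mu" "mu v = 0"
    using * by simp_all
  have "\<forall>x\<in>X. \<forall>y\<in>A x. y \<noteq> x \<longrightarrow> mu y < mu x"
    using * by (elim conjE)
  then show "\<lbrakk>x \<in> X; y \<in> A x; y \<noteq> x\<rbrakk> \<Longrightarrow> mu y < mu x"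
    by blast
qed

lemma mu_le: "x \<in> X \<Longrightarrow> y \<in> A x \<Longrightarrow> mu y \<le> mu x"
  using mu_less by (cases "y = x") (auto intro: less_imp_le)

lemma mu_nonneg: "x \<in> X \<Longrightarrow> 0 \<le> mu x"
  using mu_le[OF _ A_root] mu_root by force

lemma mu_pos: "x \<in> X \<Longrightarrow> x \<noteq> v \<Longrightarrow> 0 < mu x"
  using mu_less[OF _ A_root] mu_root by force

lemma mu_eq_comparable:
  assumes "x \<in> X" "y \<in> X" "x \<in> A y \<or> y \<in> A x" "mu x = mu y"
  shows "x = y"
  using assms mu_less by (metis less_irrefl)

lemma mu_le_iff:
  assumes "x \<in> X" "y \<in> A x" "z \<in> A x"
  shows "mu y \<le> mu z \<longleftrightarrow> y \<in> A z"
proof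
  assume le: "mu y \<le> mu z"
  have yX: "y \<in> X" and zX: "z \<in> X"
    using assms A_in by blast+
  show "y \<in> A z"
  proof (rule ccontr)
    assume "y \<notin> A z"
    then have "z \<in> A y"
      using A_linear[OF assms] by blast
    then have "y = z"
      using le mu_le[OF yX] mu_eq_comparable[OF yX zX] by force
    then show False
      using \<open>y \<notin> A z\<close> A_self[OF zX] by blast
  qed
qed (use assms A_in mu_le in blast)

lemma mu_inj: "x \<in> X \<Longrightarrow> inj_on mu (A x)"
  by (rule inj_onI) (metis A_in A_linear mu_eq_comparable)

text \<open>\<open>A_usc\<close> read sequentially: the order is a closed relation. Otherwise a
  closed ball about \<open>y\<close> off \<open>A x\<close> would be met by almost all
  \<open>A (s n)\<close>, hence by \<open>A x\<close>.\<close>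

lemma graph_closed:
  assumes s: "\<And>n. s n \<in> X" "s \<longlonglongrightarrow> x" and t: "\<And>n. t n \<in> A (s n)" "t \<longlonglongrightarrow> y"
  shows "x \<in> X" "y \<in> A x"
proof -
  show x: "x \<in> X"
    using closed_sequentially[OF compact_imp_closed[OF X_compact]] s by blast
  show "y \<in> A x"
  proof (rule ccontr)
    assume "y \<notin> A x"
    then have "y \<in> - A x" "open (- A x)"
      using A_compact[OF x] compact_imp_closed by auto
    then obtain r where r: "0 < r" "cball y r \<subseteq> - A x"
      using open_contains_cball by blast
    obtain N where N: "\<And>n. n \<ge> N \<Longrightarrow> dist (t n) y < r"
      using t(2) r(1) unfolding lim_sequentially by blast
    have cl: "closed {z \<in> X. A z \<inter> cball y r \<noteq> {}}"
      by (rule A_usc) simp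
    have "s (n + N) \<in> {z \<in> X. A z \<inter> cball y r \<noteq> {}}" for n
      using s(1)[of "n + N"] t(1)[of "n + N"] N[of "n + N"] by (auto simp: dist_commute intro: less_imp_le)
    then have "x \<in> {z \<in> X. A z \<inter> cball y r \<noteq> {}}"
      using closed_sequentially[OF cl, of "\<lambda>n. s (n + N)"] LIMSEQ_ignore_initial_segment[OF s(2)] by blast
    then show False
      using r by blast
  qed
qed

lemma lsc_dist:
  assumes x: "x \<in> X" and b: "b \<in> A x" and e: "0 < e"
  shows "\<exists>d>0. \<forall>y\<in>X. dist y x < d \<longrightarrow> (\<exists>c\<in>A y. dist c b < e)"
proof -
  have "openin (top_of_set X) {y \<in> X. A y \<inter> ball b e \<noteq> {}}"
    by (rule A_lsc) simp
  moreover have "x \<in> {y \<in> X. A y \<inter> ball b e \<noteq> {}}"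
    using x b e by force
  ultimately obtain d where "0 < d" "ball x d \<inter> X \<subseteq> {y \<in> X. A y \<inter> ball b e \<noteq> {}}"
    unfolding openin_contains_ball by blast
  then show ?thesis
    by (intro exI[of _ d]) (force simp: dist_commute)
qed

lemma mu_image_A: "x \<in> X \<Longrightarrow> mu ` A x = {0..mu x}"
proof
  assume x: "x \<in> X"
  show "mu ` A x \<subseteq> {0..mu x}"
    using x mu_le mu_nonneg A_in by auto
  have "connected (mu ` A x)"
    using connected_continuous_image[OF continuous_on_subset[OF mu_continuous A_sub[OF x]] A_connected[OF x]] .
  moreover have "0 \<in> mu ` A x" "mu x \<in> mu ` A x"
    using A_root[OF x] A_self[OF x] mu_root by (metis image_eqI)+
  ultimately show "{0..mu x} \<subseteq> mu ` A x"
    by (simp add: connected_contains_Icc)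
qed

definition pt :: "'a \<Rightarrow> real \<Rightarrow> 'a" where
  "pt x = the_inv_into (A x) mu"

lemma pt_mu: "x \<in> X \<Longrightarrow> y \<in> A x \<Longrightarrow> pt x (mu y) = y"
  unfolding pt_def by (rule the_inv_into_f_f[OF mu_inj])

lemma pt_in: "x \<in> X \<Longrightarrow> 0 \<le> t \<Longrightarrow> t \<le> mu x \<Longrightarrow> pt x t \<in> A x"
  unfolding pt_def by (rule the_inv_into_into[OF mu_inj]) (auto simp: mu_image_A)

lemma mu_pt: "x \<in> X \<Longrightarrow> 0 \<le> t \<Longrightarrow> t \<le> mu x \<Longrightarrow> mu (pt x t) = t"
  unfolding pt_def by (rule f_the_inv_into_f[OF mu_inj]) (auto simp: mu_image_A)

lemma pt_0: "x \<in> X \<Longrightarrow> pt x 0 = v"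
  using pt_mu[of x v] mu_root A_root by auto

lemma pt_top: "x \<in> X \<Longrightarrow> pt x (mu x) = x"
  using pt_mu A_self by auto

lemma pt_continuous: "x \<in> X \<Longrightarrow> continuous_on {0..mu x} (pt x)"
  using continuous_on_inv[of "A x" mu "pt x"] continuous_on_subset[OF mu_continuous A_sub]
    A_compact pt_mu mu_image_A by auto

lemma pt_image:
  assumes "x \<in> X" "0 \<le> a" "b \<le> mu x"
  shows "pt x ` {a..b} = {z \<in> A x. a \<le> mu z \<and> mu z \<le> b}"
proof (intro set_eqI iffI)
  fix z assume "z \<in> pt x ` {a..b}"
  then show "z \<in> {z \<in> A x. a \<le> mu z \<and> mu z \<le> b}"
    using assms pt_in mu_pt by auto
next
  fix z assume "z \<in> {z \<in> A x. a \<le> mu z \<and> mu z \<le> b}"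
  then show "z \<in> pt x ` {a..b}"
    using pt_mu[OF assms(1), of z] by (intro image_eqI[of _ _ "mu z"]) auto
qed

lemma continuum_pt_image:
  assumes "x \<in> X" "0 \<le> a" "a \<le> b" "b \<le> mu x"
  shows "continuum (pt x ` {a..b})" "pt x ` {a..b} \<subseteq> X"
proof -
  have c: "continuous_on {a..b} (pt x)"
    by (rule continuous_on_subset[OF pt_continuous]) (use assms in auto)
  show "continuum (pt x ` {a..b})"
    unfolding continuum_def
    using assms compact_continuous_image[OF c] connected_continuous_image[OF c] by auto
  show "pt x ` {a..b} \<subseteq> X"
    using pt_image[OF assms(1,2,4)] A_in[OF assms(1)] by auto
qed

text \<open>Away from the root legs do not branch: above a common point \<open>z\<close> the two
  pieces form a continuum that misses \<open>v\<close>, and \<open>continuum_chain\<close> makes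
  their top points comparable.\<close>

lemma comparable_of_meet:
  assumes x: "x \<in> X" and y: "y \<in> X" and z: "z \<in> A x" "z \<in> A y" "z \<noteq> v"
  shows "x \<in> A y \<or> y \<in> A x"
proof -
  have zX: "z \<in> X"
    using x z A_in by blast
  have pos: "0 < mu z" "mu z \<le> mu x" "mu z \<le> mu y"
    using mu_pos[OF zX] z mu_le x y by auto
  define K where "K = pt x ` {mu z..mu x} \<union> pt y ` {mu z..mu y}"
  have 1: "continuum (pt x ` {mu z..mu x})" "pt x ` {mu z..mu x} \<subseteq> X"
    "continuum (pt y ` {mu z..mu y})" "pt y ` {mu z..mu y} \<subseteq> X"
    using continuum_pt_image x y pos by auto
  have z12: "z \<in> pt x ` {mu z..mu x}" "z \<in> pt y ` {mu z..mu y}"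
    using z pos x y by (auto simp: pt_image)
  have "continuum K"
    using 1 z12 unfolding K_def continuum_def by (auto intro!: connected_Un)
  moreover have "K \<subseteq> X"
    using 1 K_def by auto
  moreover have "v \<notin> K"
    using pos mu_root x y by (auto simp: K_def pt_image)
  moreover have "x \<in> K" "y \<in> K"
    using pos x y A_self by (auto simp: K_def pt_image)
  ultimately show ?thesis
    by (rule continuum_chain)
qed

text \<open>If \<open>K\<close> misses \<open>v\<close>, its heights fill an interval, so it has a
  point \<open>k\<close> at the height of \<open>u\<close>. This \<open>k\<close> is comparable with
  \<open>z\<close>, and equal heights on one leg force \<open>k = u\<close>.\<close>

lemma continuum_convex:
  assumes K: "continuum K" "K \<subseteq> X" and y: "y \<in> K" "y \<in> A u" and z: "z \<in> K" "u \<in> A z"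
  shows "u \<in> K"
proof (cases "v \<in> K")
  case True
  then show ?thesis
    using continuum_root K z by blast
next
  case False
  have zX: "z \<in> X" and uX: "u \<in> X" and yX: "y \<in> X"
    using K z y A_in by auto
  have "connected (mu ` K)"
    using connected_continuous_image[OF continuous_on_subset[OF mu_continuous K(2)]] K(1)
    by (auto simp: continuum_def)
  moreover have "mu y \<le> mu u" "mu u \<le> mu z"
    using mu_le uX y zX z by auto
  ultimately have "mu u \<in> mu ` K"
    using y z by (meson connectedD_interval imageI)
  then obtain k where k: "k \<in> K" "mu k = mu u"
    by auto
  have kX: "k \<in> X"
    using k K by auto
  have "k \<in> A z \<or> z \<in> A k"
    using continuum_chain[OF K False k(1) z(1)] by blast
  then show ?thesis
  proof
    assume "k \<in> A z"
    then have "k = u"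
      using mu_inj[OF zX] k z by (meson inj_onD)
    then show ?thesis using k by simp
  next
    assume "z \<in> A k"
    then have "mu z \<le> mu u"
      using mu_le[OF kX] k by metis
    then have "z = u"
      using \<open>mu u \<le> mu z\<close> mu_eq_comparable[OF uX zX] z by auto
    then show ?thesis using z by simp
  qed
qed

definition maxs :: "'a set" where
  "maxs = {e \<in> X. \<forall>y\<in>X. e \<in> A y \<longrightarrow> y = e}"

lemma maxsD: "e \<in> maxs \<Longrightarrow> e \<in> X" "e \<in> maxs \<Longrightarrow> y \<in> X \<Longrightarrow> e \<in> A y \<Longrightarrow> y = e"
  by (auto simp: maxs_def)

text \<open>\<open>A_usc\<close> for the closed set \<open>{x}\<close> makes the set of points above
  \<open>x\<close> compact, and a highest one is maximal because \<open>mu\<close> is strictly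
  monotone.\<close>

lemma maximal_above:
  assumes x: "x \<in> X"
  shows "\<exists>e\<in>maxs. x \<in> A e"
proof -
  define S where "S = {y \<in> X. x \<in> A y}"
  have "S = {y \<in> X. A y \<inter> {x} \<noteq> {}}"
    by (auto simp: S_def)
  then have "closed S"
    using A_usc[of "{x}"] by simp
  moreover have SX: "S = X \<inter> S"
    by (auto simp: S_def)
  ultimately have "compact S"
    using compact_Int_closed[OF X_compact] by metis
  moreover have "S \<noteq> {}"
    using A_self x by (auto simp: S_def)
  moreover have "continuous_on S mu"
    by (rule continuous_on_subset[OF mu_continuous]) (auto simp: S_def)
  ultimately obtain e where "e \<in> S" "\<forall>y\<in>S. mu y \<le> mu e"
    using continuous_attains_sup by blast
  then have e: "e \<in> X" "x \<in> A e" "\<And>y. y \<in> X \<Longrightarrow> x \<in> A y \<Longrightarrow> mu y \<le> mu e"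
    by (auto simp: S_def)
  have "y = e" if y: "y \<in> X" "e \<in> A y" for y
  proof -
    have "x \<in> A y"
      using A_trans[OF y] e by auto
    then have "mu y \<le> mu e"
      using e y by auto
    then show ?thesis
      using mu_less[OF y] by force
  qed
  then show ?thesis
    using e by (auto simp: maxs_def)
qed

lemma X_continuum: "continuum X"
proof -
  have "X = (\<Union>x\<in>X. A x)"
    using A_self A_sub by auto
  moreover have "connected (\<Union>x\<in>X. A x)"
  proof (rule connected_Union)
    show "\<Inter> (A ` X) \<noteq> {}"
      using A_root by (metis INT_I empty_iff)
  qed (use A_connected in auto)
  ultimately show ?thesis
    unfolding continuum_def using X_compact root_in by auto
qed

end

locale lelek_rooted_fan = rooted_fan +
  assumes maxs_dense: "X \<subseteq> closure maxs" and nontrivial: "X \<noteq> {v}"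
begin

lemma maxs_not_root: "e \<in> maxs \<Longrightarrow> e \<noteq> v"
  using nontrivial root_in A_root unfolding maxs_def by blast

lemma maxs_approx: "x \<in> X \<Longrightarrow> 0 < d \<Longrightarrow> \<exists>e\<in>maxs. dist e x < d"
  using maxs_dense closure_approachable by blast

end

section \<open>Open images of Lelek fans\<close>

lemma path_avoiding_right:
  fixes F :: "real \<Rightarrow> 'b::metric_space"
  assumes F: "continuous_on {u..t} F" and ut: "u \<le> t" and ne: "F t \<noteq> F u" "F u \<noteq> w"
  shows "\<exists>b\<in>{u..t}. F b \<noteq> F u \<and> w \<notin> F ` {u..b}"
proof (cases "w \<in> F ` {u..t}")
  case False
  then show ?thesis using ut ne by (intro bexI[of _ t]) auto
next
  case True
  define C where "C = {s \<in> {u..t}. F s = w}"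
  have "compact C"
    using compact_level_Icc[OF F, of "{w}"] by (simp add: C_def)
  moreover have "C \<noteq> {}"
    using True by (auto simp: C_def)
  ultimately obtain b0 where b0: "b0 \<in> C" "\<And>s. s \<in> C \<Longrightarrow> b0 \<le> s"
    using compact_attains_inf by metis
  have b0': "u < b0" "b0 \<le> t" "F b0 = w"
    using b0(1) ne(2) by (auto simp: C_def less_le)
  have "0 < dist w (F u)"
    using ne by simp
  then obtain d where d: "0 < d" "\<And>s. s \<in> {u..t} \<Longrightarrow> dist s b0 < d \<Longrightarrow> dist (F s) w < dist w (F u)"
    using F b0' unfolding continuous_on_iff by (metis atLeastAtMost_iff less_imp_le)
  \<comment> \<open>Slightly before the first hit \<open>b0\<close> of \<open>w\<close> the path has
    not met \<open>w\<close> yet, but is so close to it that it has left \<open>F u\<close>.\<close>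
  define b where "b = max u (b0 - d/2)"
  have b: "b \<in> {u..t}" "b < b0" "dist b b0 < d"
    using b0' d(1) by (auto simp: b_def dist_real_def)
  have "F b \<noteq> F u"
    using d(2)[OF b(1) b(3)] by (auto simp: dist_commute)
  moreover have "w \<notin> F ` {u..b}"
    using b0(2) b by (force simp: C_def)
  ultimately show ?thesis
    using b by blast
qed

lemma path_avoiding_left:
  fixes F :: "real \<Rightarrow> 'b::metric_space"
  assumes F: "continuous_on {t..u} F" and ut: "t \<le> u" and ne: "F t \<noteq> F u" "F u \<noteq> w"
  shows "\<exists>a\<in>{t..u}. F a \<noteq> F u \<and> w \<notin> F ` {a..u}"
proof -
  define G where "G s = F (- s)" for s
  have "continuous_on {-u..-t} G"
    unfolding G_def by (rule continuous_on_compose2[OF F]) (auto intro!: continuous_intros)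
  then obtain b where b: "b \<in> {-u..-t}" "G b \<noteq> G (-u)" "w \<notin> G ` {-u..b}"
    using path_avoiding_right[of "-u" "-t" G w] assms by (auto simp: G_def)
  have "F ` {-b..u} \<subseteq> G ` {-u..b}"
  proof
    fix y assume "y \<in> F ` {-b..u}"
    then obtain s where "s \<in> {-b..u}" "y = F s" by blast
    then show "y \<in> G ` {-u..b}"
      by (intro image_eqI[of _ _ "-s"]) (auto simp: G_def)
  qed
  then show ?thesis
    using b by (intro bexI[of _ "-b"]) (auto simp: G_def)
qed

text \<open>If the path returned to \<open>F x\<close> after leaving it, let \<open>s\<close> be the last parameter before \<open>x\<close>
  at which the path enters the loop \<open>F ` {x..r}\<close>. Nestedness, applied at \<open>F s\<close> and at \<open>F x\<close>, puts
  the loop inside \<open>F ` {s'..s}\<close> for every \<open>s' < s\<close>, so the loop is a point.\<close>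
lemma path_loop_constant:
  fixes F :: "real \<Rightarrow> 'b::metric_space"
  assumes F: "continuous_on {0..T} F" and F0: "F 0 = w"
    and nest: "\<And>a b a' b'. \<lbrakk>0 \<le> a; a \<le> b; b \<le> T; 0 \<le> a'; a' \<le> b'; b' \<le> T; F b = F b';
      w \<notin> F ` {a..b}; w \<notin> F ` {a'..b'}\<rbrakk> \<Longrightarrow> F ` {a..b} \<subseteq> F ` {a'..b'} \<or> F ` {a'..b'} \<subseteq> F ` {a..b}"
    and xr: "0 \<le> x" "x \<le> r" "r \<le> T" "F x = F r" "w \<notin> F ` {x..r}" and t: "t \<in> {x..r}"
  shows "F t = F x"
proof -
  define K where "K = F ` {x..r}"
  have cont_sub: "continuous_on {a..b} F" if "0 \<le> a" "b \<le> T" for a b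
    by (rule continuous_on_subset[OF F]) (use that in auto)
  have "compact K"
    unfolding K_def using compact_continuous_image[OF cont_sub] xr by auto
  then have Kcl: "closed K"
    by (rule compact_imp_closed)
  define S where "S = {s \<in> {0..x}. F s \<notin> K}"
  have S0: "0 \<in> S"
    using F0 xr by (auto simp: S_def K_def)
  have Sb: "bdd_above S"
    by (auto simp: S_def bdd_above_def)
  define s where "s = Sup S"
  have "s \<le> x"
    unfolding s_def
  proof (rule cSup_least)
    show "S \<noteq> {}" using S0 by blast
  qed (simp add: S_def)
  moreover have "0 \<le> s"
    unfolding s_def by (rule cSup_upper[OF S0 Sb])
  ultimately have s: "0 \<le> s" "s \<le> x"
    by blast+
  have after: "F y \<in> K" if "s < y" "y \<le> x" for y
  proof (rule ccontr)
    assume "F y \<notin> K"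
    then have "y \<in> S"
      using that s by (auto simp: S_def)
    then show False
      using cSup_upper[OF _ Sb, of y] that by (simp add: s_def)
  qed
  have Fx: "F x \<in> K"
    using xr by (auto simp: K_def)
  have Fs: "F s \<in> K"
  proof (rule ccontr)
    assume "F s \<notin> K"
    then obtain \<epsilon> where \<epsilon>: "0 < \<epsilon>" "ball (F s) \<epsilon> \<inter> K = {}"
      using Kcl by (metis Compl_iff disjoint_eq_subset_Compl open_Compl open_contains_ball)
    have sx: "s < x"
      using \<open>F s \<notin> K\<close> Fx s by (metis less_le)
    have "s \<in> {0..T}"
      using s xr by auto
    then obtain d where d: "0 < d" "\<And>y. y \<in> {0..T} \<Longrightarrow> dist y s < d \<Longrightarrow> dist (F y) (F s) < \<epsilon>"
      using F \<epsilon>(1) unfolding continuous_on_iff by metis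
    define y where "y = min x (s + d/2)"
    have y: "s < y" "y \<le> x" "dist y s < d" "y \<in> {0..T}"
      using sx d(1) s xr by (auto simp: y_def dist_real_def)
    then show False
      using d(2)[of y] after[of y] \<epsilon>(2) by (metis IntI dist_commute empty_iff mem_ball)
  qed
  have wK: "w \<notin> K"
    using xr by (simp add: K_def)
  have s_pos: "0 < s"
    using Fs wK F0 s by (metis less_le)
  obtain z where z: "z \<in> {x..r}" "F z = F s"
    using Fs by (auto simp: K_def)
  have sx_K: "F ` {s..x} \<subseteq> K"
    using after Fs by (force simp: less_le)
  have sz_K: "F ` {s..z} \<subseteq> K"
  proof
    fix y assume "y \<in> F ` {s..z}"
    then obtain p where "p \<in> {s..z}" "y = F p" by blast
    then show "y \<in> K"
      using sx_K z by (cases "p \<le> x") (auto simp: K_def)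
  qed
  have "s \<in> {0..T}" "0 < dist (F s) w"
    using s xr Fs wK by auto
  then obtain d where d: "0 < d" "\<And>y. y \<in> {0..T} \<Longrightarrow> dist y s < d \<Longrightarrow> dist (F y) (F s) < dist (F s) w"
    using F unfolding continuous_on_iff by metis
  \<comment> \<open>With \<open>s - s' < d\<close> the piece over \<open>{s'..s}\<close> avoids
    \<open>w\<close>, so \<open>nest\<close> is available. It contains a value off \<open>K\<close>,
    because \<open>s\<close> is a supremum of such parameters; hence in each comparison it, or its
    extension to \<open>x\<close>, is the larger side.\<close>
  have cover: "K \<subseteq> F ` {s'..s}" if s': "0 \<le> s'" "s' < s" "s - s' < d" for s'
  proof -
    have w1: "w \<notin> F ` {s'..s}"
    proof
      assume "w \<in> F ` {s'..s}"
      then obtain y where "y \<in> {s'..s}" "w = F y" by blast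
      then show False
        using d(2)[of y] s' s xr by (auto simp: dist_real_def dist_commute)
    qed
    obtain y where y: "y \<in> S" "s' < y"
      using less_cSup_iff[of S s'] S0 Sb s' by (auto simp: s_def)
    have "y \<le> s"
      using cSup_upper[OF y(1) Sb] by (simp add: s_def)
    then have "F y \<in> F ` {s'..s}" "F y \<notin> K"
      using y by (auto simp: S_def)
    then have not1: "\<not> F ` {s'..s} \<subseteq> K"
      by blast
    have un: "F ` {s'..x} = F ` {s'..s} \<union> F ` {s..x}"
      using s s' by (metis image_Un ivl_disj_un_two_touch(4) less_imp_le)
    have w2: "w \<notin> F ` {s'..x}"
      using w1 wK sx_K un by auto
    have "F ` {s'..s} \<subseteq> F ` {s..z} \<or> F ` {s..z} \<subseteq> F ` {s'..s}"
      by (rule nest) (use s' s z xr w1 sz_K wK in auto)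
    then have 1: "F ` {s..z} \<subseteq> F ` {s'..s}"
      using not1 sz_K by blast
    have "F ` {s'..x} \<subseteq> F ` {x..r} \<or> F ` {x..r} \<subseteq> F ` {s'..x}"
      by (rule nest) (use s' s z xr w2 in auto)
    then have "K \<subseteq> F ` {s'..x}"
      using not1 un K_def by (metis Un_subset_iff)
    moreover have "F ` {s..x} \<subseteq> F ` {s..z}"
      using z by auto
    then have "F ` {s..x} \<subseteq> F ` {s'..s}"
      using 1 by (rule subset_trans)
    then have "F ` {s'..x} = F ` {s'..s}"
      unfolding un by (rule Un_absorb2)
    ultimately show ?thesis
      by simp
  qed
  \<comment> \<open>Letting \<open>s'\<close> tend to \<open>s\<close>, continuity squeezes the
    cover of \<open>K\<close> into every neighbourhood of \<open>F s\<close>.\<close>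
  have Keq: "y = F s" if y: "y \<in> K" for y
  proof (rule ccontr)
    assume "y \<noteq> F s"
    then have "0 < dist y (F s)" "s \<in> {0..T}"
      using s xr by auto
    then obtain d' where d': "0 < d'" "\<And>p. p \<in> {0..T} \<Longrightarrow> dist p s < d' \<Longrightarrow> dist (F p) (F s) < dist y (F s)"
      using F unfolding continuous_on_iff by metis
    define s' where "s' = max 0 (s - min d d' / 2)"
    have s': "0 \<le> s'" "s' < s" "s - s' < d" "s - s' < d'"
      using s_pos d(1) d'(1) by (auto simp: s'_def max_def)
    obtain p where "p \<in> {s'..s}" "y = F p"
      using cover[OF s'(1-3)] y by blast
    then show False
      using d'(2)[of p] s' s xr by (auto simp: dist_real_def)
  qed
  show ?thesis
    using Keq[of "F t"] Keq[of "F x"] t Fx by (auto simp: K_def)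
qed

text \<open>If the path ended away from \<open>F u\<close>, there would be pieces on both sides of
  \<open>u\<close> that avoid \<open>w\<close> and have their far ends off \<open>F u\<close>. One
  of them contains the far end value of the other, which closes a loop through \<open>u\<close>, and
  \<open>loop\<close> makes that value equal to \<open>F u\<close>. Here \<open>nest\<close>
  compares a piece ending at \<open>u\<close> with one starting at \<open>u\<close>.\<close>

lemma path_constant_above:
  fixes F :: "real \<Rightarrow> 'b::metric_space"
  assumes F: "continuous_on {0..T} F" and F0: "F 0 = w"
    and loop: "\<And>x r t. \<lbrakk>0 \<le> x; r \<le> T; F x = F r; w \<notin> F ` {x..r}; t \<in> {x..r}\<rbrakk> \<Longrightarrow> F t = F x"
    and u: "0 \<le> u" "u \<le> T" "F u \<noteq> w"
    and nest: "\<And>a b. \<lbrakk>0 \<le> a; a \<le> u; u \<le> b; b \<le> T; w \<notin> F ` {a..u}; w \<notin> F ` {u..b}\<rbrakk>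
      \<Longrightarrow> F ` {a..u} \<subseteq> F ` {u..b} \<or> F ` {u..b} \<subseteq> F ` {a..u}"
  shows "F T = F u"
proof (rule ccontr)
  assume ne: "F T \<noteq> F u"
  obtain b where b: "b \<in> {u..T}" "F b \<noteq> F u" "w \<notin> F ` {u..b}"
    using path_avoiding_right[of u T F w] continuous_on_subset[OF F] u ne by auto
  obtain a where a: "a \<in> {0..u}" "F a \<noteq> F u" "w \<notin> F ` {a..u}"
    using path_avoiding_left[of 0 u F w] continuous_on_subset[OF F, of "{0..u}"] u F0 by auto
  have no: "w \<notin> F ` {p..q}" if "a \<le> p" "q \<le> b" for p q
  proof
    assume "w \<in> F ` {p..q}"
    then obtain y where "y \<in> {p..q}" "w = F y" by blast
    then show False
      using a b that by (cases "y \<le> u") auto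
  qed
  consider "F ` {a..u} \<subseteq> F ` {u..b}" | "F ` {u..b} \<subseteq> F ` {a..u}"
    using nest[of a b] a b by auto
  then show False
  proof cases
    case 1
    then obtain t where t: "t \<in> {u..b}" "F a = F t"
      using a by (metis atLeastAtMost_iff imageE imageI order_refl subsetD)
    then have "F u = F a"
      using loop[of a t u] no[of a t] a b by auto
    then show False using a by simp
  next
    case 2
    then obtain t where t: "t \<in> {a..u}" "F b = F t"
      using b by (metis atLeastAtMost_iff imageE imageI order_refl subsetD)
    then have "F u = F t"
      using loop[of t b u] no[of t b] a b by auto
    then show False using t b by simp
  qed
qed

section \<open>Segments of legs and their limits\<close>

context rooted_fan
begin

text \<open>The order interval from \<open>s\<close> to \<open>x\<close>; for \<open>x\<close> in
  \<open>X\<close> it is empty unless \<open>s\<close> lies below \<open>x\<close>. Avoiding heights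
  in the definition makes both conditions closed relations, which is what limits need.\<close>

definition seg :: "'a \<Rightarrow> 'a \<Rightarrow> 'a set" where
  "seg s x = {z \<in> A x. s \<in> A z}"

lemma A_as_mu: "x \<in> X \<Longrightarrow> y \<in> A x \<Longrightarrow> A y = {z \<in> A x. mu z \<le> mu y}"
  using mu_le_iff A_trans by blast

lemma seg_pt: "x \<in> X \<Longrightarrow> s \<in> A x \<Longrightarrow> seg s x = pt x ` {mu s..mu x}"
  using mu_le_iff mu_nonneg A_in mu_le by (auto simp: seg_def pt_image)

lemma seg_pt_pt:
  assumes "x \<in> X" "0 \<le> a" "a \<le> b" "b \<le> mu x"
  shows "seg (pt x a) (pt x b) = pt x ` {a..b}"
proof -
  have *: "pt x a \<in> A x" "pt x b \<in> A x" "mu (pt x a) = a" "mu (pt x b) = b"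
    using pt_in mu_pt assms by auto
  have "seg (pt x a) (pt x b) = {z \<in> A x. mu z \<le> b \<and> pt x a \<in> A z}"
    using A_as_mu[OF assms(1) *(2)] *(4) by (auto simp: seg_def)
  also have "\<dots> = {z \<in> A x. a \<le> mu z \<and> mu z \<le> b}"
    using mu_le_iff[OF assms(1) *(1)] *(3) by auto
  finally show ?thesis
    using pt_image assms by simp
qed

lemma seg_continuum: "x \<in> X \<Longrightarrow> s \<in> A x \<Longrightarrow> continuum (seg s x)"
  using seg_pt continuum_pt_image mu_nonneg A_in mu_le by simp

lemma seg_sub: "x \<in> X \<Longrightarrow> seg s x \<subseteq> X" "seg s x \<subseteq> A x"
  using A_sub by (auto simp: seg_def)

lemma seg_ends: "x \<in> X \<Longrightarrow> s \<in> A x \<Longrightarrow> s \<in> seg s x" "x \<in> X \<Longrightarrow> s \<in> A x \<Longrightarrow> x \<in> seg s x"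
  using A_self A_in by (auto simp: seg_def)

lemma seg_root: "x \<in> X \<Longrightarrow> v \<in> seg s x \<Longrightarrow> s = v"
  using A_of_root by (auto simp: seg_def)

lemma seg_mono: "x \<in> X \<Longrightarrow> s \<in> A t \<Longrightarrow> seg t x \<subseteq> seg s x"
  using A_trans A_in by (fastforce simp: seg_def)

lemma seg_limit:
  assumes x: "\<And>n. x n \<in> X" "x \<longlonglongrightarrow> x0" and s: "s \<longlonglongrightarrow> s0"
    and z: "\<And>n. z n \<in> seg (s n) (x n)" "z \<longlonglongrightarrow> z0"
  shows "z0 \<in> seg s0 x0"
proof -
  have "z0 \<in> A x0"
    using graph_closed(2)[OF x _ z(2)] z(1) by (auto simp: seg_def)
  moreover have "s0 \<in> A z0"
    using graph_closed(2)[OF _ z(2) _ s] z(1) seg_sub x(1) by (auto simp: seg_def A_in)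
  ultimately show ?thesis
    by (simp add: seg_def)
qed

text \<open>Used in contrapositive form: when \<open>f\<close> omits the value \<open>c\<close> on
  the limit segment, almost all nearby segments omit the nearby values \<open>g n\<close>.
  Compactness supplies convergent witnesses.\<close>

lemma seg_frequently:
  fixes f :: "'a \<Rightarrow> 'b::metric_space"
  assumes f: "continuous_on X f"
    and x: "\<And>n. x n \<in> X" "x \<longlonglongrightarrow> x0" and s: "s \<longlonglongrightarrow> s0"
    and g: "g \<longlonglongrightarrow> c" and ev: "\<exists>\<^sub>F n in sequentially. g n \<in> f ` seg (s n) (x n)"
  shows "c \<in> f ` seg s0 x0"
proof -
  have "infinite {n. g n \<in> f ` seg (s n) (x n)}"
    using ev by (simp add: cofinite_eq_sequentially[symmetric] frequently_cofinite)
  then obtain k :: "nat \<Rightarrow> nat" where k: "strict_mono k" "\<And>n. g (k n) \<in> f ` seg (s (k n)) (x (k n))"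
    using infinite_enumerate by blast
  then have "\<forall>n. \<exists>z. z \<in> seg (s (k n)) (x (k n)) \<and> g (k n) = f z"
    by blast
  then obtain z where z: "\<And>n. z n \<in> seg (s (k n)) (x (k n))" "\<And>n. g (k n) = f (z n)"
    by metis
  have "z n \<in> X" for n
    using z(1) seg_sub x(1) by blast
  then obtain z0 l where l: "z0 \<in> X" "strict_mono l" "(z \<circ> l) \<longlonglongrightarrow> z0"
    using X_compact unfolding compact_eq_seq_compact_metric seq_compact_def by metis
  have kl: "strict_mono (k \<circ> l)"
    using k l strict_mono_o by blast
  have "z0 \<in> seg s0 x0"
    by (rule seg_limit[of "x \<circ> (k \<circ> l)" _ "s \<circ> (k \<circ> l)" _ "z \<circ> l"])
      (use x s z l LIMSEQ_subseq_LIMSEQ[OF _ kl] in auto)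
  moreover have "(\<lambda>n. f ((z \<circ> l) n)) \<longlonglongrightarrow> f z0"
    using continuous_on_tendsto_compose[OF f l(3) l(1)] \<open>\<And>n. z n \<in> X\<close> by simp
  moreover have "(g \<circ> (k \<circ> l)) \<longlonglongrightarrow> c"
    using LIMSEQ_subseq_LIMSEQ[OF g kl] .
  ultimately have "f z0 = c"
    using LIMSEQ_unique z(2) by (auto simp: o_def)
  then show ?thesis
    using \<open>z0 \<in> seg s0 x0\<close> by blast
qed

lemma comparable_limit:
  assumes p: "\<And>n. p n \<in> X" "p \<longlonglongrightarrow> p0" and q: "\<And>n. q n \<in> X" "q \<longlonglongrightarrow> q0"
    and c: "\<And>n. p n \<in> A (q n) \<or> q n \<in> A (p n)"
  shows "p0 \<in> A q0 \<or> q0 \<in> A p0"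
proof (cases "infinite {n. p n \<in> A (q n)}")
  case True
  then obtain k :: "nat \<Rightarrow> nat" where k: "strict_mono k" "\<And>n. p (k n) \<in> A (q (k n))"
    using infinite_enumerate by blast
  then show ?thesis
    using graph_closed(2)[of "q \<circ> k" q0 "p \<circ> k" p0] p(1) q(1)
      LIMSEQ_subseq_LIMSEQ[OF p(2) k(1)] LIMSEQ_subseq_LIMSEQ[OF q(2) k(1)] by simp
next
  case False
  moreover have "UNIV = {n. p n \<in> A (q n)} \<union> {n. q n \<in> A (p n)}"
    using c by auto
  ultimately have "infinite {n. q n \<in> A (p n)}"
    by (metis finite_Un infinite_UNIV_nat)
  then obtain k :: "nat \<Rightarrow> nat" where k: "strict_mono k" "\<And>n. q (k n) \<in> A (p (k n))"
    using infinite_enumerate by blast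
  then show ?thesis
    using graph_closed(2)[of "p \<circ> k" p0 "q \<circ> k" q0] p(1) q(1)
      LIMSEQ_subseq_LIMSEQ[OF p(2) k(1)] LIMSEQ_subseq_LIMSEQ[OF q(2) k(1)] by simp
qed

end

lemma LIMSEQ_inverse_Suc:
  assumes "\<And>n. dist (x n) y < 1 / Suc n"
  shows "x \<longlonglongrightarrow> y"
  unfolding lim_sequentially
proof (intro allI impI)
  fix r :: real assume "0 < r"
  then obtain N where N: "1 / real (Suc N) < r"
    using nat_approx_posE by metis
  have "dist (x n) y < r" if "N \<le> n" for n
    using assms[of n] that N by (smt (verit) Suc_le_mono frac_le of_nat_0_less_iff of_nat_mono zero_less_Suc)
  then show "\<exists>no. \<forall>n\<ge>no. dist (x n) y < r"
    by blast
qed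

section \<open>Lifting continua through an open map, and nestedness\<close>

locale open_image = lelek_rooted_fan X v A
  for X :: "'a::metric_space set" and v A +
  fixes f :: "'a \<Rightarrow> 'b::metric_space" and Y :: "'b set"
  assumes f_cont: "continuous_on X f" and f_im: "f ` X = Y" and f_open: "open_map_on X f"
    and Y_nondeg: "nondegenerate Y"
begin

lemma f_in: "x \<in> X \<Longrightarrow> f x \<in> Y"
  using f_im by blast

lemma f_tendsto: "\<lbrakk>\<And>n. s n \<in> X; s \<longlonglongrightarrow> x; x \<in> X\<rbrakk> \<Longrightarrow> (\<lambda>n. f (s n)) \<longlonglongrightarrow> f x"
  using continuous_on_tendsto_compose[OF f_cont, of s x sequentially] by simp

lemma Y_continuum: "continuum Y"
  using X_continuum f_im compact_continuous_image[OF f_cont] connected_continuous_image[OF f_cont]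
  unfolding continuum_def by auto

lemma f_image_continuum: "K \<subseteq> X \<Longrightarrow> continuum K \<Longrightarrow> continuum (f ` K) \<and> f ` K \<subseteq> Y"
  using f_im continuous_on_subset[OF f_cont] compact_continuous_image connected_continuous_image
  unfolding continuum_def by blast

text \<open>This is confluence of open maps. If no connected subset of the preimage of
  \<open>K\<close> joins \<open>x\<close> to the fibre of \<open>y\<close>, a partition of the
  preimage into compact sets \<open>U\<close> and \<open>V\<close> separates them. The image of
  \<open>U\<close> is compact, and it is relatively open in \<open>K\<close> because it is cut out
  by the open image of \<open>X\<close> minus \<open>V\<close>; so it is all of \<open>K\<close>,
  although it omits \<open>y\<close>.\<close>

lemma lift_point:
  assumes K: "continuum K" "K \<subseteq> Y" and x: "x \<in> X" "f x \<in> K" and y: "y \<in> K"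
  shows "\<exists>C. connected C \<and> C \<subseteq> X \<inter> f -` K \<and> x \<in> C \<and> y \<in> f ` C"
proof (rule ccontr)
  assume no: "\<not> ?thesis"
  define G where "G = X \<inter> f -` K"
  have Kcl: "closed K"
    using K(1) compact_imp_closed continuum_def by blast
  have pre: "closed (X \<inter> f -` S)" if "closed S" for S
    using continuous_closed_preimage[OF f_cont compact_imp_closed[OF X_compact] that] .
  have G: "compact G"
    unfolding G_def using compact_Int_closed[OF X_compact pre[OF Kcl]] by (simp add: Int_absorb1 inf_assoc[symmetric])
  define T where "T = X \<inter> f -` {y}"
  have T: "closed T" "T \<subseteq> G"
    using pre[of "{y}"] y by (auto simp: T_def G_def)
  have "\<exists>U V. U \<union> V = G \<and> U \<inter> V = {} \<and> {x} \<subseteq> U \<and> T \<subseteq> V \<and> compact U \<and> compact V"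
  proof (rule compact_separation[OF G])
    fix C assume C: "connected C" "C \<subseteq> G"
    show "C \<inter> {x} = {} \<or> C \<inter> T = {}"
    proof (rule ccontr)
      assume "\<not> ?thesis"
      then have "x \<in> C" "y \<in> f ` C"
        by (auto simp: T_def)
      then show False
        using no C unfolding G_def by blast
    qed
  qed (use T x in \<open>auto simp: G_def\<close>)
  then obtain U V where UV: "U \<union> V = G" "U \<inter> V = {}" "x \<in> U" "T \<subseteq> V" "compact U" "compact V"
    by auto
  have "openin (top_of_set X) (X \<inter> - V)"
    using UV(6) compact_imp_closed by (intro openin_open_Int) auto
  then have "openin (top_of_set Y) (f ` (X \<inter> - V))"
    using f_open f_im unfolding open_map_on_def by blast
  then obtain W where W: "open W" "f ` (X \<inter> - V) = Y \<inter> W"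
    unfolding openin_open by blast
  have fU: "f ` U = K \<inter> W"
  proof
    show "f ` U \<subseteq> K \<inter> W"
      using UV(1,2) W(2) by (auto simp: G_def)
    show "K \<inter> W \<subseteq> f ` U"
    proof
      fix z assume z: "z \<in> K \<inter> W"
      then have "z \<in> f ` (X \<inter> - V)"
        using W(2) K(2) by blast
      then obtain p where "p \<in> X" "p \<notin> V" "f p = z"
        by blast
      then show "z \<in> f ` U"
        using UV(1) z by (auto simp: G_def)
    qed
  qed
  have "compact (f ` U)"
    by (rule compact_continuous_image[OF continuous_on_subset[OF f_cont] UV(5)])
      (use UV(1) G_def in auto)
  then have "closedin (top_of_set K) (f ` U)"
    using fU compact_imp_closed by (intro closed_subset) auto
  moreover have "openin (top_of_set K) (f ` U)"
    unfolding fU using W(1) by (rule openin_open_Int)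
  ultimately have "f ` U = {} \<or> f ` U = K"
    using K(1) unfolding continuum_def connected_clopen by blast
  then have "y \<in> f ` U"
    using UV(3) y by blast
  then obtain p where "p \<in> U" "f p = y"
    by blast
  then have "p \<in> T"
    using UV(1) by (auto simp: T_def G_def)
  then show False
    using UV(2,4) \<open>p \<in> U\<close> by blast
qed

text \<open>One continuum serves all points of \<open>K\<close>: the component of \<open>x\<close>
  in the preimage of \<open>K\<close> contains every connected set produced by
  \<open>lift_point\<close>.\<close>

lemma lift_continuum:
  assumes K: "continuum K" "K \<subseteq> Y" and x: "x \<in> X" "f x \<in> K"
  shows "\<exists>C. continuum C \<and> C \<subseteq> X \<and> x \<in> C \<and> f ` C = K"
proof -
  define G where "G = X \<inter> f -` K"
  have "closed G"
    unfolding G_def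
    using continuous_closed_preimage[OF f_cont compact_imp_closed[OF X_compact]] K(1) compact_imp_closed
    by (auto simp: continuum_def)
  then have G: "compact G"
    using compact_Int_closed[OF X_compact, of G] by (simp add: G_def Int_absorb1 inf_assoc[symmetric])
  define C where "C = connected_component_set G x"
  have xG: "x \<in> G"
    using x by (simp add: G_def)
  have CG: "C \<subseteq> G"
    unfolding C_def by (rule connected_component_subset)
  have "closedin (top_of_set G) C"
    unfolding C_def by (rule closedin_connected_component)
  then have "compact C"
    using G closedin_compact by blast
  moreover have "connected C" "x \<in> C"
    using xG by (auto simp: C_def)
  moreover have "f ` C = K"
  proof
    show "f ` C \<subseteq> K"
      using CG by (auto simp: G_def)
    show "K \<subseteq> f ` C"
    proof
      fix y assume "y \<in> K"
      then obtain D where D: "connected D" "D \<subseteq> G" "x \<in> D" "y \<in> f ` D"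
        using lift_point[OF K x] unfolding G_def by blast
      then have "D \<subseteq> C"
        unfolding C_def by (intro connected_component_maximal)
      then show "y \<in> f ` C"
        using D by blast
    qed
  qed
  ultimately show ?thesis
    using CG by (intro exI[of _ C]) (auto simp: continuum_def G_def)
qed

text \<open>Lifts of \<open>K\<close> and \<open>M\<close> through \<open>e\<close> miss
  \<open>v\<close>, so by maximality of \<open>e\<close> they lie in the chain \<open>A e\<close>.
  Both are convex and contain its top \<open>e\<close>, hence one contains the other.\<close>

lemma nested_at_max:
  assumes e: "e \<in> maxs" and K: "continuum K" "K \<subseteq> Y" "f e \<in> K" "f v \<notin> K"
    and M: "continuum M" "M \<subseteq> Y" "f e \<in> M" "f v \<notin> M"
  shows "K \<subseteq> M \<or> M \<subseteq> K"
proof -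
  have eX: "e \<in> X"
    using e maxsD by blast
  obtain C where C: "continuum C" "C \<subseteq> X" "e \<in> C" "f ` C = K"
    using lift_continuum[OF K(1,2) eX K(3)] by blast
  obtain D where D: "continuum D" "D \<subseteq> X" "e \<in> D" "f ` D = M"
    using lift_continuum[OF M(1,2) eX M(3)] by blast
  have below: "z \<in> A e" if "continuum B" "B \<subseteq> X" "e \<in> B" "v \<notin> B" "z \<in> B" for B z
    using continuum_chain[OF that(1,2,4,3,5)] maxsD(2)[OF e, of z] A_self[OF eX] that by blast
  have "v \<notin> C" "v \<notin> D"
    using C D K M by auto
  then have sub: "C \<subseteq> A e" "D \<subseteq> A e"
    using below C D by blast+
  have "C \<subseteq> D \<or> D \<subseteq> C"
  proof (rule ccontr)
    assume "\<not> ?thesis"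
    then obtain c d where cd: "c \<in> C" "c \<notin> D" "d \<in> D" "d \<notin> C"
      by blast
    have "c \<in> A d \<or> d \<in> A c"
      using A_linear[OF eX] sub cd by blast
    then show False
    proof
      assume "c \<in> A d"
      then show False
        using continuum_convex[OF C(1,2) cd(1) _ C(3)] sub cd by blast
    next
      assume "d \<in> A c"
      then show False
        using continuum_convex[OF D(1,2) cd(3) _ D(3)] sub cd by blast
    qed
  qed
  then show ?thesis
    using C D by blast
qed

lemma open_lift:
  assumes r: "r \<in> X" and d: "0 < d"
  shows "\<exists>\<eta>>0. \<forall>y\<in>Y. dist y (f r) < \<eta> \<longrightarrow> (\<exists>r'\<in>X. dist r' r < d \<and> f r' = y)"
proof -
  have "openin (top_of_set Y) (f ` (X \<inter> ball r d))"
    using f_open f_im unfolding open_map_on_def by (metis open_ball openin_open_Int)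
  moreover have "f r \<in> f ` (X \<inter> ball r d)"
    using r d by simp
  ultimately obtain \<eta> where "0 < \<eta>" "ball (f r) \<eta> \<inter> Y \<subseteq> f ` (X \<inter> ball r d)"
    unfolding openin_contains_ball by blast
  then show ?thesis
    by (intro exI[of _ \<eta>]) (force simp: dist_commute)
qed

text \<open>Nestedness passes to limits. End points \<open>e\<close> approach \<open>x\<close>,
  openness supplies \<open>r'\<close> near \<open>r\<close> with \<open>f r' = f e\<close>, and
  lower semicontinuity supplies lower ends near \<open>a\<close> and \<open>b\<close>.
  \<open>nested_at_max\<close> applies to the perturbed segments, but the witnesses \<open>a\<close>
  and \<open>b\<close> of non-inclusion persist under small perturbations.\<close>

lemma nested_below:
  assumes x: "x \<in> X" "s \<in> A x" "f v \<notin> f ` seg s x" and r: "r \<in> X" "t \<in> A r" "f v \<notin> f ` seg t r"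
    and eq: "f x = f r"
  shows "f ` seg s x \<subseteq> f ` seg t r \<or> f ` seg t r \<subseteq> f ` seg s x"
proof (rule ccontr)
  assume "\<not> ?thesis"
  then obtain a b where ab: "a \<in> seg s x" "f a \<notin> f ` seg t r" "b \<in> seg t r" "f b \<notin> f ` seg s x"
    by blast
  have a: "a \<in> A x" "s \<in> A a" and b: "b \<in> A r" "t \<in> A b"
    using ab by (auto simp: seg_def)
  have aX: "a \<in> X" and bX: "b \<in> X"
    using a b A_in x r by auto
  have sub: "seg a x \<subseteq> seg s x" "seg b r \<subseteq> seg t r"
    using seg_mono x r a b by auto
  have "\<exists>e a' r' b'. e \<in> maxs \<and> dist e x < \<epsilon> \<and> a' \<in> A e \<and> dist a' a < \<epsilon> \<and>
      r' \<in> X \<and> dist r' r < \<epsilon> \<and> f r' = f e \<and> b' \<in> A r' \<and> dist b' b < \<epsilon>" if \<epsilon>: "0 < \<epsilon>" for \<epsilon>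
  proof -
    \<comment> \<open>The radii are chosen backwards: \<open>r'\<close> must be close enough to
      \<open>r\<close> for \<open>b'\<close> to exist, and \<open>e\<close> close enough to
      \<open>x\<close> for \<open>r'\<close> and \<open>a'\<close> to exist.\<close>
    obtain d0 where d0: "0 < d0" "\<And>y. y \<in> X \<Longrightarrow> dist y r < d0 \<Longrightarrow> \<exists>c\<in>A y. dist c b < \<epsilon>"
      using lsc_dist[OF r(1) b(1) \<epsilon>] by blast
    obtain \<eta> where \<eta>: "0 < \<eta>" "\<And>y. y \<in> Y \<Longrightarrow> dist y (f r) < \<eta> \<Longrightarrow> \<exists>r'\<in>X. dist r' r < min d0 \<epsilon> \<and> f r' = y"
      using open_lift[OF r(1), of "min d0 \<epsilon>"] d0(1) \<epsilon> by auto
    obtain d1 where d1: "0 < d1" "\<And>y. y \<in> X \<Longrightarrow> dist y x < d1 \<Longrightarrow> dist (f y) (f x) < \<eta>"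
      using f_cont x(1) \<eta>(1) unfolding continuous_on_iff by metis
    obtain d2 where d2: "0 < d2" "\<And>y. y \<in> X \<Longrightarrow> dist y x < d2 \<Longrightarrow> \<exists>c\<in>A y. dist c a < \<epsilon>"
      using lsc_dist[OF x(1) a(1) \<epsilon>] by blast
    obtain e where e: "e \<in> maxs" "dist e x < min \<epsilon> (min d1 d2)"
      using maxs_approx[OF x(1), of "min \<epsilon> (min d1 d2)"] \<epsilon> d1(1) d2(1) by auto
    have eX: "e \<in> X"
      using e maxsD by blast
    obtain a' where a': "a' \<in> A e" "dist a' a < \<epsilon>"
      using d2(2)[OF eX] e by auto
    obtain r' where r': "r' \<in> X" "dist r' r < min d0 \<epsilon>" "f r' = f e"
      using \<eta>(2)[of "f e"] d1(2)[OF eX] e f_in[OF eX] eq by auto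
    obtain b' where "b' \<in> A r'" "dist b' b < \<epsilon>"
      using d0(2)[OF r'(1)] r' by auto
    then show ?thesis
      using e a' r' by (intro exI[of _ e] exI[of _ a'] exI[of _ r'] exI[of _ b']) auto
  qed
  then have "\<forall>n. \<exists>e a' r' b'. e \<in> maxs \<and> dist e x < 1 / Suc n \<and> a' \<in> A e \<and> dist a' a < 1 / Suc n \<and>
      r' \<in> X \<and> dist r' r < 1 / Suc n \<and> f r' = f e \<and> b' \<in> A r' \<and> dist b' b < 1 / Suc n"
    by simp
  then obtain e a' r' b' where seqs: "\<And>n. e n \<in> maxs" "\<And>n. dist (e n) x < 1 / Suc n"
      "\<And>n. a' n \<in> A (e n)" "\<And>n. dist (a' n) a < 1 / Suc n" "\<And>n. r' n \<in> X" "\<And>n. dist (r' n) r < 1 / Suc n"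
      "\<And>n. f (r' n) = f (e n)" "\<And>n. b' n \<in> A (r' n)" "\<And>n. dist (b' n) b < 1 / Suc n"
    by metis
  have eX: "e n \<in> X" for n
    using seqs maxsD by blast
  have lims: "e \<longlonglongrightarrow> x" "a' \<longlonglongrightarrow> a" "r' \<longlonglongrightarrow> r" "b' \<longlonglongrightarrow> b"
    using seqs by (auto intro!: LIMSEQ_inverse_Suc simp del: of_nat_Suc)
  have a'X: "a' n \<in> X" and b'X: "b' n \<in> X" for n
    using seqs eX A_in by blast+
  \<comment> \<open>If neither image contains \<open>f v\<close>, one contains the other and hence
    the image of the other's lower end. Each of the four cases fails for large
    \<open>n\<close>.\<close>
  have main: "f v \<in> f ` seg (a' n) (e n) \<or> f v \<in> f ` seg (b' n) (r' n) \<or>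
      f (a' n) \<in> f ` seg (b' n) (r' n) \<or> f (b' n) \<in> f ` seg (a' n) (e n)" for n
  proof -
    have 1: "continuum (f ` seg (a' n) (e n))" "f ` seg (a' n) (e n) \<subseteq> Y"
       "continuum (f ` seg (b' n) (r' n))" "f ` seg (b' n) (r' n) \<subseteq> Y"
      using f_image_continuum[OF seg_sub(1)[OF eX] seg_continuum[OF eX seqs(3)]]
        f_image_continuum[OF seg_sub(1)[OF seqs(5)] seg_continuum[OF seqs(5) seqs(8)]] by blast+
    have "f (e n) \<in> f ` seg (a' n) (e n)" "f (e n) \<in> f ` seg (b' n) (r' n)"
      using seg_ends(2)[OF eX seqs(3)] imageI[OF seg_ends(2)[OF seqs(5) seqs(8)], of f n] seqs(7)[of n]
      by simp_all
    then show ?thesis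
      using nested_at_max[OF seqs(1) 1(1,2) _ _ 1(3,4)] imageI[OF seg_ends(1)[OF eX seqs(3)], of f n]
        imageI[OF seg_ends(1)[OF seqs(5) seqs(8)], of f n] by blast
  qed
  have "\<forall>\<^sub>F n in sequentially. f v \<notin> f ` seg (a' n) (e n)"
    using seg_frequently[OF f_cont eX lims(1,2), of "\<lambda>n. f v" "f v"] x(3) sub
    unfolding not_frequently[symmetric] by blast
  moreover have "\<forall>\<^sub>F n in sequentially. f v \<notin> f ` seg (b' n) (r' n)"
    using seg_frequently[OF f_cont seqs(5) lims(3,4), of "\<lambda>n. f v" "f v"] r(3) sub
    unfolding not_frequently[symmetric] by blast
  moreover have "\<forall>\<^sub>F n in sequentially. f (a' n) \<notin> f ` seg (b' n) (r' n)"
    using seg_frequently[OF f_cont seqs(5) lims(3,4) f_tendsto[OF a'X lims(2) aX]] ab sub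
    unfolding not_frequently[symmetric] by blast
  moreover have "\<forall>\<^sub>F n in sequentially. f (b' n) \<notin> f ` seg (a' n) (e n)"
    using seg_frequently[OF f_cont eX lims(1,2) f_tendsto[OF b'X lims(4) bX]] ab sub
    unfolding not_frequently[symmetric] by blast
  ultimately have "\<forall>\<^sub>F n::nat in sequentially. False"
  proof eventually_elim
    case (elim n)
    then show ?case using main[of n] by blast
  qed
  then show False
    by simp
qed

lemma path_cont: "x \<in> X \<Longrightarrow> continuous_on {0..mu x} (\<lambda>t. f (pt x t))"
  by (rule continuous_on_compose2[OF f_cont pt_continuous]) (use pt_in A_in in auto)

lemma path_nested:
  assumes x: "x \<in> X" and ab: "0 \<le> a" "a \<le> b" "b \<le> mu x" "0 \<le> a'" "a' \<le> b'" "b' \<le> mu x"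
    and eq: "f (pt x b) = f (pt x b')"
    and w: "f v \<notin> (\<lambda>t. f (pt x t)) ` {a..b}" "f v \<notin> (\<lambda>t. f (pt x t)) ` {a'..b'}"
  shows "(\<lambda>t. f (pt x t)) ` {a..b} \<subseteq> (\<lambda>t. f (pt x t)) ` {a'..b'} \<or>
         (\<lambda>t. f (pt x t)) ` {a'..b'} \<subseteq> (\<lambda>t. f (pt x t)) ` {a..b}"
proof -
  have im: "(\<lambda>t. f (pt x t)) ` {c..d} = f ` seg (pt x c) (pt x d)" if "0 \<le> c" "c \<le> d" "d \<le> mu x" for c d
    using seg_pt_pt[OF x that] by (simp add: image_image)
  have in1: "pt x d \<in> X" "pt x c \<in> A (pt x d)" if "0 \<le> c" "c \<le> d" "d \<le> mu x" for c d
  proof -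
    show "pt x d \<in> X"
      using pt_in[OF x, of d] that A_in[OF x] by auto
    show "pt x c \<in> A (pt x d)"
      using mu_le_iff[OF x pt_in[OF x] pt_in[OF x], of c d] mu_pt[OF x] that by auto
  qed
  show ?thesis
    using nested_below[OF in1[OF ab(1-3)] _ in1[OF ab(4-6)] _ eq] w im[OF ab(1-3)] im[OF ab(4-6)] by simp
qed

lemma path_loop:
  assumes x: "x \<in> X" and "0 \<le> a" "b \<le> mu x" "f (pt x a) = f (pt x b)" "t \<in> {a..b}"
    "f v \<notin> (\<lambda>t. f (pt x t)) ` {a..b}"
  shows "f (pt x t) = f (pt x a)"
proof -
  have "f (pt x 0) = f v"
    using pt_0[OF x] by simp
  moreover have "a \<le> b"
    using assms(5) by simp
  ultimately show ?thesis
    using path_loop_constant[OF path_cont[OF x] _ path_nested[OF x]] assms by blast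
qed

text \<open>At the image of an end point any two continua missing \<open>f v\<close> are nested, so
  also the pieces of the path before and after \<open>u\<close>, which \<open>nested_below\<close>
  does not cover. Hence \<open>path_constant_above\<close> applies: once a leg has reached the value
  \<open>f e\<close>, its image does not move on.\<close>

lemma max_value_on_path:
  assumes x: "x \<in> X" and e: "e \<in> maxs" and u: "u \<in> A x" and eq: "f u = f e" and ne: "f e \<noteq> f v"
  shows "f x = f e"
proof -
  define t where "t = mu u"
  have t: "0 \<le> t" "t \<le> mu x" "pt x t = u"
    using mu_nonneg mu_le pt_mu A_in x u by (auto simp: t_def)
  have "f (pt x (mu x)) = f (pt x t)"
  proof (rule path_constant_above[OF path_cont[OF x], where w = "f v"])
    show "f (pt x 0) = f v"
      using pt_0[OF x] by simp
    show "f (pt x s) = f (pt x a)" if "0 \<le> a" "b \<le> mu x" "f (pt x a) = f (pt x b)"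
      "f v \<notin> (\<lambda>t. f (pt x t)) ` {a..b}" "s \<in> {a..b}" for a b s
      using path_loop[OF x that(1-3,5,4)] .
    show "(\<lambda>t. f (pt x t)) ` {a..t} \<subseteq> (\<lambda>t. f (pt x t)) ` {t..b} \<or>
        (\<lambda>t. f (pt x t)) ` {t..b} \<subseteq> (\<lambda>t. f (pt x t)) ` {a..t}"
      if ab: "0 \<le> a" "a \<le> t" "t \<le> b" "b \<le> mu x" and w: "f v \<notin> (\<lambda>t. f (pt x t)) ` {a..t}"
        "f v \<notin> (\<lambda>t. f (pt x t)) ` {t..b}" for a b
    proof (rule nested_at_max[OF e])
      have *: "continuum ((\<lambda>t. f (pt x t)) ` {c..d}) \<and> (\<lambda>t. f (pt x t)) ` {c..d} \<subseteq> Y"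
        if "0 \<le> c" "c \<le> d" "d \<le> mu x" for c d
        using f_image_continuum[OF continuum_pt_image(2,1)[OF x that]] by (simp add: image_image)
      show "continuum ((\<lambda>t. f (pt x t)) ` {a..t})" "(\<lambda>t. f (pt x t)) ` {a..t} \<subseteq> Y"
        using *[of a t] ab t by auto
      show "continuum ((\<lambda>t. f (pt x t)) ` {t..b})" "(\<lambda>t. f (pt x t)) ` {t..b} \<subseteq> Y"
        using *[of t b] ab t by auto
      show "f e \<in> (\<lambda>t. f (pt x t)) ` {a..t}" "f e \<in> (\<lambda>t. f (pt x t)) ` {t..b}"
        using t eq ab by (auto intro!: image_eqI[of _ _ t])
    qed (use w in auto)
  qed (use t eq ne in auto)
  then show ?thesis
    using t eq pt_top[OF x] by simp
qed

text \<open>If \<open>x\<close> were a second point over \<open>f v\<close>, every value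
  \<open>f y\<close> would be taken at a point comparable with \<open>x\<close>, hence on the single
  leg \<open>A e\<close> through \<open>x\<close>. By \<open>max_value_on_path\<close> all end
  points would then have value \<open>f v\<close> or \<open>f e\<close>, so by density
  \<open>Y\<close> would be finite, which a nondegenerate continuum is not.\<close>

lemma root_fibre:
  assumes x: "x \<in> X" and fx: "f x = f v"
  shows "x = v"
proof (rule ccontr)
  assume xv: "x \<noteq> v"
  have hit: "\<exists>u\<in>X. (u \<in> A x \<or> x \<in> A u) \<and> f u = f y" if y: "y \<in> X" for y
  proof (cases "f y = f v")
    case True
    then show ?thesis using x fx A_self by metis
  next
    case False
    define F where "F t = f (pt y t)" for t
    have F: "continuous_on {0..mu y} F"
      unfolding F_def using path_cont[OF y] .
    have F0: "F 0 = f v" "F (mu y) = f y"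
      using pt_0[OF y] pt_top[OF y] by (auto simp: F_def)
    define C where "C = {t \<in> {0..mu y}. F t = f v}"
    have "compact C"
      using compact_level_Icc[OF F, of "{f v}"] by (simp add: C_def)
    moreover have "C \<noteq> {}"
      using F0 mu_nonneg[OF y] by (force simp: C_def)
    ultimately obtain r where r: "r \<in> C" "\<And>s. s \<in> C \<Longrightarrow> s \<le> r"
      using compact_attains_sup by metis
    have r': "0 \<le> r" "r < mu y" "F r = f v"
      using r(1) F0 False by (auto simp: C_def less_le)
    have "\<exists>p q. p \<in> X \<and> q \<in> X \<and> dist p x < \<epsilon> \<and> f q = f y \<and> (p \<in> A q \<or> q \<in> A p)" if \<epsilon>: "0 < \<epsilon>" for \<epsilon>
    proof -
      obtain \<eta> where \<eta>: "0 < \<eta>" "\<And>z. z \<in> Y \<Longrightarrow> dist z (f x) < \<eta> \<Longrightarrow> \<exists>p\<in>X. dist p x < \<epsilon> \<and> f p = z"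
        using open_lift[OF x \<epsilon>] by blast
      have "r \<in> {0..mu y}"
        using r' by simp
      then obtain d where d: "0 < d" "\<And>s. s \<in> {0..mu y} \<Longrightarrow> dist s r < d \<Longrightarrow> dist (F s) (F r) < \<eta>"
        using F \<eta>(1) unfolding continuous_on_iff by metis
      \<comment> \<open>Just after the last visit \<open>r\<close> of the path to \<open>f v\<close>
        the value \<open>F t\<close> is close to \<open>f x = f v\<close>, so openness lifts it to a
        point \<open>p\<close> near \<open>x\<close>. The path from \<open>t\<close> on misses
        \<open>f v\<close>, hence its lift through \<open>p\<close> misses \<open>v\<close> and
        consists of comparable points.\<close>
      define t where "t = min (mu y) (r + d/2)"
      have t: "r < t" "t \<le> mu y" "0 \<le> t" "dist t r < d"
        using r' d(1) by (auto simp: t_def dist_real_def)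
      have Ft: "dist (F t) (f x) < \<eta>"
        using d(2)[of t] t r' fx by simp
      define K where "K = F ` {t..mu y}"
      have K: "continuum K" "K \<subseteq> Y"
        using f_image_continuum[OF continuum_pt_image(2,1)[OF y t(3,2) order_refl]]
        by (simp_all add: K_def F_def image_image)
      have FtK: "F t \<in> K"
        using t by (auto simp: K_def)
      have "F (mu y) \<in> K"
        using t by (auto simp: K_def)
      then have FyK: "f y \<in> K"
        using F0 by simp
      have wK: "f v \<notin> K"
      proof
        assume "f v \<in> K"
        then obtain s where "s \<in> {t..mu y}" "F s = f v"
          by (auto simp: K_def)
        then show False
          using r(2)[of s] t by (auto simp: C_def)
      qed
      obtain p where p: "p \<in> X" "dist p x < \<epsilon>" "f p = F t"
        using \<eta>(2)[OF _ Ft] FtK K(2) by blast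
      obtain D where D: "continuum D" "D \<subseteq> X" "p \<in> D" "f ` D = K"
        using lift_continuum[OF K p(1)] p(3) FtK by metis
      obtain q where q: "q \<in> D" "f q = f y"
        using D(4) FyK by (metis imageE)
      have "v \<notin> D"
        using D(4) wK by blast
      then have "p \<in> A q \<or> q \<in> A p"
        using continuum_chain[OF D(1,2) _ D(3) q(1)] by blast
      then show ?thesis
        using p q D by blast
    qed
    then have "\<forall>n. \<exists>p q. p \<in> X \<and> q \<in> X \<and> dist p x < 1 / Suc n \<and> f q = f y \<and> (p \<in> A q \<or> q \<in> A p)"
      by simp
    then obtain p q where pq: "\<And>n. p n \<in> X" "\<And>n. q n \<in> X" "\<And>n. dist (p n) x < 1 / Suc n"
      "\<And>n. f (q n) = f y" "\<And>n. p n \<in> A (q n) \<or> q n \<in> A (p n)"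
      by metis
    obtain q0 l where l: "q0 \<in> X" "strict_mono l" "(q \<circ> l) \<longlonglongrightarrow> q0"
      using X_compact pq(2) unfolding compact_eq_seq_compact_metric seq_compact_def by metis
    have "(p \<circ> l) \<longlonglongrightarrow> x"
      using LIMSEQ_subseq_LIMSEQ[OF LIMSEQ_inverse_Suc[of p x] l(2)] pq(3) by blast
    then have "x \<in> A q0 \<or> q0 \<in> A x"
      using comparable_limit[of "p \<circ> l" x "q \<circ> l" q0] pq l by simp
    moreover have "(\<lambda>n. f ((q \<circ> l) n)) \<longlonglongrightarrow> f q0"
      by (rule f_tendsto[OF _ l(3,1)]) (use pq in auto)
    then have "f q0 = f y"
      using pq(4) LIMSEQ_unique[OF _ tendsto_const] by (simp add: o_def)
    ultimately show ?thesis
      using l(1) by blast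
  qed
  obtain e where e: "e \<in> maxs" "x \<in> A e"
    using maximal_above[OF x] by blast
  have eX: "e \<in> X"
    using e maxsD by blast
  have leg: "u \<in> A e" if u: "u \<in> X" "u \<in> A x \<or> x \<in> A u" for u
  proof -
    have "u \<in> A e" if "x \<in> A u"
      using comparable_of_meet[OF u(1) eX that e(2) xv] maxsD(2)[OF e(1) u(1)] A_self[OF eX] by blast
    then show ?thesis
      using u(2) A_trans[OF eX e(2)] by blast
  qed
  have max_val: "f m \<in> {f v, f e}" if m: "m \<in> maxs" for m
  proof -
    obtain u where "u \<in> X" "u \<in> A x \<or> x \<in> A u" "f u = f m"
      using hit[of m] m maxsD by blast
    then show ?thesis
      using max_value_on_path[OF eX m, of u] leg by (metis insertCI)
  qed
  have "closed (X \<inter> f -` {f v, f e})"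
    using continuous_closed_preimage[OF f_cont compact_imp_closed[OF X_compact]] by simp
  moreover have "maxs \<subseteq> X \<inter> f -` {f v, f e}"
    using max_val maxsD by auto
  ultimately have "X \<subseteq> X \<inter> f -` {f v, f e}"
    using maxs_dense closure_minimal by (metis subset_trans)
  then have "finite Y"
    using f_im finite_subset[of Y "{f v, f e}"] by auto
  then have "\<exists>y. Y = {y}"
    using Y_continuum connected_finite_iff_sing unfolding continuum_def by blast
  then show False
    using Y_nondeg by (auto simp: nondegenerate_def)
qed

text \<open>Only the root lies over \<open>f v\<close>, so for \<open>x\<close> other than
  \<open>v\<close> the image of \<open>seg x r\<close> avoids \<open>f v\<close> and
  \<open>path_loop\<close> applies.\<close>

lemma fibre_convex:
  assumes r: "r \<in> X" and x: "x \<in> A r" and z: "z \<in> seg x r" and eq: "f x = f r"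
  shows "f z = f x"
proof (cases "x = v")
  case True
  then have "r = v"
    using root_fibre[OF r] eq by simp
  then show ?thesis
    using z True A_of_root by (auto simp: seg_def)
next
  case False
  have xX: "x \<in> X"
    using r x A_in by blast
  have "f v \<notin> f ` seg x r"
  proof
    assume "f v \<in> f ` seg x r"
    then obtain u where u: "u \<in> seg x r" "f u = f v"
      by force
    then have "u = v"
      using root_fibre seg_sub(1)[OF r] by blast
    then show False
      using u seg_root[OF r] False by blast
  qed
  moreover have "seg x r = pt r ` {mu x..mu r}"
    using seg_pt[OF r x] .
  moreover obtain t where "t \<in> {mu x..mu r}" "z = pt r t"
    using calculation z by auto
  ultimately show ?thesis
    using path_loop[OF r, of "mu x" "mu r" t] mu_nonneg[OF xX] pt_mu[OF r x] pt_top[OF r] eq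
    by (simp add: image_image)
qed

text \<open>Suppose \<open>f q\<close> is missing from the image of \<open>A x\<close>. The images
  of \<open>A q\<close> and \<open>seg q r\<close> cover that connected image, and each meets it, in
  \<open>f v\<close> and in \<open>f x = f r\<close>. A common value would be taken below and above
  \<open>q\<close>, hence at \<open>q\<close> by \<open>fibre_convex\<close>.\<close>

lemma image_A_eq_if_subset:
  assumes x: "x \<in> X" and r: "r \<in> X" and eq: "f x = f r" and sub: "f ` A x \<subseteq> f ` A r"
  shows "f ` A r \<subseteq> f ` A x"
proof (rule ccontr)
  assume "\<not> ?thesis"
  then obtain q where q: "q \<in> A r" "f q \<notin> f ` A x"
    by blast
  have qX: "q \<in> X"
    using q r A_in by blast
  have "connected (f ` A x)"
    using connected_continuous_image[OF continuous_on_subset[OF f_cont A_sub[OF x]] A_connected[OF x]] .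
  moreover have "closed (f ` A q)" "closed (f ` seg q r)"
    using compact_imp_closed[OF compact_continuous_image[OF continuous_on_subset[OF f_cont A_sub[OF qX]] A_compact[OF qX]]]
      f_image_continuum[OF seg_sub(1)[OF r] seg_continuum[OF r q(1)]] compact_imp_closed
    by (auto simp: continuum_def)
  moreover have "A r \<subseteq> A q \<union> seg q r"
    using A_linear[OF r q(1)] by (auto simp: seg_def)
  then have "f ` A x \<subseteq> f ` A q \<union> f ` seg q r"
    using sub by blast
  moreover have "f ` A q \<inter> f ` seg q r \<inter> f ` A x = {}"
  proof (rule ccontr)
    assume "\<not> ?thesis"
    then obtain c where c: "c \<in> f ` A q" "c \<in> f ` seg q r" "c \<in> f ` A x"
      by blast
    obtain p where p1: "p \<in> A q" "c = f p"
      using c(1) by blast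
    obtain p' where p2: "p' \<in> seg q r" "c = f p'"
      using c(2) by blast
    have p: "p \<in> A q" "p' \<in> seg q r" "f p = f p'" "f p \<in> f ` A x"
      using c p1 p2 by simp_all
    have p'X: "p' \<in> X" and qp': "q \<in> A p'"
      using p(2) A_in[OF r] by (auto simp: seg_def)
    then have "p \<in> A p'" "q \<in> seg p p'"
      using p A_trans[OF p'X qp'] by (auto simp: seg_def)
    then have "f q = f p"
      using fibre_convex[OF p'X] p(3) by blast
    then show False
      using p q by simp
  qed
  moreover have "f v \<in> f ` A q \<inter> f ` A x"
    using A_root x qX by blast
  moreover have "f r \<in> f ` seg q r \<inter> f ` A x"
    using seg_ends(2)[OF r q(1)] A_self[OF x] eq by (metis IntI imageI)
  ultimately show False
    using connected_closedD[of "f ` A x" "f ` A q" "f ` seg q r"] by blast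
qed

text \<open>Witnesses \<open>a\<close> and \<open>b\<close> of non-inclusion in both directions are
  not \<open>v\<close>, so the segments from \<open>a\<close> to \<open>x\<close> and from
  \<open>b\<close> to \<open>r\<close> avoid \<open>f v\<close>, and \<open>nested_below\<close>
  refutes them. The equality makes the choice of a preimage in \<open>B\<close> immaterial.\<close>

lemma image_A_eq:
  assumes x: "x \<in> X" and r: "r \<in> X" and eq: "f x = f r"
  shows "f ` A x = f ` A r"
proof -
  have "f ` A x \<subseteq> f ` A r \<or> f ` A r \<subseteq> f ` A x"
  proof (rule ccontr)
    assume "\<not> ?thesis"
    then obtain a b where ab: "a \<in> A x" "f a \<notin> f ` A r" "b \<in> A r" "f b \<notin> f ` A x"
      by blast
    have "a \<noteq> v" "b \<noteq> v"
      using ab A_root x r by blast+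
    then have w: "f v \<notin> f ` seg a x" "f v \<notin> f ` seg b r"
      using seg_root root_fibre seg_sub(1) x r by (metis (no_types, lifting) imageE subsetD)+
    show False
      using nested_below[OF x ab(1) w(1) r ab(3) w(2) eq] seg_ends(1)[OF x ab(1)] seg_ends(1)[OF r ab(3)]
        seg_sub(2)[of a x] seg_sub(2)[of b r] ab by blast
  qed
  then show ?thesis
    using image_A_eq_if_subset[OF x r eq] image_A_eq_if_subset[OF r x eq[symmetric]] by blast
qed

section \<open>The order on the image\<close>

definition B :: "'b \<Rightarrow> 'b set" where
  "B y = f ` A (SOME x. x \<in> X \<and> f x = y)"

lemma B_f: "x \<in> X \<Longrightarrow> B (f x) = f ` A x"
  unfolding B_def using someI[of "\<lambda>z. z \<in> X \<and> f z = f x" x] image_A_eq by blast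

text \<open>Reduces semicontinuity of \<open>B\<close> to that of \<open>A\<close>: \<open>f\<close>
  carries the closed hitting sets to closed ones by compactness and the open ones to open ones by
  hypothesis.\<close>

lemma image_hits: "{y \<in> Y. B y \<inter> S \<noteq> {}} = f ` {x \<in> X. A x \<inter> (X \<inter> f -` S) \<noteq> {}}"
proof (intro set_eqI iffI)
  fix y assume y: "y \<in> {y \<in> Y. B y \<inter> S \<noteq> {}}"
  then obtain x where x: "x \<in> X" "y = f x"
    using f_im by blast
  then obtain z where "z \<in> A x" "f z \<in> S"
    using y B_f[OF x(1)] by auto
  then have "x \<in> {x \<in> X. A x \<inter> (X \<inter> f -` S) \<noteq> {}}"
    using x A_in[OF x(1)] by blast
  then show "y \<in> f ` {x \<in> X. A x \<inter> (X \<inter> f -` S) \<noteq> {}}"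
    using x by blast
next
  fix y assume "y \<in> f ` {x \<in> X. A x \<inter> (X \<inter> f -` S) \<noteq> {}}"
  then obtain x z where "x \<in> X" "y = f x" "z \<in> A x" "f z \<in> S"
    by blast
  then show "y \<in> {y \<in> Y. B y \<inter> S \<noteq> {}}"
    using B_f[of x] f_in[of x] by blast
qed

lemma image_rooted_fan: "rooted_fan Y (f v) B"
proof
  show "compact Y" "f v \<in> Y"
    using Y_continuum f_in[OF root_in] by (auto simp: continuum_def)
  show "B (f v) = {f v}"
    using B_f[OF root_in] A_of_root by simp
  fix y assume "y \<in> Y"
  then obtain x where x: "x \<in> X" "y = f x"
    using f_im by blast
  have By: "B y = f ` A x"
    using B_f x by simp
  show "B y \<subseteq> Y"
    using By A_sub[OF x(1)] f_im by blast
  show "compact (B y)" "connected (B y)"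
    unfolding By using x A_sub A_compact A_connected continuous_on_subset[OF f_cont]
    by (meson compact_continuous_image connected_continuous_image)+
  show "y \<in> B y" "f v \<in> B y"
    unfolding By using x A_self A_root by auto
  show "B z \<subseteq> B y" if "z \<in> B y" for z
    using that B_f A_trans A_in x unfolding By by (metis imageE image_mono)
  show "z \<in> B z' \<or> z' \<in> B z" if zz': "z \<in> B y" "z' \<in> B y" for z z'
  proof -
    obtain p p' where "p \<in> A x" "p' \<in> A x" "z = f p" "z' = f p'"
      using zz' unfolding By by blast
    then show ?thesis
      using A_linear[OF x(1), of p p'] A_in[OF x(1)] B_f[of p] B_f[of p'] by blast
  qed
  show "y = z" if zy: "z \<in> B y" "y \<in> B z" for z
  proof -
    obtain q where q: "q \<in> A x" "z = f q"
      using zy(1) unfolding By by blast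
    have qX: "q \<in> X"
      using q x A_in by blast
    obtain p where p: "p \<in> A q" "y = f p"
      using zy(2) B_f[OF qX] q by auto
    have "p \<in> A x" "q \<in> seg p x"
      using p q A_trans[OF x(1) q(1)] by (auto simp: seg_def)
    then show ?thesis
      using fibre_convex[OF x(1), of p q] p q x by simp
  qed
next
  fix F :: "'b set" assume "closed F"
  then have "closed (X \<inter> f -` F)"
    using continuous_closed_preimage[OF f_cont compact_imp_closed[OF X_compact]] by simp
  then have "closed {x \<in> X. A x \<inter> (X \<inter> f -` F) \<noteq> {}}"
    by (rule A_usc)
  then have "compact (X \<inter> {x \<in> X. A x \<inter> (X \<inter> f -` F) \<noteq> {}})"
    using compact_Int_closed[OF X_compact] by blast
  moreover have "X \<inter> {x \<in> X. A x \<inter> (X \<inter> f -` F) \<noteq> {}} = {x \<in> X. A x \<inter> (X \<inter> f -` F) \<noteq> {}}"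
    by blast
  ultimately have "compact (f ` {x \<in> X. A x \<inter> (X \<inter> f -` F) \<noteq> {}})"
    using compact_continuous_image[OF continuous_on_subset[OF f_cont]] by (metis (no_types, lifting) inf_le1)
  then show "closed {y \<in> Y. B y \<inter> F \<noteq> {}}"
    unfolding image_hits by (rule compact_imp_closed)
next
  fix U :: "'b set" assume "open U"
  then have "openin (top_of_set X) (X \<inter> f -` U)"
    by (rule continuous_openin_preimage_gen[OF f_cont])
  then obtain W where W: "open W" "X \<inter> f -` U = X \<inter> W"
    unfolding openin_open by blast
  have "{x \<in> X. A x \<inter> (X \<inter> f -` U) \<noteq> {}} = {x \<in> X. A x \<inter> W \<noteq> {}}"
    unfolding W(2) using A_in by blast
  then have "openin (top_of_set X) {x \<in> X. A x \<inter> (X \<inter> f -` U) \<noteq> {}}"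
    using A_lsc[OF W(1)] by simp
  then show "openin (top_of_set Y) {y \<in> Y. B y \<inter> U \<noteq> {}}"
    unfolding image_hits using f_open f_im unfolding open_map_on_def by blast
next
  fix K y assume K: "continuum K" "K \<subseteq> Y" "f v \<in> K" "y \<in> K"
  then obtain x where x: "x \<in> X" "y = f x"
    using f_im by blast
  obtain C where C: "continuum C" "C \<subseteq> X" "x \<in> C" "f ` C = K"
    using lift_continuum[OF K(1,2) x(1)] x(2) K(4) by blast
  \<comment> \<open>The lift contains some point over \<open>f v\<close>, and by
    \<open>root_fibre\<close> that point can only be \<open>v\<close>.\<close>
  have "v \<in> C"
    using C K(3) root_fibre by (metis (no_types, lifting) imageE subsetD)
  then show "B y \<subseteq> K"
    using continuum_root[OF C(1,2) _ C(3)] C(4) B_f[OF x(1)] x(2) by blast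
next
  fix K y z assume K: "continuum K" "K \<subseteq> Y" "f v \<notin> K" "y \<in> K" "z \<in> K"
  then obtain x where x: "x \<in> X" "y = f x"
    using f_im by blast
  obtain C where C: "continuum C" "C \<subseteq> X" "x \<in> C" "f ` C = K"
    using lift_continuum[OF K(1,2) x(1)] x(2) K(4) by blast
  obtain p where p: "p \<in> C" "z = f p"
    using C(4) K(5) by blast
  have "v \<notin> C"
    using C K(3) by blast
  then have "x \<in> A p \<or> p \<in> A x"
    using continuum_chain[OF C(1,2) _ C(3) p(1)] by blast
  then show "y \<in> B z \<or> z \<in> B y"
    using B_f[OF x(1)] B_f[of p] p x C(2) by blast
qed

lemma image_lelek_rooted_fan: "lelek_rooted_fan Y (f v) B"
proof -
  interpret Y: rooted_fan Y "f v" B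
    using image_rooted_fan .
  have "f e \<in> Y.maxs" if e: "e \<in> maxs" for e
  proof -
    have eX: "e \<in> X"
      using e maxsD by blast
    have ne: "f e \<noteq> f v"
      using root_fibre[OF eX] maxs_not_root[OF e] by blast
    have "y = f e" if y: "y \<in> Y" "f e \<in> B y" for y
    proof -
      obtain x where x: "x \<in> X" "y = f x"
        using y f_im by blast
      then obtain q where "q \<in> A x" "f q = f e"
        using y B_f[OF x(1)] by (metis imageE)
      then show ?thesis
        using max_value_on_path[OF x(1) e _ _ ne] x by blast
    qed
    then show ?thesis
      unfolding Y.maxs_def using f_in[OF eX] by blast
  qed
  then have sub: "f ` maxs \<subseteq> Y.maxs"
    by blast
  have "Y \<subseteq> closure Y.maxs"
  proof
    fix y assume "y \<in> Y"
    then obtain x where x: "x \<in> X" "y = f x"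
      using f_im by blast
    show "y \<in> closure Y.maxs"
      unfolding closure_approachable
    proof (intro allI impI)
      fix \<epsilon> :: real assume "0 < \<epsilon>"
      then obtain d where d: "0 < d" "\<And>z. z \<in> X \<Longrightarrow> dist z x < d \<Longrightarrow> dist (f z) (f x) < \<epsilon>"
        using f_cont x(1) unfolding continuous_on_iff by metis
      obtain e where "e \<in> maxs" "dist e x < d"
        using maxs_approx[OF x(1) d(1)] by blast
      then show "\<exists>z\<in>Y.maxs. dist z y < \<epsilon>"
        using d(2)[of e] sub maxsD x(2) by blast
    qed
  qed
  moreover have "Y \<noteq> {f v}"
    using Y_nondeg by (auto simp: nondegenerate_def)
  ultimately show ?thesis
    by unfold_locales
qed

end

section \<open>Functions of leg lengths on the Cantor set\<close>

definition agree :: "nat \<Rightarrow> (nat \<Rightarrow> bool) \<Rightarrow> (nat \<Rightarrow> bool) \<Rightarrow> bool" where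
  "agree n c d \<longleftrightarrow> (\<forall>i<n. c i = d i)"

lemma agree_refl [simp]: "agree n c c"
  by (simp add: agree_def)

lemma agree_sym: "agree n c d \<Longrightarrow> agree n d c"
  by (simp add: agree_def)

lemma agree_trans: "agree n c d \<Longrightarrow> agree n d e \<Longrightarrow> agree n c e"
  by (simp add: agree_def)

lemma agree_mono: "agree n c d \<Longrightarrow> m \<le> n \<Longrightarrow> agree m c d"
  by (simp add: agree_def)

text \<open>One \<open>n\<close> serves all points of \<open>U\<close>; by compactness of the Cantor
  set this describes exactly the clopen sets.\<close>

definition cyl_clopen :: "(nat \<Rightarrow> bool) set \<Rightarrow> bool" where
  "cyl_clopen U \<longleftrightarrow> (\<exists>n. \<forall>c\<in>U. \<forall>d. agree n c d \<longrightarrow> d \<in> U)"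

lemma cyl_clopen_Diff:
  assumes "cyl_clopen U" "cyl_clopen V"
  shows "cyl_clopen (U - V)"
proof -
  obtain m where m: "\<And>c d. c \<in> U \<Longrightarrow> agree m c d \<Longrightarrow> d \<in> U"
    using assms unfolding cyl_clopen_def by blast
  obtain n where n: "\<And>c d. c \<in> V \<Longrightarrow> agree n c d \<Longrightarrow> d \<in> V"
    using assms unfolding cyl_clopen_def by blast
  have "d \<in> U - V" if "c \<in> U - V" "agree (max m n) c d" for c d
    using that m n agree_mono[OF that(2), of m] agree_mono[OF that(2), of n] agree_sym by (metis DiffD1 DiffD2 DiffI max.cobounded1 max.cobounded2)
  then show ?thesis
    unfolding cyl_clopen_def by blast
qed

lemma cyl_clopen_coordinate:
  assumes "cyl_clopen U"
  shows "cyl_clopen (U \<inter> {c. c n = b})"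
proof -
  obtain m where m: "\<And>c d. c \<in> U \<Longrightarrow> agree m c d \<Longrightarrow> d \<in> U"
    using assms unfolding cyl_clopen_def by blast
  have "d \<in> U \<inter> {c. c n = b}" if "c \<in> U \<inter> {c. c n = b}" "agree (max m (Suc n)) c d" for c d
    using that m[of c d] agree_mono[OF that(2), of m] by (auto simp: agree_def less_max_iff_disj)
  then show ?thesis
    unfolding cyl_clopen_def by blast
qed

lemma cyl_clopen_cylinder: "cyl_clopen {d. agree n c d}"
  unfolding cyl_clopen_def using agree_trans by blast

text \<open>A function on the Cantor set whose value at \<open>c\<close> is the length of the leg coded by \<open>c\<close>
  (\<open>0\<close> if there is none): upper semicontinuity encodes compactness of the fan, and the last
  condition encodes density of the end points.\<close>
definition lelek_function :: "((nat \<Rightarrow> bool) \<Rightarrow> real) \<Rightarrow> bool" where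
  "lelek_function \<phi> \<longleftrightarrow>
     (\<forall>c. 0 \<le> \<phi> c) \<and> (\<exists>B. \<forall>c. \<phi> c \<le> B) \<and> (\<exists>c. 0 < \<phi> c) \<and>
     (\<forall>c r. \<phi> c < r \<longrightarrow> (\<exists>n. \<forall>d. agree n c d \<longrightarrow> \<phi> d < r)) \<and>
     (\<forall>c n s t. 0 \<le> s \<and> s < t \<and> t \<le> \<phi> c \<longrightarrow> (\<exists>d. agree n c d \<and> s < \<phi> d \<and> \<phi> d < t))"

definition height :: "((nat \<Rightarrow> bool) \<Rightarrow> real) \<Rightarrow> (nat \<Rightarrow> bool) set \<Rightarrow> real" where
  "height \<phi> U = Sup (\<phi> ` U)"

definition good :: "((nat \<Rightarrow> bool) \<Rightarrow> real) \<Rightarrow> (nat \<Rightarrow> bool) set \<Rightarrow> bool" where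
  "good \<phi> U \<longleftrightarrow> cyl_clopen U \<and> (\<exists>c\<in>U. 0 < \<phi> c)"

lemma lelek_function_bdd: "lelek_function \<phi> \<Longrightarrow> bdd_above (\<phi> ` U)"
  unfolding lelek_function_def bdd_above_def by blast

lemma le_height: "lelek_function \<phi> \<Longrightarrow> c \<in> U \<Longrightarrow> \<phi> c \<le> height \<phi> U"
  unfolding height_def by (simp add: cSup_upper lelek_function_bdd)

lemma height_least: "U \<noteq> {} \<Longrightarrow> (\<And>c. c \<in> U \<Longrightarrow> \<phi> c \<le> r) \<Longrightarrow> height \<phi> U \<le> r"
  unfolding height_def by (rule cSup_least) auto

lemma height_mono:
  "lelek_function \<phi> \<Longrightarrow> U \<noteq> {} \<Longrightarrow> U \<subseteq> V \<Longrightarrow> height \<phi> U \<le> height \<phi> V"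
  by (meson height_least le_height subsetD)

lemma height_pos: "lelek_function \<phi> \<Longrightarrow> good \<phi> U \<Longrightarrow> 0 < height \<phi> U"
  unfolding good_def using le_height by fastforce

lemma less_heightD: "U \<noteq> {} \<Longrightarrow> s < height \<phi> U \<Longrightarrow> \<exists>c\<in>U. s < \<phi> c"
  by (meson height_least linorder_not_le)

lemma height_Un:
  assumes "lelek_function \<phi>" "U \<noteq> {}" "V \<noteq> {}"
  shows "height \<phi> (U \<union> V) = max (height \<phi> U) (height \<phi> V)"
proof (rule antisym)
  show "height \<phi> (U \<union> V) \<le> max (height \<phi> U) (height \<phi> V)"
    by (rule height_least) (use assms le_height[of \<phi>] in \<open>auto simp: le_max_iff_disj\<close>)
  show "max (height \<phi> U) (height \<phi> V) \<le> height \<phi> (U \<union> V)"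
    using assms by (simp add: height_mono)
qed

text \<open>Density of end points yields a point \<open>d\<close> of \<open>V\<close> with value
  strictly between \<open>k * s\<close> and \<open>m\<close>, and upper semicontinuity a cylinder
  \<open>V'\<close> about \<open>d\<close> on which values stay below \<open>m\<close>.\<close>

lemma split_off:
  assumes \<psi>: "lelek_function \<psi>" and V: "good \<psi> V" and s: "0 < s" "s \<le> height \<psi> V"
    and k: "0 < k" "k < 1"
  shows "\<exists>V'\<subseteq>V. good \<psi> V' \<and> good \<psi> (V - V') \<and> k * s \<le> height \<psi> V' \<and> height \<psi> V' \<le> s \<and>
           height \<psi> (V - V') = height \<psi> V"
proof -
  \<comment> \<open>Any value strictly between \<open>k * s\<close> and \<open>s\<close> would do.
    Values on \<open>V'\<close> stay below \<open>m < height \<psi> V\<close>, so removing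
    \<open>V'\<close> does not lower the height; \<open>c\<close>, whose value exceeds
    \<open>m\<close>, keeps the complement good.\<close>
  define m where "m = (k * s + s) / 2"
  have m: "0 \<le> k * s" "k * s < m" "m < s"
    using s k by (auto simp: m_def)
  have ne: "V \<noteq> {}"
    using V by (auto simp: good_def)
  obtain c where c: "c \<in> V" "m < \<psi> c"
    using less_heightD[OF ne, of m \<psi>] m s by auto
  obtain n where n: "\<And>c d. c \<in> V \<Longrightarrow> agree n c d \<Longrightarrow> d \<in> V"
    using V unfolding good_def cyl_clopen_def by blast
  obtain d where d: "agree n c d" "k * s < \<psi> d" "\<psi> d < m"
    using \<psi> c m unfolding lelek_function_def by (meson less_imp_le)
  obtain n2 where n2: "\<And>e. agree n2 d e \<Longrightarrow> \<psi> e < m"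
    using \<psi> d unfolding lelek_function_def by blast
  define V' where "V' = {e. agree (max n n2) d e}"
  have sub: "V' \<subseteq> V"
  proof
    fix e assume "e \<in> V'"
    then have "agree n c e"
      using d agree_mono[of "max n n2" d e n] agree_trans by (auto simp: V'_def)
    then show "e \<in> V"
      using n c by blast
  qed
  have less: "\<psi> e < m" if "e \<in> V'" for e
    using that n2 agree_mono[of "max n n2" d e n2] by (auto simp: V'_def)
  have dV': "d \<in> V'"
    by (simp add: V'_def)
  have cV: "c \<in> V - V'"
    using c less by fastforce
  have le: "height \<psi> V' \<le> m"
    using height_least[of V' \<psi> m] dV' less by fastforce
  have "good \<psi> V'"
    unfolding good_def using dV' d m cyl_clopen_cylinder[of "max n n2" d]
    by (metis V'_def le_less_trans)
  moreover have "good \<psi> (V - V')"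
    using V \<open>good \<psi> V'\<close> cV c m unfolding good_def
    by (metis cyl_clopen_Diff le_less_trans less_trans)
  moreover have "k * s \<le> height \<psi> V'"
    using le_height[OF \<psi> dV'] d by linarith
  moreover have "height \<psi> (V - V') = height \<psi> V"
  proof -
    have "height \<psi> V = max (height \<psi> V') (height \<psi> (V - V'))"
      using height_Un[OF \<psi>, of V' "V - V'"] dV' cV sub by (metis Diff_partition empty_iff)
    then show ?thesis
      using le m s by (simp add: max_def split: if_splits)
  qed
  ultimately show ?thesis
    using sub le m by (intro exI[of _ V']) auto
qed

text \<open>The logarithm of the factor by which lengths are to be stretched, so that the errors of
  successive refinements add up.\<close>

definition ratio :: "((nat \<Rightarrow> bool) \<Rightarrow> real) \<Rightarrow> ((nat \<Rightarrow> bool) \<Rightarrow> real) \<Rightarrow>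
    (nat \<Rightarrow> bool) set \<times> (nat \<Rightarrow> bool) set \<Rightarrow> real" where
  "ratio \<phi> \<psi> p = ln (height \<psi> (snd p)) - ln (height \<phi> (fst p))"

definition good_pair where
  "good_pair \<phi> \<psi> p \<longleftrightarrow> good \<phi> (fst p) \<and> good \<psi> (snd p)"

text \<open>Only points of positive length need be covered: pieces carrying no leg cannot be paired
  and are dropped. The projection \<open>\<pi>\<close> is a parameter so that each fact holds for
  both sides of a pair.\<close>

definition covers :: "('p \<Rightarrow> 'c set) \<Rightarrow> ('c \<Rightarrow> real) \<Rightarrow> 'p \<Rightarrow> 'p set \<Rightarrow> bool" where
  "covers \<pi> \<omega> p Q \<longleftrightarrow> (\<forall>c\<in>\<pi> p. 0 < \<omega> c \<longrightarrow> (\<exists>!q. q \<in> Q \<and> c \<in> \<pi> q))"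

lemma coversD: "covers \<pi> \<omega> p Q \<Longrightarrow> c \<in> \<pi> p \<Longrightarrow> 0 < \<omega> c \<Longrightarrow> \<exists>!q. q \<in> Q \<and> c \<in> \<pi> q"
  unfolding covers_def by blast

lemma covers_image:
  assumes cov: "covers \<pi> \<omega> p Q" and i: "\<And>q. \<pi>' (i q) = \<pi> q"
  shows "covers \<pi>' \<omega> (i p) (i ` Q)"
  unfolding covers_def i
proof (intro ballI impI)
  fix c assume "c \<in> \<pi> p" "0 < \<omega> c"
  from coversD[OF cov this] obtain q where q: "q \<in> Q \<and> c \<in> \<pi> q" "\<forall>q'. q' \<in> Q \<and> c \<in> \<pi> q' \<longrightarrow> q' = q"
    by (rule ex1E)
  show "\<exists>!q. q \<in> i ` Q \<and> c \<in> \<pi>' q"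
  proof (rule ex1I[of _ "i q"])
    show "i q \<in> i ` Q \<and> c \<in> \<pi>' (i q)"
      using q(1) i by simp
    fix r assume "r \<in> i ` Q \<and> c \<in> \<pi>' r"
    then obtain q' where "q' \<in> Q \<and> c \<in> \<pi> q'" "r = i q'"
      using i by auto
    then show "r = i q"
      using q(2) by blast
  qed
qed

lemma covers_compose:
  assumes Q: "covers \<pi> \<omega> p Q" and R: "\<And>q. q \<in> Q \<Longrightarrow> covers \<pi> \<omega> q (R q)"
    and sub: "\<And>q r. q \<in> Q \<Longrightarrow> r \<in> R q \<Longrightarrow> \<pi> r \<subseteq> \<pi> q"
  shows "covers \<pi> \<omega> p (\<Union>q\<in>Q. R q)"
  unfolding covers_def
proof (intro ballI impI)
  fix c assume c: "c \<in> \<pi> p" "0 < \<omega> c"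
  from coversD[OF Q c] obtain q where q: "q \<in> Q \<and> c \<in> \<pi> q" "\<forall>q'. q' \<in> Q \<and> c \<in> \<pi> q' \<longrightarrow> q' = q"
    by (rule ex1E)
  from coversD[OF R _ c(2)] q obtain r where
    r: "r \<in> R q \<and> c \<in> \<pi> r" "\<forall>r'. r' \<in> R q \<and> c \<in> \<pi> r' \<longrightarrow> r' = r"
    by (metis ex1E)
  show "\<exists>!r. r \<in> (\<Union>q\<in>Q. R q) \<and> c \<in> \<pi> r"
  proof (rule ex1I[of _ r])
    show "r \<in> (\<Union>q\<in>Q. R q) \<and> c \<in> \<pi> r"
      using q r by blast
    fix r' assume "r' \<in> (\<Union>q\<in>Q. R q) \<and> c \<in> \<pi> r'"
    then obtain q' where "q' \<in> Q" "r' \<in> R q'" "c \<in> \<pi> r'"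
      by blast
    then show "r' = r"
      using sub q(2) r(2) by blast
  qed
qed

definition refines :: "((nat \<Rightarrow> bool) \<Rightarrow> real) \<Rightarrow> ((nat \<Rightarrow> bool) \<Rightarrow> real) \<Rightarrow> real \<Rightarrow>
    (nat \<Rightarrow> bool) set \<times> (nat \<Rightarrow> bool) set \<Rightarrow> ((nat \<Rightarrow> bool) set \<times> (nat \<Rightarrow> bool) set) set \<Rightarrow> bool"
  where
  "refines \<phi> \<psi> \<epsilon> p Q \<longleftrightarrow>
     (\<forall>q\<in>Q. good_pair \<phi> \<psi> q \<and> fst q \<subseteq> fst p \<and> snd q \<subseteq> snd p \<and>
        \<bar>ratio \<phi> \<psi> q - ratio \<phi> \<psi> p\<bar> \<le> \<epsilon>) \<and>
     covers fst \<phi> p Q \<and> covers snd \<psi> p Q"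

lemma refinesD:
  assumes "refines \<phi> \<psi> \<epsilon> p Q"
  shows "q \<in> Q \<Longrightarrow> good_pair \<phi> \<psi> q" "q \<in> Q \<Longrightarrow> fst q \<subseteq> fst p" "q \<in> Q \<Longrightarrow> snd q \<subseteq> snd p"
    "q \<in> Q \<Longrightarrow> \<bar>ratio \<phi> \<psi> q - ratio \<phi> \<psi> p\<bar> \<le> \<epsilon>"
    "covers fst \<phi> p Q" "covers snd \<psi> p Q"
  using assms unfolding refines_def by simp_all

lemma refines_swap:
  assumes "refines \<psi> \<phi> \<epsilon> (prod.swap p) Q"
  shows "refines \<phi> \<psi> \<epsilon> p (prod.swap ` Q)"
proof -
  have "covers fst \<phi> p (prod.swap ` Q)" "covers snd \<psi> p (prod.swap ` Q)"
    using covers_image[OF refinesD(6)[OF assms], of fst prod.swap]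
      covers_image[OF refinesD(5)[OF assms], of snd prod.swap] by simp_all
  moreover have "\<bar>ratio \<phi> \<psi> (prod.swap q) - ratio \<phi> \<psi> p\<bar> = \<bar>ratio \<psi> \<phi> q - ratio \<psi> \<phi> (prod.swap p)\<bar>" for q
    by (simp add: ratio_def)
  ultimately show ?thesis
    unfolding refines_def ball_simps using refinesD(1-4)[OF assms] by (simp add: good_pair_def)
qed

lemma refines_compose:
  assumes Q: "refines \<phi> \<psi> \<epsilon> p Q" and R: "\<And>q. q \<in> Q \<Longrightarrow> refines \<phi> \<psi> \<delta> q (R q)"
  shows "refines \<phi> \<psi> (\<epsilon> + \<delta>) p (\<Union>q\<in>Q. R q)"
proof -
  have "covers fst \<phi> p (\<Union>q\<in>Q. R q)"
    using covers_compose[OF refinesD(5)[OF Q] refinesD(5)[OF R] refinesD(2)[OF R]] .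
  moreover have "covers snd \<psi> p (\<Union>q\<in>Q. R q)"
    using covers_compose[OF refinesD(6)[OF Q] refinesD(6)[OF R] refinesD(3)[OF R]] .
  moreover have "good_pair \<phi> \<psi> r \<and> fst r \<subseteq> fst p \<and> snd r \<subseteq> snd p \<and> \<bar>ratio \<phi> \<psi> r - ratio \<phi> \<psi> p\<bar> \<le> \<epsilon> + \<delta>"
    if "q \<in> Q" "r \<in> R q" for q r
    using refinesD(2-4)[OF Q that(1)] refinesD(1-4)[OF R that(2)] that(1) by auto
  ultimately show ?thesis
    unfolding refines_def by auto
qed

text \<open>Splitting \<open>U\<close> by its \<open>n\<close>-th digit gives one half of full
  height, paired with what remains of \<open>V\<close>, so its ratio is unchanged. The other half is
  paired with a piece split off from \<open>V\<close>, or dropped if it carries no leg.\<close>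

lemma split_fst:
  assumes \<phi>: "lelek_function \<phi>" and \<psi>: "lelek_function \<psi>"
    and p: "good_pair \<phi> \<psi> p" and \<epsilon>: "0 < \<epsilon>"
  shows "\<exists>Q. refines \<phi> \<psi> \<epsilon> p Q \<and> (\<forall>q\<in>Q. \<forall>c\<in>fst q. \<forall>c'\<in>fst q. c n = c' n)"
proof -
  obtain U V where pUV: "p = (U, V)"
    by (cases p)
  have U: "good \<phi> U" and V: "good \<psi> V"
    using p by (auto simp: good_pair_def pUV)
  define W where "W b = U \<inter> {c. c n = b}" for b
  have UW: "U = W True \<union> W False"
    by (auto simp: W_def)
  have clo: "cyl_clopen (W b)" for b
    unfolding W_def using U cyl_clopen_coordinate good_def by blast
  have dis: "W b \<inter> W (\<not> b) = {}" "U = W b \<union> W (\<not> b)" for b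
    by (auto simp: W_def)
  have "\<exists>b. good \<phi> (W b) \<and> height \<phi> (W b) = height \<phi> U"
  proof -
    obtain c where c: "c \<in> U" "0 < \<phi> c"
      using U by (auto simp: good_def)
    show ?thesis
    proof (cases "\<exists>b. W b = {}")
      case True
      then obtain b where "W b = {}" by blast
      then have "W (\<not> b) = U" using dis(2)[of b] by blast
      then show ?thesis using U by metis
    next
      case False
      then have "height \<phi> U = max (height \<phi> (W True)) (height \<phi> (W False))"
        using height_Un[OF \<phi>] UW by metis
      then obtain b where b: "height \<phi> (W b) = height \<phi> U"
        by (metis max_def)
      then have "0 < height \<phi> (W b)"
        using height_pos[OF \<phi> U] by simp
      then have "good \<phi> (W b)"
        using less_heightD[of "W b" 0 \<phi>] False clo by (auto simp: good_def)
      then show ?thesis using b by blast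
    qed
  qed
  then obtain b where b: "good \<phi> (W b)" "height \<phi> (W b) = height \<phi> U"
    by blast
  show ?thesis
  proof (cases "\<exists>c\<in>W (\<not> b). 0 < \<phi> c")
    case False
    have "refines \<phi> \<psi> \<epsilon> p {(W b, V)}"
      unfolding refines_def covers_def pUV using b V \<epsilon> False dis[of b] by (auto simp: good_pair_def ratio_def)
    then show ?thesis
      by (intro exI[of _ "{(W b, V)}"]) (auto simp: W_def)
  next
    case True
    then have g: "good \<phi> (W (\<not> b))"
      using clo by (auto simp: good_def)
    define M where "M = height \<phi> U"
    define N where "N = height \<psi> V"
    define M' where "M' = height \<phi> (W (\<not> b))"
    have pos: "0 < M" "0 < N" "0 < M'"
      using height_pos \<phi> \<psi> U V g by (auto simp: M_def N_def M'_def)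
    have "M' \<le> M"
      unfolding M_def M'_def using height_mono[OF \<phi>] g dis(2)[of b] by (metis Un_upper2 empty_iff good_def)
    \<comment> \<open>The height that would give the second pair exactly the ratio of
      \<open>p\<close>. The factor \<open>exp (- \<epsilon>)\<close> passed to
      \<open>split_off\<close> costs at most \<open>\<epsilon>\<close> after taking
      logarithms.\<close>
    define s where "s = N * M' / M"
    have s: "0 < s" "s \<le> N"
      using pos \<open>M' \<le> M\<close> by (auto simp: s_def field_simps)
    obtain V' where V': "V' \<subseteq> V" "good \<psi> V'" "good \<psi> (V - V')" "exp (- \<epsilon>) * s \<le> height \<psi> V'"
      "height \<psi> V' \<le> s" "height \<psi> (V - V') = N"
      using split_off[OF \<psi> V, of s "exp (- \<epsilon>)"] s \<epsilon> N_def by auto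
    have hp: "0 < height \<psi> V'"
      using height_pos \<psi> V' by blast
    have "ln (exp (- \<epsilon>) * s) \<le> ln (height \<psi> V')" "ln (height \<psi> V') \<le> ln s"
      using V' s hp by auto
    moreover have "ln (exp (- \<epsilon>) * s) = - \<epsilon> + ln s"
      using s by (simp add: ln_mult)
    moreover have "ln s = ln N + ln M' - ln M"
      using pos by (simp add: s_def ln_mult ln_div)
    ultimately have r: "\<bar>(ln (height \<psi> V') - ln M') - (ln N - ln M)\<bar> \<le> \<epsilon>"
      using \<epsilon> by linarith
    define Q where "Q = {(W b, V - V'), (W (\<not> b), V')}"
    have "refines \<phi> \<psi> \<epsilon> p Q"
      unfolding refines_def covers_def
    proof (intro conjI ballI impI)
      fix q assume "q \<in> Q"
      then consider "q = (W b, V - V')" | "q = (W (\<not> b), V')"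
        by (auto simp: Q_def)
      then show "good_pair \<phi> \<psi> q" "fst q \<subseteq> fst p" "snd q \<subseteq> snd p"
        "\<bar>ratio \<phi> \<psi> q - ratio \<phi> \<psi> p\<bar> \<le> \<epsilon>"
        using b g V' r \<epsilon> dis[of b] by (cases; auto simp: pUV good_pair_def ratio_def M_def N_def M'_def)+
    next
      fix c assume "c \<in> fst p"
      then consider "c \<in> W b" "c \<notin> W (\<not> b)" | "c \<notin> W b" "c \<in> W (\<not> b)"
        using dis[of b] pUV by auto
      then show "\<exists>!q. q \<in> Q \<and> c \<in> fst q"
        by cases (auto simp: Q_def)
    next
      fix d assume "d \<in> snd p"
      then consider "d \<in> V" "d \<notin> V'" | "d \<in> V'"
        using pUV by auto
      then show "\<exists>!q. q \<in> Q \<and> d \<in> snd q"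
        by cases (auto simp: Q_def)
    qed
    then show ?thesis
      by (intro exI[of _ Q]) (auto simp: Q_def W_def)
  qed
qed

text \<open>The two directions of the back-and-forth: after the first sets the second ones are
  split, with the roles exchanged by \<open>prod.swap\<close>, each at the cost of half of
  \<open>\<epsilon>\<close>.\<close>

lemma split_pair:
  assumes \<phi>: "lelek_function \<phi>" and \<psi>: "lelek_function \<psi>"
    and p: "good_pair \<phi> \<psi> p" and \<epsilon>: "0 < \<epsilon>"
  shows "\<exists>Q. refines \<phi> \<psi> \<epsilon> p Q \<and> (\<forall>q\<in>Q. \<forall>c\<in>fst q. \<forall>c'\<in>fst q. c n = c' n) \<and>
           (\<forall>q\<in>Q. \<forall>c\<in>snd q. \<forall>c'\<in>snd q. c n = c' n)"
proof -
  obtain Q where Q: "refines \<phi> \<psi> (\<epsilon>/2) p Q" "\<forall>q\<in>Q. \<forall>c\<in>fst q. \<forall>c'\<in>fst q. c n = c' n"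
    using split_fst[OF \<phi> \<psi> p, of "\<epsilon>/2" n] \<epsilon> by auto
  have "\<exists>R. refines \<phi> \<psi> (\<epsilon>/2) q R \<and> (\<forall>r\<in>R. \<forall>c\<in>snd r. \<forall>c'\<in>snd r. c n = c' n)" if q: "q \<in> Q" for q
  proof -
    have "good_pair \<psi> \<phi> (prod.swap q)"
      using Q q unfolding refines_def good_pair_def by auto
    then obtain R where R: "refines \<psi> \<phi> (\<epsilon>/2) (prod.swap q) R" "\<forall>r\<in>R. \<forall>c\<in>fst r. \<forall>c'\<in>fst r. c n = c' n"
      using split_fst[OF \<psi> \<phi>, of "prod.swap q" "\<epsilon>/2" n] \<epsilon> by auto
    have "refines \<phi> \<psi> (\<epsilon>/2) q (prod.swap ` R)"
      using refines_swap[OF R(1)] .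
    then show ?thesis
      using R(2) by (intro exI[of _ "prod.swap ` R"]) auto
  qed
  then obtain R where R: "\<And>q. q \<in> Q \<Longrightarrow> refines \<phi> \<psi> (\<epsilon>/2) q (R q)"
    "\<And>q r c c'. \<lbrakk>q \<in> Q; r \<in> R q; c \<in> snd r; c' \<in> snd r\<rbrakk> \<Longrightarrow> c n = c' n"
    by metis
  have "refines \<phi> \<psi> \<epsilon> p (\<Union>q\<in>Q. R q)"
    using refines_compose[OF Q(1) R(1)] by simp
  moreover have "fst r \<subseteq> fst q" if "q \<in> Q" "r \<in> R q" for q r
    using R(1)[OF that(1)] that unfolding refines_def by blast
  then have "\<forall>r\<in>(\<Union>q\<in>Q. R q). \<forall>c\<in>fst r. \<forall>c'\<in>fst r. c n = c' n"
    using Q(2) by blast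
  moreover have "\<forall>r\<in>(\<Union>q\<in>Q. R q). \<forall>c\<in>snd r. \<forall>c'\<in>snd r. c n = c' n"
    using R(2) by blast
  ultimately show ?thesis
    by blast
qed

text \<open>The diagonal point takes digit \<open>i\<close> from an element of
  \<open>U (Suc i)\<close>, where this digit is constant. It agrees with elements of
  \<open>U n\<close> to any finite depth, so it lies in the clopen set \<open>U n\<close>.\<close>

lemma shrinking_point_exists:
  assumes clo: "\<And>n. cyl_clopen (U n)" and ne: "\<And>n. U n \<noteq> {}" and dec: "\<And>n. U (Suc n) \<subseteq> U n"
    and const: "\<And>n c c'. c \<in> U (Suc n) \<Longrightarrow> c' \<in> U (Suc n) \<Longrightarrow> c n = c' n"
  shows "\<exists>c. \<forall>n. c \<in> U n"
proof -
  have "\<forall>n. \<exists>x. x \<in> U n"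
    using ne by blast
  then obtain a where a: "\<And>n. a n \<in> U n"
    by metis
  have anti: "U n \<subseteq> U m" if "m \<le> n" for m n
    using lift_Suc_antimono_le[of U] dec that by blast
  define c where "c i = a (Suc i) i" for i
  have ag: "agree n (a k) c" if "n \<le> k" for n k
    unfolding agree_def
  proof (intro allI impI)
    fix i assume "i < n"
    then have "a k \<in> U (Suc i)"
      using a anti[of "Suc i" k] that by fastforce
    then show "a k i = c i"
      using const[of "a k" i "a (Suc i)"] a by (simp add: c_def)
  qed
  have "c \<in> U n" for n
  proof -
    obtain m where m: "\<And>c d. c \<in> U n \<Longrightarrow> agree m c d \<Longrightarrow> d \<in> U n"
      using clo[of n] unfolding cyl_clopen_def by blast
    have "a (max m n) \<in> U n"
      using a anti[of n "max m n"] by fastforce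
    then show ?thesis
      using m ag[of m "max m n"] by simp
  qed
  then show ?thesis
    by blast
qed

lemma height_shrinking:
  assumes \<phi>: "lelek_function \<phi>" and c: "\<And>n. c \<in> U n" and dec: "\<And>n. U (Suc n) \<subseteq> U n"
    and const: "\<And>n c c'. c \<in> U (Suc n) \<Longrightarrow> c' \<in> U (Suc n) \<Longrightarrow> c n = c' n"
  shows "(\<lambda>n. height \<phi> (U n)) \<longlonglongrightarrow> \<phi> c"
proof (rule order_tendstoI)
  fix r assume "r < \<phi> c"
  then show "\<forall>\<^sub>F n in sequentially. r < height \<phi> (U n)"
    using le_height[OF \<phi> c] by (intro always_eventually) (meson less_le_trans)
next
  fix r assume r: "\<phi> c < r"
  then obtain r' where r': "\<phi> c < r'" "r' < r"
    using dense by blast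
  obtain m where m: "\<And>d. agree m c d \<Longrightarrow> \<phi> d < r'"
    using \<phi> r' unfolding lelek_function_def by blast
  have anti: "U n \<subseteq> U m" if "m \<le> n" for m n
    using lift_Suc_antimono_le[of U] dec that by blast
  have "height \<phi> (U n) < r" if "m \<le> n" for n
  proof -
    have "\<phi> d \<le> r'" if d: "d \<in> U n" for d
    proof -
      have "c i = d i" if "i < m" for i
        using const[of c i d] c d anti[of "Suc i" n] that \<open>m \<le> n\<close> by fastforce
      then show ?thesis
        using m[of d] by (auto simp: agree_def)
    qed
    then have "height \<phi> (U n) \<le> r'"
      using height_least[of "U n" \<phi> r'] c by blast
    then show ?thesis
      using r' by simp
  qed
  then show "\<forall>\<^sub>F n in sequentially. height \<phi> (U n) < r"
    by (auto simp: eventually_sequentially)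
qed

section \<open>The tree of paired clopen sets and its branches\<close>

locale lelek_pair =
  fixes \<phi> \<psi> :: "(nat \<Rightarrow> bool) \<Rightarrow> real"
  assumes \<phi>: "lelek_function \<phi>" and \<psi>: "lelek_function \<psi>"
begin

text \<open>The refinement is a function of the stage and the pair, so branches that agree at a
  stage choose from the same set afterwards; uniqueness of branches rests on this. The tolerances
  \<open>(1/2)^n\<close> are summable.\<close>

definition step where
  "step n p = (SOME Q. refines \<phi> \<psi> ((1/2)^n) p Q \<and>
     (\<forall>q\<in>Q. \<forall>c\<in>fst q. \<forall>c'\<in>fst q. c n = c' n) \<and> (\<forall>q\<in>Q. \<forall>c\<in>snd q. \<forall>c'\<in>snd q. c n = c' n))"

lemma step:
  assumes "good_pair \<phi> \<psi> p"
  shows "refines \<phi> \<psi> ((1/2)^n) p (step n p)"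
    and "\<lbrakk>q \<in> step n p; c \<in> fst q; c' \<in> fst q\<rbrakk> \<Longrightarrow> c n = c' n"
    and "\<lbrakk>q \<in> step n p; c \<in> snd q; c' \<in> snd q\<rbrakk> \<Longrightarrow> c n = c' n"
proof -
  have "0 < (1/2::real)^n" by simp
  note * = someI_ex[OF split_pair[OF \<phi> \<psi> assms this, of n], folded step_def]
  show "refines \<phi> \<psi> ((1/2)^n) p (step n p)"
    using * by (rule conjunct1)
  have "\<forall>q\<in>step n p. \<forall>c\<in>fst q. \<forall>c'\<in>fst q. c n = c' n"
    using * by (elim conjE)
  then show "\<lbrakk>q \<in> step n p; c \<in> fst q; c' \<in> fst q\<rbrakk> \<Longrightarrow> c n = c' n"
    by blast
  have "\<forall>q\<in>step n p. \<forall>c\<in>snd q. \<forall>c'\<in>snd q. c n = c' n"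
    using * by (elim conjE)
  then show "\<lbrakk>q \<in> step n p; c \<in> snd q; c' \<in> snd q\<rbrakk> \<Longrightarrow> c n = c' n"
    by blast
qed

definition branch where
  "branch p \<longleftrightarrow> p 0 = (UNIV, UNIV) \<and> (\<forall>n. p (Suc n) \<in> step n (p n))"

lemma good_pair_UNIV: "good_pair \<phi> \<psi> (UNIV, UNIV)"
  using \<phi> \<psi> unfolding good_pair_def good_def lelek_function_def cyl_clopen_def by auto

lemma branch_good: "branch p \<Longrightarrow> good_pair \<phi> \<psi> (p n)"
proof (induction n)
  case 0
  then show ?case using good_pair_UNIV by (simp add: branch_def)
next
  case (Suc n)
  then have "refines \<phi> \<psi> ((1/2)^n) (p n) (step n (p n))" "p (Suc n) \<in> step n (p n)"
    using step branch_def by auto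
  then show ?case
    by (rule refinesD)
qed

lemma branch_Suc:
  assumes "branch p"
  shows "fst (p (Suc n)) \<subseteq> fst (p n)" "snd (p (Suc n)) \<subseteq> snd (p n)"
    "\<bar>ratio \<phi> \<psi> (p (Suc n)) - ratio \<phi> \<psi> (p n)\<bar> \<le> (1/2)^n"
    "\<And>c c'. c \<in> fst (p (Suc n)) \<Longrightarrow> c' \<in> fst (p (Suc n)) \<Longrightarrow> c n = c' n"
    "\<And>c c'. c \<in> snd (p (Suc n)) \<Longrightarrow> c' \<in> snd (p (Suc n)) \<Longrightarrow> c n = c' n"
proof -
  have 1: "refines \<phi> \<psi> ((1/2)^n) (p n) (step n (p n))" "p (Suc n) \<in> step n (p n)"
    using assms step branch_good branch_def by auto
  then show "fst (p (Suc n)) \<subseteq> fst (p n)" "snd (p (Suc n)) \<subseteq> snd (p n)"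
    "\<bar>ratio \<phi> \<psi> (p (Suc n)) - ratio \<phi> \<psi> (p n)\<bar> \<le> (1/2)^n"
    by (rule refinesD)+
  show "\<And>c c'. c \<in> fst (p (Suc n)) \<Longrightarrow> c' \<in> fst (p (Suc n)) \<Longrightarrow> c n = c' n"
    "\<And>c c'. c \<in> snd (p (Suc n)) \<Longrightarrow> c' \<in> snd (p (Suc n)) \<Longrightarrow> c n = c' n"
    using step(2,3)[OF branch_good[OF assms] 1(2)] by blast+
qed

lemma branch_ratio:
  assumes "branch p"
  shows "\<bar>ratio \<phi> \<psi> (p (n + k)) - ratio \<phi> \<psi> (p n)\<bar> \<le> 2 * (1/2)^n - 2 * (1/2)^(n + k)"
proof (induction k)
  case (Suc k)
  then show ?case using branch_Suc(3)[OF assms, of "n + k"] by simp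
qed simp

lemma branch_mem_mono:
  assumes "branch p" "m \<le> n"
  shows "fst (p n) \<subseteq> fst (p m)" "snd (p n) \<subseteq> snd (p m)"
  using lift_Suc_antimono_le[of "\<lambda>n. fst (p n)" m n] lift_Suc_antimono_le[of "\<lambda>n. snd (p n)" m n]
    branch_Suc(1,2)[OF assms(1)] assms(2) by simp_all

text \<open>By \<open>covers\<close> exactly one member of each refinement contains a given point of
  positive length, so the point determines the branch step by step.\<close>

lemma branch_unique:
  assumes p: "branch p" "branch p'" and cov: "\<And>q n. good_pair \<phi> \<psi> q \<Longrightarrow> covers \<pi> \<omega> q (step n q)"
    and sub: "\<And>n. \<pi> (p (Suc n)) \<subseteq> \<pi> (p n)" "\<And>n. \<pi> (p' (Suc n)) \<subseteq> \<pi> (p' n)"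
    and c: "0 < \<omega> c" "c \<in> \<pi> (p n)" "c \<in> \<pi> (p' n)"
  shows "p n = p' n"
  using c(2,3)
proof (induction n)
  case 0
  then show ?case using p branch_def by metis
next
  case (Suc n)
  then have cn: "c \<in> \<pi> (p n)" "c \<in> \<pi> (p' n)"
    using sub by blast+
  with Suc have eq: "p n = p' n" by blast
  have "\<exists>!q. q \<in> step n (p n) \<and> c \<in> \<pi> q"
    using coversD[OF cov[OF branch_good[OF p(1)]]] cn(1) c(1) .
  moreover have "p (Suc n) \<in> step n (p n)" "p' (Suc n) \<in> step n (p n)"
    using p eq unfolding branch_def by metis+
  ultimately show ?case
    using Suc.prems by blast
qed

lemma branch_unique_fst:
  "\<lbrakk>branch p; branch p'; 0 < \<phi> c; c \<in> fst (p n); c \<in> fst (p' n)\<rbrakk> \<Longrightarrow> p n = p' n"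
  by (rule branch_unique[where \<pi> = fst and \<omega> = \<phi>, OF _ _ refinesD(5)[OF step(1)] branch_Suc(1) branch_Suc(1)])

lemma branch_unique_snd:
  "\<lbrakk>branch p; branch p'; 0 < \<psi> d; d \<in> snd (p n); d \<in> snd (p' n)\<rbrakk> \<Longrightarrow> p n = p' n"
  by (rule branch_unique[where \<pi> = snd and \<omega> = \<psi>, OF _ _ refinesD(6)[OF step(1)] branch_Suc(2) branch_Suc(2)])

lemma branch_exists:
  assumes cov: "\<And>q n. good_pair \<phi> \<psi> q \<Longrightarrow> covers \<pi> \<omega> q (step n q)" and c: "c \<in> \<pi> (UNIV, UNIV)" "0 < \<omega> c"
  shows "\<exists>p. branch p \<and> (\<forall>n. c \<in> \<pi> (p n))"
proof -
  have "\<exists>p. \<forall>n. (good_pair \<phi> \<psi> (p n) \<and> c \<in> \<pi> (p n) \<and> (n = 0 \<longrightarrow> p n = (UNIV, UNIV))) \<and> p (Suc n) \<in> step n (p n)"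
  proof (rule dependent_nat_choice)
    show "\<exists>x. good_pair \<phi> \<psi> x \<and> c \<in> \<pi> x \<and> ((0::nat) = 0 \<longrightarrow> x = (UNIV, UNIV))"
      using good_pair_UNIV c by auto
  next
    fix x and n :: nat
    assume x: "good_pair \<phi> \<psi> x \<and> c \<in> \<pi> x \<and> (n = 0 \<longrightarrow> x = (UNIV, UNIV))"
    then have gx: "good_pair \<phi> \<psi> x" and cx: "c \<in> \<pi> x"
      by auto
    obtain q where "q \<in> step n x" "c \<in> \<pi> q"
      using ex1_implies_ex[OF coversD[OF cov[OF gx] cx c(2)]] by blast
    then show "\<exists>y. (good_pair \<phi> \<psi> y \<and> c \<in> \<pi> y \<and> (Suc n = 0 \<longrightarrow> y = (UNIV, UNIV))) \<and> y \<in> step n x"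
      using refinesD(1)[OF step(1)[OF gx]] by blast
  qed
  then show ?thesis
    unfolding branch_def by blast
qed

lemma branch_exists_fst: "0 < \<phi> c \<Longrightarrow> \<exists>p. branch p \<and> (\<forall>n. c \<in> fst (p n))"
  by (rule branch_exists[where \<pi> = fst and \<omega> = \<phi>, OF refinesD(5)[OF step(1)]]) simp_all

lemma branch_exists_snd: "0 < \<psi> d \<Longrightarrow> \<exists>p. branch p \<and> (\<forall>n. d \<in> snd (p n))"
  by (rule branch_exists[where \<pi> = snd and \<omega> = \<psi>, OF refinesD(6)[OF step(1)]]) simp_all

lemma branch_fst_point:
  assumes "branch p"
  shows "\<exists>c. \<forall>n. c \<in> fst (p n)"
proof (rule shrinking_point_exists)
  show "cyl_clopen (fst (p n))" "fst (p n) \<noteq> {}" for n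
    using branch_good[OF assms, of n] by (auto simp: good_pair_def good_def)
qed (use branch_Suc[OF assms] in \<open>simp_all\<close>)

lemma branch_snd_point:
  assumes "branch p"
  shows "\<exists>c. \<forall>n. c \<in> snd (p n)"
proof (rule shrinking_point_exists)
  show "cyl_clopen (snd (p n))" "snd (p n) \<noteq> {}" for n
    using branch_good[OF assms, of n] by (auto simp: good_pair_def good_def)
qed (use branch_Suc[OF assms] in \<open>simp_all\<close>)

text \<open>The ratios form a Cauchy sequence with limit \<open>\<rho>\<close>, and the heights on
  both sides converge to the values at \<open>c\<close> and \<open>d\<close>, so the relation
  between heights passes to the limit. The error bound is uniform over all branches and will give
  continuity of the factor.\<close>

lemma branch_value:
  assumes p: "branch p" and c: "\<And>n. c \<in> fst (p n)" and d: "\<And>n. d \<in> snd (p n)"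
  shows "\<exists>\<rho>. \<psi> d = exp \<rho> * \<phi> c \<and> (\<forall>n. \<bar>\<rho> - ratio \<phi> \<psi> (p n)\<bar> \<le> 2 * (1/2)^n)"
proof -
  have c_lim: "(\<lambda>n. height \<phi> (fst (p n))) \<longlonglongrightarrow> \<phi> c"
    using height_shrinking[OF \<phi>, of c "\<lambda>n. fst (p n)"] c branch_Suc(1,4)[OF p] by simp
  have d_lim: "(\<lambda>n. height \<psi> (snd (p n))) \<longlonglongrightarrow> \<psi> d"
    using height_shrinking[OF \<psi>, of d "\<lambda>n. snd (p n)"] d branch_Suc(2,5)[OF p] by simp
  have close: "\<bar>ratio \<phi> \<psi> (p m) - ratio \<phi> \<psi> (p n)\<bar> \<le> 2 * (1/2)^n" if nm: "n \<le> m" for m n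
  proof -
    obtain k where k: "m = n + k"
      using nm le_Suc_ex by blast
    show ?thesis
      unfolding k by (rule order_trans[OF branch_ratio[OF p]]) simp
  qed
  have "Cauchy (\<lambda>n. ratio \<phi> \<psi> (p n))"
  proof (rule CauchyI')
    fix e :: real assume e: "0 < e"
    obtain n where n: "(1/2::real)^n < e/2"
      using real_arch_pow_inv[of "e/2" "1/2"] e by auto
    have "dist (ratio \<phi> \<psi> (p m)) (ratio \<phi> \<psi> (p k)) < e" if "n \<le> m" "m < k" for m k
    proof -
      have le: "(1/2::real)^m \<le> (1/2)^n"
        using that by (intro power_decreasing) auto
      have "dist (ratio \<phi> \<psi> (p m)) (ratio \<phi> \<psi> (p k)) \<le> 2 * (1/2)^m"
        using close[of m k] that by (simp add: dist_real_def abs_minus_commute)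
      also have "\<dots> \<le> 2 * (1/2)^n"
        using le by simp
      also have "\<dots> < e"
        using n by simp
      finally show ?thesis .
    qed
    then show "\<exists>M. \<forall>m\<ge>M. \<forall>n>m. dist (ratio \<phi> \<psi> (p m)) (ratio \<phi> \<psi> (p n)) < e"
      by blast
  qed
  then obtain \<rho> where \<rho>: "(\<lambda>n. ratio \<phi> \<psi> (p n)) \<longlonglongrightarrow> \<rho>"
    using Cauchy_convergent convergent_def by blast
  have eq: "height \<psi> (snd (p n)) = exp (ratio \<phi> \<psi> (p n)) * height \<phi> (fst (p n))" for n
  proof -
    have "0 < height \<psi> (snd (p n))" "0 < height \<phi> (fst (p n))"
      using height_pos \<phi> \<psi> branch_good[OF p, of n] by (auto simp: good_pair_def)
    then show ?thesis
      by (simp add: ratio_def exp_diff)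
  qed
  have "(\<lambda>n. exp (ratio \<phi> \<psi> (p n)) * height \<phi> (fst (p n))) \<longlonglongrightarrow> exp \<rho> * \<phi> c"
    by (intro tendsto_intros \<rho> c_lim)
  then have "\<psi> d = exp \<rho> * \<phi> c"
    using LIMSEQ_unique[OF d_lim] eq by simp
  moreover have "\<bar>\<rho> - ratio \<phi> \<psi> (p n)\<bar> \<le> 2 * (1/2)^n" for n
  proof (rule tendsto_upperbound)
    show "(\<lambda>m. \<bar>ratio \<phi> \<psi> (p m) - ratio \<phi> \<psi> (p n)\<bar>) \<longlonglongrightarrow> \<bar>\<rho> - ratio \<phi> \<psi> (p n)\<bar>"
      by (intro tendsto_intros \<rho>)
    show "\<forall>\<^sub>F m in sequentially. \<bar>ratio \<phi> \<psi> (p m) - ratio \<phi> \<psi> (p n)\<bar> \<le> 2 * (1/2)^n"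
      using close[of n] by (auto simp: eventually_sequentially)
  qed simp
  ultimately show ?thesis
    by blast
qed

lemma branch_agree:
  assumes p: "branch p"
  shows "c \<in> fst (p n) \<Longrightarrow> c' \<in> fst (p n) \<Longrightarrow> agree n c c'"
    and "d \<in> snd (p n) \<Longrightarrow> d' \<in> snd (p n) \<Longrightarrow> agree n d d'"
  using branch_mem_mono[OF p, of _ n] branch_Suc(4,5)[OF p] unfolding agree_def
  by (metis Suc_leI subsetD)+

text \<open>\<open>h c\<close> is the point of the second Cantor set on the branch through
  \<open>c\<close>, and \<open>\<alpha> c\<close> is \<open>exp\<close> of the limit ratio. Points
  near \<open>c\<close> share its branch up to stage \<open>n\<close>, which fixes \<open>n\<close>
  digits of \<open>h\<close> and the ratio up to \<open>2 * (1/2)^n\<close>; so both are continuous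
  on the positive part.\<close>

lemma equivalence:
  "\<exists>h \<alpha> B. bij_betw h {c. 0 < \<phi> c} {d. 0 < \<psi> d} \<and>
     (\<forall>c. 0 < \<phi> c \<longrightarrow> 0 < \<alpha> c \<and> \<alpha> c \<le> B \<and> \<psi> (h c) = \<alpha> c * \<phi> c) \<and>
     (\<forall>c n. 0 < \<phi> c \<longrightarrow> (\<exists>m. \<forall>c'. 0 < \<phi> c' \<and> agree m c c' \<longrightarrow> agree n (h c) (h c'))) \<and>
     (\<forall>c e. 0 < \<phi> c \<and> 0 < e \<longrightarrow> (\<exists>m. \<forall>c'. 0 < \<phi> c' \<and> agree m c c' \<longrightarrow> \<bar>\<alpha> c' - \<alpha> c\<bar> < (e::real)))"
proof -
  obtain p where p: "\<And>c. 0 < \<phi> c \<Longrightarrow> branch (p c)" "\<And>c n. 0 < \<phi> c \<Longrightarrow> c \<in> fst (p c n)"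
    using branch_exists_fst by metis
  have "\<forall>c. \<exists>d. 0 < \<phi> c \<longrightarrow> (\<forall>n. d \<in> snd (p c n))"
    using branch_snd_point p(1) by blast
  then obtain h where h: "\<And>c n. 0 < \<phi> c \<Longrightarrow> h c \<in> snd (p c n)"
    by metis
  have "\<exists>\<rho>. 0 < \<phi> c \<longrightarrow> \<psi> (h c) = exp \<rho> * \<phi> c \<and> (\<forall>n. \<bar>\<rho> - ratio \<phi> \<psi> (p c n)\<bar> \<le> 2 * (1/2)^n)" for c
    using branch_value[OF p(1), of c c "h c"] p(2) h by blast
  then obtain \<rho> where \<rho>: "\<And>c. 0 < \<phi> c \<Longrightarrow> \<psi> (h c) = exp (\<rho> c) * \<phi> c"
    "\<And>c n. 0 < \<phi> c \<Longrightarrow> \<bar>\<rho> c - ratio \<phi> \<psi> (p c n)\<bar> \<le> 2 * (1/2)^n"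
    by metis
  \<comment> \<open>At stage \<open>0\<close> every branch starts with the pair of whole Cantor
    sets, and \<open>\<rho>\<close> differs from the ratio there by at most
    \<open>2 * (1/2)^0 = 2\<close>.\<close>
  define B where "B = exp (ratio \<phi> \<psi> (UNIV, UNIV) + 2)"
  have pos: "0 < \<psi> (h c)" if "0 < \<phi> c" for c
    using \<rho>(1)[OF that] that by simp
  have same: "p c' n = p c n" if "0 < \<phi> c" "0 < \<phi> c'" "c' \<in> fst (p c n)" for c c' n
    using branch_unique_fst[OF p(1)[OF that(2)] p(1)[OF that(1)] that(2)] p(2)[OF that(2)] that(3) by blast
  have local_same: "\<exists>m. \<forall>c'. 0 < \<phi> c' \<and> agree m c c' \<longrightarrow> p c' n = p c n" if c: "0 < \<phi> c" for c n
  proof -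
    obtain m where "\<And>d. agree m c d \<Longrightarrow> d \<in> fst (p c n)"
      using branch_good[OF p(1)[OF c], of n] p(2)[OF c, of n]
      unfolding good_pair_def good_def cyl_clopen_def by blast
    then show ?thesis
      using same[OF c] by blast
  qed
  have inj: "inj_on h {c. 0 < \<phi> c}"
  proof (rule inj_onI)
    fix c c' assume c: "c \<in> {c. 0 < \<phi> c}" "c' \<in> {c. 0 < \<phi> c}" and eq: "h c = h c'"
    have "p c n = p c' n" for n
      using branch_unique_snd[of "p c" "p c'" "h c" n] p(1) h[of c n] h[of c' n] pos[of c] c eq by auto
    then have "agree n c c'" for n
      using branch_agree(1)[of "p c" c n c'] p(1)[of c] p(2)[of c n] p(2)[of c' n] c by auto
    then show "c = c'"
      by (auto simp: agree_def)
  qed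
  have surj: "d \<in> h ` {c. 0 < \<phi> c}" if d: "0 < \<psi> d" for d
  proof -
    obtain q where q: "branch q" "\<And>n. d \<in> snd (q n)"
      using branch_exists_snd d by blast
    obtain c where c: "\<And>n. c \<in> fst (q n)"
      using branch_fst_point q(1) by blast
    obtain r where "\<psi> d = exp r * \<phi> c"
      using branch_value[OF q(1) c q(2)] by blast
    then have c0: "0 < \<phi> c"
      using d by (metis exp_gt_zero zero_less_mult_pos)
    have "p c n = q n" for n
      using branch_unique_fst[OF p(1)[OF c0] q(1) c0 p(2)[OF c0] c] .
    then have "agree n d (h c)" for n
      using branch_agree(2)[OF q(1), of d n "h c"] q(2)[of n] h[OF c0, of n] by simp
    then have "d = h c"
      by (auto simp: agree_def)
    then show ?thesis
      using c0 by blast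
  qed
  have "bij_betw h {c. 0 < \<phi> c} {d. 0 < \<psi> d}"
    unfolding bij_betw_def using inj surj pos by blast
  moreover have "0 < exp (\<rho> c) \<and> exp (\<rho> c) \<le> B \<and> \<psi> (h c) = exp (\<rho> c) * \<phi> c" if c: "0 < \<phi> c" for c
  proof -
    have "\<bar>\<rho> c - ratio \<phi> \<psi> (p c 0)\<bar> \<le> 2"
      using \<rho>(2)[OF c, of 0] by simp
    moreover have "p c 0 = (UNIV, UNIV)"
      using p(1)[OF c] by (simp add: branch_def)
    ultimately show ?thesis
      using \<rho>(1)[OF c] by (simp add: B_def)
  qed
  moreover have "\<exists>m. \<forall>c'. 0 < \<phi> c' \<and> agree m c c' \<longrightarrow> agree n (h c) (h c')" if c: "0 < \<phi> c" for c n
  proof -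
    obtain m where m: "\<And>c'. 0 < \<phi> c' \<Longrightarrow> agree m c c' \<Longrightarrow> p c' n = p c n"
      using local_same[OF c] by blast
    then show ?thesis
      using branch_agree(2)[OF p(1)[OF c], of "h c" n] h c by metis
  qed
  moreover have "\<exists>m. \<forall>c'. 0 < \<phi> c' \<and> agree m c c' \<longrightarrow> \<bar>exp (\<rho> c') - exp (\<rho> c)\<bar> < e"
    if c: "0 < \<phi> c" and e: "0 < e" for c and e :: real
  proof -
    obtain \<delta> where \<delta>: "0 < \<delta>" "\<And>t. \<bar>t - \<rho> c\<bar> < \<delta> \<Longrightarrow> \<bar>exp t - exp (\<rho> c)\<bar> < e"
      using isCont_exp[of "\<rho> c"] e unfolding continuous_at_eps_delta
      by (metis (no_types) abs_minus_commute continuous_at_eps_delta dist_real_def isCont_exp dist_commute)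
    \<comment> \<open>Both \<open>\<rho> c\<close> and \<open>\<rho> c'\<close> are within
      \<open>2 * (1/2)^n\<close> of the common ratio at stage \<open>n\<close>, so they differ by
      less than \<open>\<delta>\<close>.\<close>
    obtain n where n: "(1/2::real)^n < \<delta>/4"
      using real_arch_pow_inv[of "\<delta>/4" "1/2"] \<delta> by auto
    obtain m where m: "\<And>c'. 0 < \<phi> c' \<Longrightarrow> agree m c c' \<Longrightarrow> p c' n = p c n"
      using local_same[OF c] by blast
    have "\<bar>\<rho> c' - \<rho> c\<bar> < \<delta>" if "0 < \<phi> c'" "agree m c c'" for c'
      using \<rho>(2)[OF that(1), of n] \<rho>(2)[OF c, of n] m[OF that] n by auto
    then show ?thesis
      using \<delta>(2) by blast
  qed
  ultimately show ?thesis
    by (intro exI[of _ h] exI[of _ "\<lambda>c. exp (\<rho> c)"] exI[of _ B]) blast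
qed

end

section \<open>Uniqueness of the Lelek fan\<close>

context rooted_fan
begin

lemma upper_compact: "compact {p \<in> X. r \<le> mu p}"
proof -
  have "closed {p \<in> X. mu p \<in> {r..}}"
    using continuous_closed_preimage[OF mu_continuous compact_imp_closed[OF X_compact], of "{r..}"]
    by (simp add: vimage_def Int_def)
  moreover have "{p \<in> X. r \<le> mu p} = X \<inter> {p \<in> X. mu p \<in> {r..}}"
    by auto
  ultimately show ?thesis
    using compact_Int_closed[OF X_compact] by metis
qed

text \<open>The closure of \<open>C\<close> still lies at heights at least \<open>r\<close>, hence
  is a continuum missing \<open>v\<close>; so above a positive height connected sets stay on one
  leg.\<close>

lemma upper_connected_chain:
  assumes r: "0 < r" and C: "connected C" "C \<subseteq> {p \<in> X. r \<le> mu p}" and xy: "x \<in> C" "y \<in> C"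
  shows "x \<in> A y \<or> y \<in> A x"
proof -
  have sub: "closure C \<subseteq> {p \<in> X. r \<le> mu p}"
    using closure_minimal[OF C(2) compact_imp_closed[OF upper_compact]] .
  then have "compact (closure C)"
    using compact_Int_closed[OF upper_compact[of r] closed_closure[of C]] by (simp add: Int_absorb1)
  then have "continuum (closure C)"
    using C(1) xy closure_subset by (auto simp: continuum_def connected_imp_connected_closure)
  moreover have "v \<notin> closure C"
    using sub mu_root r by auto
  moreover have "closure C \<subseteq> X"
    using sub by auto
  ultimately show ?thesis
    using continuum_chain[of "closure C" x y] xy closure_subset by blast
qed

text \<open>A connected set joining \<open>U\<close> and \<open>V\<close> above height
  \<open>r'\<close> would give comparable points in them. The segment between these lies above its
  lower end, hence at heights at least \<open>r\<close> and inside the union of \<open>U\<close> and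
  \<open>V\<close>, and would connect the two disjoint compact sets.\<close>

lemma clopen_extension:
  assumes r: "0 < r'" "r' \<le> r"
    and UV: "U \<union> V = {p \<in> X. r \<le> mu p}" "U \<inter> V = {}" "compact U" "compact V"
  shows "\<exists>U' V'. U' \<union> V' = {p \<in> X. r' \<le> mu p} \<and> U' \<inter> V' = {} \<and> U \<subseteq> U' \<and> V \<subseteq> V' \<and> compact U' \<and> compact V'"
proof (rule compact_separation[OF upper_compact])
  show "closed U" "closed V"
    using UV compact_imp_closed by auto
  have "{p \<in> X. r \<le> mu p} \<subseteq> {p \<in> X. r' \<le> mu p}"
    using r by auto
  then show "U \<subseteq> {p \<in> X. r' \<le> mu p}" "V \<subseteq> {p \<in> X. r' \<le> mu p}"
    unfolding UV(1)[symmetric] by blast+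
  fix C assume C: "connected C" "C \<subseteq> {p \<in> X. r' \<le> mu p}"
  have no: False if pq: "p \<in> U \<union> V" "q \<in> U \<union> V" "p \<in> A q" "p \<in> U \<and> q \<in> V \<or> p \<in> V \<and> q \<in> U" for p q
  proof -
    have q: "q \<in> X" and p: "r \<le> mu p"
      using pq(1,2) UV(1) by auto
    have "seg p q \<subseteq> U \<union> V"
      unfolding UV(1) using p mu_le A_in[OF q] by (force simp: seg_def)
    moreover have "connected (seg p q)"
      using seg_continuum[OF q pq(3)] by (simp add: continuum_def)
    moreover have "U \<inter> V \<inter> seg p q = {}"
      using UV(2) by blast
    ultimately have "U \<inter> seg p q = {} \<or> V \<inter> seg p q = {}"
      using connected_closedD compact_imp_closed[OF UV(3)] compact_imp_closed[OF UV(4)] by blast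
    then show False
      using seg_ends[OF q pq(3)] pq(4) by blast
  qed
  show "C \<inter> U = {} \<or> C \<inter> V = {}"
  proof (rule ccontr)
    assume "\<not> ?thesis"
    then obtain p q where pq: "p \<in> C" "p \<in> U" "q \<in> C" "q \<in> V"
      by blast
    then have "p \<in> A q \<or> q \<in> A p"
      using upper_connected_chain[OF r(1) C] by blast
    then show False
      using no[of p q] no[of q p] pq by blast
  qed
qed

text \<open>\<open>v\<close> is removed because all legs meet there. A set that is clopen in the
  remainder is a union of whole legs, and as \<open>{v}\<close> is closed, openness may be tested in
  \<open>X\<close>.\<close>

definition leg_clopen :: "'a set \<Rightarrow> bool" where
  "leg_clopen S \<longleftrightarrow> S \<subseteq> X - {v} \<and> openin (top_of_set X) S \<and> openin (top_of_set X) (X - {v} - S)"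

text \<open>Partitions of \<open>{p \<in> X. \<epsilon> \<le> mu p}\<close> into two compact sets extend to smaller and smaller \<open>\<epsilon>\<close>;
  the unions of the two halves are clopen in \<open>X - {v}\<close>.\<close>
lemma leg_separation:
  assumes x: "x \<in> X" "x \<noteq> v" and y: "y \<in> X" "y \<noteq> v" and no: "x \<notin> A y" "y \<notin> A x"
  shows "\<exists>S. leg_clopen S \<and> x \<in> S \<and> y \<notin> S"
proof -
  define \<epsilon> where "\<epsilon> = min (mu x) (mu y)"
  have \<epsilon>: "0 < \<epsilon>"
    using mu_pos x y by (auto simp: \<epsilon>_def)
  define D where "D n = {p \<in> X. \<epsilon> / 2^n \<le> mu p}" for n
  define P where "P n UV \<longleftrightarrow> fst UV \<union> snd UV = D n \<and> fst UV \<inter> snd UV = {} \<and> compact (fst UV) \<and>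
    compact (snd UV) \<and> x \<in> fst UV \<and> y \<in> snd UV" for n UV
  have "\<exists>W. \<forall>n::nat. P n (W n) \<and> fst (W n) \<subseteq> fst (W (Suc n)) \<and> snd (W n) \<subseteq> snd (W (Suc n))"
  proof (rule dependent_nat_choice)
    have "\<exists>U V. U \<union> V = D 0 \<and> U \<inter> V = {} \<and> {x} \<subseteq> U \<and> {y} \<subseteq> V \<and> compact U \<and> compact V"
    proof (rule compact_separation)
      show "compact (D 0)"
        unfolding D_def by (rule upper_compact)
      show "{x} \<subseteq> D 0" "{y} \<subseteq> D 0"
        using x y by (auto simp: D_def \<epsilon>_def)
      show "C \<inter> {x} = {} \<or> C \<inter> {y} = {}" if "connected C" "C \<subseteq> D 0" for C
        using upper_connected_chain[of "\<epsilon> / 2^0" C x y] that \<epsilon> no unfolding D_def by auto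
    qed auto
    then obtain U V where "U \<union> V = D 0 \<and> U \<inter> V = {} \<and> {x} \<subseteq> U \<and> {y} \<subseteq> V \<and> compact U \<and> compact V"
      by blast
    then have "P 0 (U, V)"
      by (simp add: P_def)
    then show "\<exists>W. P 0 W"
      by blast
  next
    fix W n assume W: "P n W"
    have "\<exists>U' V'. U' \<union> V' = {p \<in> X. \<epsilon> / 2^Suc n \<le> mu p} \<and> U' \<inter> V' = {} \<and> fst W \<subseteq> U' \<and> snd W \<subseteq> V' \<and>
        compact U' \<and> compact V'"
      by (rule clopen_extension[of _ "\<epsilon> / 2^n"]) (use W \<epsilon> in \<open>auto simp: P_def D_def field_simps\<close>)
    then obtain U' V' where U'V': "U' \<union> V' = D (Suc n)" "U' \<inter> V' = {}" "fst W \<subseteq> U'" "snd W \<subseteq> V'"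
        "compact U'" "compact V'"
      unfolding D_def by blast
    then have "P (Suc n) (U', V')"
      using W by (auto simp: P_def)
    then show "\<exists>W'. P (Suc n) W' \<and> fst W \<subseteq> fst W' \<and> snd W \<subseteq> snd W'"
      using U'V' by (metis fst_conv snd_conv)
  qed
  then obtain W where W: "\<And>n. P n (W n)" "\<And>n. fst (W n) \<subseteq> fst (W (Suc n))" "\<And>n. snd (W n) \<subseteq> snd (W (Suc n))"
    by blast
  define U where "U n = fst (W n)" for n
  define V where "V n = snd (W n)" for n
  have UV: "U n \<union> V n = D n" "U n \<inter> V n = {}" "compact (U n)" "compact (V n)" "x \<in> U n" "y \<in> V n" for n
    using W(1)[of n] by (auto simp: P_def U_def V_def)
  have mono: "U m \<subseteq> U n" "V m \<subseteq> V n" if "m \<le> n" for m n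
    using lift_Suc_mono_le[of U m n] lift_Suc_mono_le[of V m n] W(2,3) that by (auto simp: U_def V_def)
  have ex: "\<exists>n. \<epsilon> / 2^n < mu p" if "p \<in> X" "p \<noteq> v" for p
  proof -
    have "0 < mu p / \<epsilon>"
      using mu_pos[OF that] \<epsilon> by simp
    then obtain n where "(1/2::real)^n < mu p / \<epsilon>"
      using real_arch_pow_inv[of "mu p / \<epsilon>" "1/2"] by auto
    then show ?thesis
      using \<epsilon> by (intro exI[of _ n]) (simp add: field_simps)
  qed
  define S where "S = (\<Union>n. U n)"
  define T where "T = (\<Union>n. V n)"
  have SD: "z \<in> X" "z \<noteq> v" if "z \<in> D n" for z n
  proof -
    show "z \<in> X" using that by (simp add: D_def)
    have "0 < \<epsilon> / 2^n" using \<epsilon> by simp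
    then show "z \<noteq> v" using that mu_root by (auto simp: D_def)
  qed
  have ST: "S \<union> T = X - {v}"
  proof
    show "S \<union> T \<subseteq> X - {v}"
      using UV(1) SD unfolding S_def T_def by blast
    show "X - {v} \<subseteq> S \<union> T"
    proof
      fix p assume p: "p \<in> X - {v}"
      then obtain n where "\<epsilon> / 2^n < mu p"
        using ex by blast
      then have "p \<in> D n"
        using p by (simp add: D_def)
      then show "p \<in> S \<union> T"
        using UV(1)[of n] unfolding S_def T_def by blast
    qed
  qed
  have dis: "S \<inter> T = {}"
  proof (rule ccontr)
    assume "\<not> ?thesis"
    then obtain p m n where "p \<in> U m" "p \<in> V n"
      by (auto simp: S_def T_def)
    then show False
      using mono(1)[of m "max m n"] mono(2)[of n "max m n"] UV(2)[of "max m n"] by auto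
  qed
  \<comment> \<open>Stated for a half \<open>K\<close> with complement \<open>K'\<close> so as to
    serve both halves. At a stage \<open>n\<close> with \<open>\<epsilon> / 2^n < mu p\<close> some
    neighbourhood of \<open>p\<close> lies above that height, and what avoids the compact set
    \<open>K' n\<close> there belongs to \<open>K n\<close>.\<close>
  have op: "openin (top_of_set X) (\<Union>n. K n)"
    if K: "\<And>n. K n \<union> K' n = D n" "\<And>n. K n \<inter> K' n = {}" "\<And>n. compact (K' n)"
      "\<And>m n. m \<le> n \<Longrightarrow> K m \<subseteq> K n" for K K' :: "nat \<Rightarrow> 'a set"
  proof (subst openin_subopen, intro ballI)
    fix p assume "p \<in> (\<Union>n. K n)"
    then obtain m where m: "p \<in> K m"
      by blast
    then have pX: "p \<in> X" "p \<noteq> v"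
      using SD K(1) by blast+
    obtain n0 where n0: "\<epsilon> / 2^n0 < mu p"
      using ex pX by blast
    define n where "n = max m n0"
    have "\<epsilon> / 2^n \<le> \<epsilon> / 2^n0"
      using \<epsilon> by (intro divide_left_mono power_increasing) (auto simp: n_def)
    then have n: "\<epsilon> / 2^n < mu p" "p \<in> K n"
      using n0 m K(4)[of m n] by (auto simp: n_def)
    define N where "N = (X \<inter> mu -` {\<epsilon> / 2^n<..}) \<inter> (X \<inter> - K' n)"
    have "openin (top_of_set X) N"
      unfolding N_def
      by (intro openin_Int continuous_openin_preimage_gen[OF mu_continuous] openin_open_Int open_Compl
          compact_imp_closed K(3)) auto
    moreover have "p \<in> N"
      using n pX K(2)[of n] by (auto simp: N_def)
    moreover have "N \<subseteq> K n"
      using K(1)[of n] unfolding N_def D_def by fastforce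
    ultimately show "\<exists>N. openin (top_of_set X) N \<and> p \<in> N \<and> N \<subseteq> (\<Union>n. K n)"
      by blast
  qed
  have "openin (top_of_set X) S"
    unfolding S_def by (rule op[of U V]) (use UV mono in auto)
  moreover have "openin (top_of_set X) T"
    unfolding T_def by (rule op[of V U]) (use UV mono in \<open>auto simp: Un_commute Int_commute\<close>)
  moreover have "T = X - {v} - S"
    using ST dis by blast
  ultimately have "leg_clopen S"
    unfolding leg_clopen_def using ST by auto
  moreover have "x \<in> S" "y \<in> T"
    using UV(5,6) by (auto simp: S_def T_def)
  ultimately show ?thesis
    using dis by blast
qed

lemma leg_clopen_comparable:
  assumes S: "leg_clopen S" and x: "x \<in> X" and y: "y \<in> A x" "y \<noteq> v"
  shows "x \<in> S \<longleftrightarrow> y \<in> S"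
proof -
  have yX: "y \<in> X" and xv: "x \<noteq> v"
    using x y A_in A_of_root by auto
  have conn: "connected (seg y x)"
    using seg_continuum[OF x y(1)] by (simp add: continuum_def)
  obtain O1 O2 where O: "open O1" "open O2" "S = X \<inter> O1" "X - {v} - S = X \<inter> O2"
    using S unfolding leg_clopen_def openin_open by blast
  have sub: "seg y x \<subseteq> X - {v}"
    using seg_sub(1)[OF x] seg_root[OF x] y by blast
  have SX: "S \<subseteq> X - {v}"
    using S by (simp add: leg_clopen_def)
  have "seg y x \<subseteq> O1 \<union> O2"
    using sub O by blast
  moreover have "O1 \<inter> O2 \<inter> seg y x = {}"
    using O sub by blast
  ultimately have "O1 \<inter> seg y x = {} \<or> O2 \<inter> seg y x = {}"
    using connectedD[OF conn O(1,2)] by blast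
  then show ?thesis
    using seg_ends[OF x y(1)] sub O by blast
qed

text \<open>Countably many sets suffice for all pairs of points: a separating set is fixed for each
  pair of small balls about points of a dense sequence, whenever there is one.\<close>

lemma separating_sequence:
  "\<exists>S::nat \<Rightarrow> 'a set. (\<forall>i. leg_clopen (S i)) \<and>
     (\<forall>x\<in>X - {v}. \<forall>y\<in>X - {v}. x \<notin> A y \<and> y \<notin> A x \<longrightarrow> (\<exists>i. x \<in> S i \<and> y \<notin> S i))"
proof -
  obtain q :: "nat \<Rightarrow> 'a" where q: "\<And>x e. x \<in> X \<Longrightarrow> 0 < e \<Longrightarrow> \<exists>n. dist x (q n) < e"
    using compact_dense_sequence[OF X_compact] root_in by blast
  define ok where "ok m n k S \<longleftrightarrow> leg_clopen S \<and> (X - {v}) \<inter> ball (q m) (1 / Suc k) \<subseteq> S \<and>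
    S \<inter> ball (q n) (1 / Suc k) = {}" for m n k S
  \<comment> \<open>The empty set is the default when nothing separates the two balls; it satisfies
    \<open>leg_clopen\<close> as well.\<close>
  define g where "g = (\<lambda>(m, n, k). if \<exists>S. ok m n k S then SOME S. ok m n k S else {})"
  have emp: "openin (top_of_set X) (X - {v})"
    by (metis Diff_eq open_Compl closed_singleton openin_open_Int)
  have g_clopen: "leg_clopen (g j)" for j
  proof -
    obtain m n k where j: "j = (m, n, k)"
      by (cases j)
    show ?thesis
    proof (cases "\<exists>S. ok m n k S")
      case True
      then have "ok m n k (g j)"
        using someI_ex[OF True] by (simp add: g_def j)
      then show ?thesis
        by (simp add: ok_def)
    next
      case False
      then have "g j = {}"
        by (simp only: g_def j case_prod_conv if_False)
      then show ?thesis
        using emp by (simp add: leg_clopen_def)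
    qed
  qed
  have sep: "\<exists>j. x \<in> g j \<and> y \<notin> g j" if x: "x \<in> X" "x \<noteq> v" and y: "y \<in> X" "y \<noteq> v" and no: "x \<notin> A y" "y \<notin> A x" for x y
  proof -
    obtain S where S: "leg_clopen S" "x \<in> S" "y \<notin> S"
      using leg_separation[OF x y no] by blast
    obtain O1 O2 where O: "open O1" "open O2" "S = X \<inter> O1" "X - {v} - S = X \<inter> O2"
      using S(1) unfolding leg_clopen_def openin_open by blast
    have "x \<in> O1" "y \<in> O2"
      using S x y O by blast+
    then obtain e1 e2 where e: "0 < e1" "ball x e1 \<subseteq> O1" "0 < e2" "ball y e2 \<subseteq> O2"
      using O(1,2) by (meson open_contains_ball)
    obtain k where k: "1 / Suc k < min e1 e2 / 2"
      using nat_approx_posE[of "min e1 e2 / 2"] e by auto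
    have kpos: "0 < 1 / real (Suc k)"
      by simp
    obtain m where m: "dist x (q m) < 1 / Suc k"
      using q[OF x(1) kpos] by blast
    obtain n where n: "dist y (q n) < 1 / Suc k"
      using q[OF y(1) kpos] by blast
    have "ball (q m) (1 / Suc k) \<subseteq> ball x e1"
    proof
      fix z assume "z \<in> ball (q m) (1 / Suc k)"
      then have "dist x z < 1 / Suc k + 1 / Suc k"
        using m dist_triangle[of x z "q m"] by simp
      then show "z \<in> ball x e1"
        using k by simp
    qed
    moreover have "ball (q n) (1 / Suc k) \<subseteq> ball y e2"
    proof
      fix z assume "z \<in> ball (q n) (1 / Suc k)"
      then have "dist y z < 1 / Suc k + 1 / Suc k"
        using n dist_triangle[of y z "q n"] by simp
      then show "z \<in> ball y e2"
        using k by simp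
    qed
    ultimately have "ok m n k S"
      unfolding ok_def using S(1) e O by blast
    then have "\<exists>S. ok m n k S"
      by blast
    then have okg: "ok m n k (g (m, n, k))"
      using someI_ex[of "ok m n k"] by (simp add: g_def)
    have "x \<in> ball (q m) (1 / Suc k)" "y \<in> ball (q n) (1 / Suc k)"
      using m n by (simp_all add: dist_commute)
    then have "x \<in> g (m, n, k)" "y \<notin> g (m, n, k)"
      using okg x unfolding ok_def by blast+
    then show ?thesis
      by blast
  qed
  have "\<exists>i. x \<in> g (from_nat i) \<and> y \<notin> g (from_nat i)"
    if x: "x \<in> X" "x \<noteq> v" and y: "y \<in> X" "y \<noteq> v" and no: "x \<notin> A y" "y \<notin> A x" for x y
    using sep[OF that] by (metis from_nat_to_nat)
  then show ?thesis
    using g_clopen by (intro exI[of _ "\<lambda>i. g (from_nat i)"]) blast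
qed

definition ind :: "nat \<Rightarrow> 'a set" where
  "ind = (SOME S. (\<forall>i. leg_clopen (S i)) \<and>
     (\<forall>x\<in>X - {v}. \<forall>y\<in>X - {v}. x \<notin> A y \<and> y \<notin> A x \<longrightarrow> (\<exists>i. x \<in> S i \<and> y \<notin> S i)))"

lemma ind: "leg_clopen (ind i)"
  "\<lbrakk>x \<in> X; x \<noteq> v; y \<in> X; y \<noteq> v; x \<notin> A y; y \<notin> A x\<rbrakk> \<Longrightarrow> \<exists>i. x \<in> ind i \<and> y \<notin> ind i"
proof -
  note * = someI_ex[OF separating_sequence, folded ind_def]
  show "leg_clopen (ind i)"
    using conjunct1[OF *] by blast
  show "\<lbrakk>x \<in> X; x \<noteq> v; y \<in> X; y \<noteq> v; x \<notin> A y; y \<notin> A x\<rbrakk> \<Longrightarrow> \<exists>i. x \<in> ind i \<and> y \<notin> ind i"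
    using conjunct2[OF *] by simp
qed

text \<open>The code of the leg through \<open>x\<close>. The root gets the constantly false code,
  which may coincide with that of a leg; hence the conditions \<open>x \<noteq> v\<close>
  below.\<close>

definition leg :: "'a \<Rightarrow> nat \<Rightarrow> bool" where
  "leg x i \<longleftrightarrow> x \<in> ind i"

lemma leg_eq_iff:
  assumes "x \<in> X" "x \<noteq> v" "y \<in> X" "y \<noteq> v"
  shows "leg x = leg y \<longleftrightarrow> x \<in> A y \<or> y \<in> A x"
proof
  assume "leg x = leg y"
  then have "x \<in> ind i \<longleftrightarrow> y \<in> ind i" for i
    by (metis leg_def)
  then show "x \<in> A y \<or> y \<in> A x"
    using ind(2)[OF assms] by blast
next
  assume "x \<in> A y \<or> y \<in> A x"
  then show "leg x = leg y"
    using leg_clopen_comparable[OF ind(1)] assms unfolding leg_def fun_eq_iff by blast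
qed

lemma leg_mu_inj:
  "\<lbrakk>x \<in> X; x \<noteq> v; y \<in> X; y \<noteq> v; leg x = leg y; mu x = mu y\<rbrakk> \<Longrightarrow> x = y"
  using leg_eq_iff[of x y] mu_eq_comparable[of x y] by blast

text \<open>Each digit is locally constant away from \<open>v\<close>, and finitely many digits
  allow a common radius. The radius may shrink as \<open>x\<close> approaches \<open>v\<close>, so
  continuity at the root needs a separate argument.\<close>

lemma leg_locally_constant:
  assumes x: "x \<in> X" "x \<noteq> v"
  shows "\<exists>d>0. \<forall>z\<in>X. dist z x < d \<longrightarrow> z \<noteq> v \<and> agree m (leg x) (leg z)"
proof -
  have "\<exists>d>0. \<forall>z\<in>X. dist z x < d \<longrightarrow> z \<noteq> v \<and> (leg x i = leg z i)" for i
  proof -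
    define S where "S = (if x \<in> ind i then ind i else X - {v} - ind i)"
    have "openin (top_of_set X) S" "x \<in> S"
      using ind(1)[of i] x by (auto simp: S_def leg_clopen_def)
    then obtain d where d: "0 < d" "ball x d \<inter> X \<subseteq> S"
      unfolding openin_contains_ball by blast
    have "S \<subseteq> X - {v}" "\<And>z. z \<in> S \<Longrightarrow> (x \<in> ind i) = (z \<in> ind i)"
      using ind(1)[of i] by (auto simp: S_def leg_clopen_def)
    moreover have "z \<in> S" if "z \<in> X" "dist z x < d" for z
      using d(2) that by (auto simp: dist_commute)
    ultimately show ?thesis
      using d(1) unfolding leg_def by blast
  qed
  then obtain d where d: "\<And>i. 0 < d i" "\<And>i z. z \<in> X \<Longrightarrow> dist z x < d i \<Longrightarrow> z \<noteq> v \<and> (leg x i = leg z i)"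
    by metis
  define e where "e = Min (d ` {..m})"
  have "0 < e" "\<And>i. i \<le> m \<Longrightarrow> e \<le> d i"
    using d(1) by (auto simp: e_def)
  then show ?thesis
    using d(2) unfolding agree_def
    by (intro exI[of _ e]) (metis less_imp_le less_le_trans order_refl)
qed

text \<open>The choice of \<open>e\<close> is immaterial: end points with the same code are
  comparable and hence equal.\<close>

definition leg_length :: "(nat \<Rightarrow> bool) \<Rightarrow> real" where
  "leg_length c = (if \<exists>e\<in>maxs - {v}. leg e = c then mu (SOME e. e \<in> maxs - {v} \<and> leg e = c) else 0)"

lemma leg_length_max:
  assumes e: "e \<in> maxs" "e \<noteq> v"
  shows "leg_length (leg e) = mu e"
proof -
  define e' where "e' = (SOME e'. e' \<in> maxs - {v} \<and> leg e' = leg e)"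
  have "e' \<in> maxs - {v} \<and> leg e' = leg e"
    unfolding e'_def by (rule someI[of _ e]) (use e in simp)
  then have e': "e' \<in> maxs" "e' \<noteq> v" "leg e' = leg e"
    by auto
  then have "e' \<in> A e \<or> e \<in> A e'"
    using leg_eq_iff[of e' e] e maxsD(1) by blast
  then have "e' = e"
    using e e' maxsD by metis
  then show ?thesis
    using e unfolding leg_length_def e'_def[symmetric] by auto
qed

lemma leg_length_posD:
  assumes "0 < leg_length c"
  shows "\<exists>e\<in>maxs. e \<noteq> v \<and> leg e = c \<and> leg_length c = mu e"
proof -
  have "\<exists>e\<in>maxs - {v}. leg e = c"
    using assms by (auto simp: leg_length_def split: if_splits)
  then show ?thesis
    using leg_length_max by blast
qed

lemma mu_le_leg_length:
  assumes x: "x \<in> X" "x \<noteq> v"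
  shows "mu x \<le> leg_length (leg x)"
proof -
  obtain e where e: "e \<in> maxs" "x \<in> A e"
    using maximal_above[OF x(1)] by blast
  have ev: "e \<noteq> v" and eX: "e \<in> X"
    using e x A_of_root maxsD by auto
  have "leg x = leg e"
    using leg_eq_iff[OF x eX ev] e by blast
  then show ?thesis
    using leg_length_max[OF e(1) ev] mu_le[OF eX e(2)] by simp
qed

lemma point_on_leg:
  assumes "0 < t" "t \<le> leg_length c"
  shows "\<exists>x\<in>X. x \<noteq> v \<and> leg x = c \<and> mu x = t"
proof -
  obtain e where e: "e \<in> maxs" "e \<noteq> v" "leg e = c" "leg_length c = mu e"
    using leg_length_posD assms by (metis less_le_trans)
  have eX: "e \<in> X"
    using e maxsD by blast
  define x where "x = pt e t"
  have x: "x \<in> A e" "mu x = t"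
    using pt_in[OF eX] mu_pt[OF eX] assms e by (auto simp: x_def)
  have xX: "x \<in> X" "x \<noteq> v"
    using x A_in[OF eX] assms mu_root by auto
  have "leg x = c"
    using leg_eq_iff[OF xX eX e(2)] x e by blast
  then show ?thesis
    using x xX by blast
qed

lemma leg_length_nonneg: "0 \<le> leg_length c"
proof (cases "\<exists>e\<in>maxs - {v}. leg e = c")
  case True
  then obtain e where "e \<in> maxs" "e \<noteq> v" "leg e = c"
    by blast
  then show ?thesis
    using leg_length_max[of e] mu_nonneg maxsD by metis
next
  case False
  then show ?thesis by (simp add: leg_length_def)
qed

text \<open>Otherwise end points of legs of length at least \<open>r\<close>, with codes tending to
  \<open>c\<close>, accumulate at a point \<open>x\<close> of height at least \<open>r\<close>. As
  \<open>r > 0\<close>, \<open>x\<close> is not the root, and by local constancy its code is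
  \<open>c\<close>; so the leg \<open>c\<close> would be too long.\<close>

lemma leg_length_usc:
  assumes r: "leg_length c < r"
  shows "\<exists>n. \<forall>d. agree n c d \<longrightarrow> leg_length d < r"
proof (rule ccontr)
  assume "\<not> ?thesis"
  then have "\<forall>n. \<exists>d. agree n c d \<and> r \<le> leg_length d"
    by (meson not_less)
  then obtain d where d: "\<And>n. agree n c (d n)" "\<And>n. r \<le> leg_length (d n)"
    by metis
  have r0: "0 < r"
    using r leg_length_nonneg[of c] by linarith
  have "\<forall>n. \<exists>e. e \<in> X \<and> e \<noteq> v \<and> leg e = d n \<and> r \<le> mu e"
    using leg_length_posD d(2) r0 maxsD(1) by (metis less_le_trans)
  then obtain e where e: "\<And>n. e n \<in> X" "\<And>n. e n \<noteq> v" "\<And>n. leg (e n) = d n" "\<And>n. r \<le> mu (e n)"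
    by metis
  obtain x k where k: "x \<in> X" "strict_mono k" "(e \<circ> k) \<longlonglongrightarrow> x"
    using X_compact e(1) unfolding compact_eq_seq_compact_metric seq_compact_def by metis
  have "(\<lambda>n. mu ((e \<circ> k) n)) \<longlonglongrightarrow> mu x"
    using continuous_on_tendsto_compose[OF mu_continuous k(3) k(1)] e(1) by simp
  then have mux: "r \<le> mu x"
    by (rule tendsto_lowerbound) (use e(4) in auto)
  then have xv: "x \<noteq> v"
    using r0 mu_root by auto
  have "leg x i = c i" for i
  proof -
    obtain \<delta> where \<delta>: "0 < \<delta>" "\<And>z. z \<in> X \<Longrightarrow> dist z x < \<delta> \<Longrightarrow> z \<noteq> v \<and> agree (Suc i) (leg x) (leg z)"
      using leg_locally_constant[OF k(1) xv] by blast
    obtain N where N: "\<And>n. N \<le> n \<Longrightarrow> dist ((e \<circ> k) n) x < \<delta>"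
      using k(3) \<delta>(1) unfolding lim_sequentially by blast
    define n where "n = max N (Suc i)"
    have "agree (Suc i) (leg x) (d (k n))"
      using \<delta>(2)[of "e (k n)"] N[of n] e(1,3) by (simp add: n_def)
    moreover have "Suc i \<le> k n"
      using strict_mono_imp_increasing[OF k(2), of n] by (simp add: n_def)
    then have "agree (Suc i) c (d (k n))"
      using d(1) agree_mono by blast
    ultimately show ?thesis
      by (simp add: agree_def)
  qed
  then have "leg x = c"
    by blast
  then show False
    using mu_le_leg_length[OF k(1) xv] mux r by simp
qed

end

context lelek_rooted_fan
begin

text \<open>The density condition comes from the point \<open>x\<close> on the leg \<open>c\<close>
  whose height is midway between \<open>s\<close> and \<open>t\<close>: an end point close to
  \<open>x\<close> has a code close to \<open>c\<close> and a length still between \<open>s\<close>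
  and \<open>t\<close>.\<close>

lemma lelek_function_leg_length: "lelek_function leg_length"
  unfolding lelek_function_def
proof (intro conjI allI impI)
  show "0 \<le> leg_length c" for c
    by (rule leg_length_nonneg)
  obtain m where m: "m \<in> X" "\<And>y. y \<in> X \<Longrightarrow> mu y \<le> mu m"
    using continuous_attains_sup[OF X_compact _ mu_continuous] root_in by blast
  have "leg_length c \<le> mu m" for c
  proof (cases "0 < leg_length c")
    case True
    then show ?thesis
      using leg_length_posD m maxsD(1) by metis
  next
    case False
    then show ?thesis
      using mu_nonneg[OF m(1)] by linarith
  qed
  then show "\<exists>B. \<forall>c. leg_length c \<le> B"
    by blast
  obtain x where "x \<in> X" "x \<noteq> v"
    using nontrivial root_in by blast
  then have "0 < leg_length (leg x)"
    using mu_le_leg_length mu_pos by (meson less_le_trans)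
  then show "\<exists>c. 0 < leg_length c"
    by blast
next
  fix c r assume "leg_length c < r"
  then show "\<exists>n. \<forall>d. agree n c d \<longrightarrow> leg_length d < r"
    by (rule leg_length_usc)
next
  fix c n and s t :: real assume st: "0 \<le> s \<and> s < t \<and> t \<le> leg_length c"
  define u where "u = (s + t) / 2"
  have u: "0 < u" "u \<le> leg_length c" "s < u" "u < t"
    using st by (auto simp: u_def)
  obtain x where x: "x \<in> X" "x \<noteq> v" "leg x = c" "mu x = u"
    using point_on_leg[OF u(1,2)] by blast
  obtain d1 where d1: "0 < d1" "\<And>z. z \<in> X \<Longrightarrow> dist z x < d1 \<Longrightarrow> z \<noteq> v \<and> agree n (leg x) (leg z)"
    using leg_locally_constant[OF x(1,2)] by blast
  have "0 < (t - s) / 2"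
    using st by simp
  then obtain d2 where d2: "0 < d2" "\<And>z. z \<in> X \<Longrightarrow> dist z x < d2 \<Longrightarrow> dist (mu z) (mu x) < (t - s) / 2"
    using mu_continuous x(1) unfolding continuous_on_iff by metis
  obtain e where e: "e \<in> maxs" "dist e x < min d1 d2"
    using maxs_approx[OF x(1), of "min d1 d2"] d1(1) d2(1) by auto
  have eX: "e \<in> X"
    using e maxsD by blast
  have "agree n c (leg e)" "e \<noteq> v"
    using d1(2)[OF eX] e x by auto
  moreover have "dist (mu e) u < (t - s) / 2"
    using d2(2)[OF eX] e x by auto
  then have "\<bar>mu e - u\<bar> < (t - s) / 2"
    by (simp add: dist_real_def)
  then have "s < mu e" "mu e < t"
    unfolding u_def by (auto simp: abs_less_iff field_simps)
  ultimately show "\<exists>d. agree n c d \<and> s < leg_length d \<and> leg_length d < t"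
    using leg_length_max[OF e(1)] by (intro exI[of _ "leg e"]) auto
qed

end

section \<open>Assembling the homeomorphism\<close>

lemma LIMSEQ_of_subsequences:
  fixes u :: "nat \<Rightarrow> 'a::metric_space"
  assumes K: "compact K" "\<And>n. u n \<in> K"
    and lim: "\<And>k y. \<lbrakk>strict_mono k; y \<in> K; (u \<circ> k) \<longlonglongrightarrow> y\<rbrakk> \<Longrightarrow> y = l"
  shows "u \<longlonglongrightarrow> l"
proof (rule ccontr)
  assume "\<not> u \<longlonglongrightarrow> l"
  then obtain e where e: "0 < e" "\<exists>\<^sub>F n in sequentially. \<not> dist (u n) l < e"
    unfolding tendsto_iff by (auto simp: not_eventually)
  have "infinite {n. \<not> dist (u n) l < e}"
    using e(2) by (simp add: cofinite_eq_sequentially[symmetric] frequently_cofinite)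
  then obtain k :: "nat \<Rightarrow> nat" where k: "strict_mono k" "\<And>n. \<not> dist (u (k n)) l < e"
    using infinite_enumerate by blast
  obtain y j where j: "y \<in> K" "strict_mono j" "((u \<circ> k) \<circ> j) \<longlonglongrightarrow> y"
    using K unfolding compact_eq_seq_compact_metric seq_compact_def by (metis comp_apply)
  then have "y = l"
    using lim[of "k \<circ> j" y] strict_mono_o[OF k(1) j(2)] by (simp add: o_assoc)
  then obtain n where "dist (((u \<circ> k) \<circ> j) n) l < e"
    using j(3) e(1) unfolding lim_sequentially by blast
  then show False
    using k(2) by simp
qed

text \<open>\<open>F\<close> sends the root to the root, and the point with code \<open>c\<close>
  and height \<open>t\<close> to the point with code \<open>h c\<close> and height
  \<open>\<alpha> c * t\<close>. By compactness, continuity follows once subsequential limits are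
  identified through their height and their code.\<close>

theorem lelek_rooted_fans_homeomorphic:
  fixes X :: "'a::metric_space set" and X' :: "'b::metric_space set"
  assumes "lelek_rooted_fan X v A" "lelek_rooted_fan X' v' A'"
  shows "\<exists>F. continuous_on X F \<and> inj_on F X \<and> F ` X = X'"
proof -
  interpret L: lelek_rooted_fan X v A by fact
  interpret M: lelek_rooted_fan X' v' A' by fact
  interpret lelek_pair L.leg_length M.leg_length
    by unfold_locales (rule L.lelek_function_leg_length M.lelek_function_leg_length)+
  from equivalence obtain h \<alpha> B where eqv: "bij_betw h {c. 0 < L.leg_length c} {d. 0 < M.leg_length d} \<and>
     (\<forall>c. 0 < L.leg_length c \<longrightarrow> 0 < \<alpha> c \<and> \<alpha> c \<le> B \<and> M.leg_length (h c) = \<alpha> c * L.leg_length c) \<and>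
     (\<forall>c n. 0 < L.leg_length c \<longrightarrow> (\<exists>m. \<forall>c'. 0 < L.leg_length c' \<and> agree m c c' \<longrightarrow> agree n (h c) (h c'))) \<and>
     (\<forall>c e. 0 < L.leg_length c \<and> 0 < e \<longrightarrow>
       (\<exists>m. \<forall>c'. 0 < L.leg_length c' \<and> agree m c c' \<longrightarrow> \<bar>\<alpha> c' - \<alpha> c\<bar> < (e::real)))"
    by (elim exE) (rule that)
  have h: "bij_betw h {c. 0 < L.leg_length c} {d. 0 < M.leg_length d}"
    using eqv by (rule conjunct1)
  have \<alpha>: "0 < \<alpha> c" "\<alpha> c \<le> B" "M.leg_length (h c) = \<alpha> c * L.leg_length c" if "0 < L.leg_length c" for c
    using conjunct1[OF conjunct2[OF eqv]] that by blast+
  have h_cont: "\<exists>m. \<forall>c'. 0 < L.leg_length c' \<and> agree m c c' \<longrightarrow> agree n (h c) (h c')"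
    if "0 < L.leg_length c" for c n
    using conjunct1[OF conjunct2[OF conjunct2[OF eqv]]] that by simp
  have \<alpha>_cont: "\<exists>m. \<forall>c'. 0 < L.leg_length c' \<and> agree m c c' \<longrightarrow> \<bar>\<alpha> c' - \<alpha> c\<bar> < e"
    if "0 < L.leg_length c" "0 < e" for c and e :: real
    using conjunct2[OF conjunct2[OF conjunct2[OF eqv]]] that by simp
  have legpos: "0 < L.leg_length (L.leg x)" if "x \<in> X" "x \<noteq> v" for x
    using L.mu_le_leg_length[OF that] L.mu_pos[OF that] by linarith
  have legpos': "0 < M.leg_length (M.leg x)" if "x \<in> X'" "x \<noteq> v'" for x
    using M.mu_le_leg_length[OF that] M.mu_pos[OF that] by linarith
  have "\<exists>z. z \<in> X' \<and> (if x = v then z = v' else z \<noteq> v' \<and> M.leg z = h (L.leg x) \<and> M.mu z = \<alpha> (L.leg x) * L.mu x)"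
    if x: "x \<in> X" for x
  proof (cases "x = v")
    case True
    then show ?thesis using M.root_in by auto
  next
    case False
    have "0 < \<alpha> (L.leg x) * L.mu x"
      using \<alpha>(1) legpos L.mu_pos x False by simp
    moreover have "\<alpha> (L.leg x) * L.mu x \<le> M.leg_length (h (L.leg x))"
      using \<alpha>(1,3)[OF legpos[OF x False]] L.mu_le_leg_length[OF x False] by simp
    ultimately show ?thesis
      using M.point_on_leg False by metis
  qed
  then obtain F where F: "\<And>x. x \<in> X \<Longrightarrow> F x \<in> X'" "F v = v'"
    "\<And>x. x \<in> X \<Longrightarrow> x \<noteq> v \<Longrightarrow> F x \<noteq> v'" "\<And>x. x \<in> X \<Longrightarrow> x \<noteq> v \<Longrightarrow> M.leg (F x) = h (L.leg x)"
    "\<And>x. x \<in> X \<Longrightarrow> x \<noteq> v \<Longrightarrow> M.mu (F x) = \<alpha> (L.leg x) * L.mu x"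
    using L.root_in by metis
  have "inj_on F X"
  proof (rule inj_onI)
    fix x y assume x: "x \<in> X" and y: "y \<in> X" and eq: "F x = F y"
    show "x = y"
    proof (cases "x = v \<or> y = v")
      case True
      then show ?thesis using F(2,3) x y eq by metis
    next
      case False
      then have "h (L.leg x) = h (L.leg y)"
        using F(4) x y eq by metis
      then have leg: "L.leg x = L.leg y"
        using h legpos x y False by (auto simp: bij_betw_def dest: inj_onD)
      moreover have "L.mu x = L.mu y"
        using F(5)[of x] F(5)[of y] x y eq False leg \<alpha>(1)[OF legpos[OF x]] by simp
      ultimately show ?thesis
        using L.leg_mu_inj x y False by blast
    qed
  qed
  moreover have "F ` X = X'"
  proof
    show "F ` X \<subseteq> X'"
      using F(1) by blast
    show "X' \<subseteq> F ` X"
    proof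
      fix z assume z: "z \<in> X'"
      show "z \<in> F ` X"
      proof (cases "z = v'")
        case True
        then show ?thesis using F(2) L.root_in by blast
      next
        case False
        have "M.leg z \<in> h ` {c. 0 < L.leg_length c}"
          using h legpos'[OF z False] by (simp add: bij_betw_def)
        then obtain c where c: "0 < L.leg_length c" "h c = M.leg z"
          by auto
        have "M.mu z \<le> \<alpha> c * L.leg_length c"
          using M.mu_le_leg_length[OF z False] \<alpha>(3)[OF c(1)] c(2) by simp
        then have "0 < M.mu z / \<alpha> c" "M.mu z / \<alpha> c \<le> L.leg_length c"
          using \<alpha>(1)[OF c(1)] M.mu_pos[OF z False] by (auto simp: field_simps)
        then obtain x where x: "x \<in> X" "x \<noteq> v" "L.leg x = c" "L.mu x = M.mu z / \<alpha> c"
          using L.point_on_leg by blast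
        have "M.leg (F x) = M.leg z" "M.mu (F x) = M.mu z"
          using F(4,5)[OF x(1,2)] x c \<alpha>(1)[OF c(1)] by auto
        then have "F x = z"
          using M.leg_mu_inj F(1,3) x z False by blast
        then show ?thesis
          using x by blast
      qed
    qed
  qed
  moreover have "continuous_on X F"
    unfolding continuous_on_sequentially
  proof (intro allI ballI impI)
    fix s x assume x: "x \<in> X" and sx: "(\<forall>n. s n \<in> X) \<and> s \<longlonglongrightarrow> x"
    then have s: "\<And>n. s n \<in> X" "s \<longlonglongrightarrow> x"
      by auto
    have mu_s: "(\<lambda>n. L.mu (s n)) \<longlonglongrightarrow> L.mu x"
      using continuous_on_tendsto_compose[OF L.mu_continuous s(2) x] s(1) by simp
    show "(F \<circ> s) \<longlonglongrightarrow> F x"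
    proof (rule LIMSEQ_of_subsequences[OF M.X_compact])
      show "(F \<circ> s) n \<in> X'" for n
        using F(1) s(1) by simp
      fix k y assume k: "strict_mono k" and y: "y \<in> X'" and lim: "(F \<circ> s \<circ> k) \<longlonglongrightarrow> y"
      have mu_y: "(\<lambda>n. M.mu (F (s (k n)))) \<longlonglongrightarrow> M.mu y"
        using continuous_on_tendsto_compose[OF M.mu_continuous lim y] F(1) s(1) by simp
      have mu_sk: "(\<lambda>n. L.mu (s (k n))) \<longlonglongrightarrow> L.mu x"
        using LIMSEQ_subseq_LIMSEQ[OF mu_s k] by (simp add: o_def)
      have sk: "(\<lambda>n. s (k n)) \<longlonglongrightarrow> x"
        using LIMSEQ_subseq_LIMSEQ[OF s(2) k] by (simp add: o_def)
      show "y = F x"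
      proof (cases "x = v")
        case True
        \<comment> \<open>Codes say nothing near the root, but the factors are bounded by
          \<open>B\<close>, so heights tending to \<open>0\<close> are mapped to heights tending to
          \<open>0\<close>.\<close>
        have bound: "norm (M.mu (F (s (k n)))) \<le> B * L.mu (s (k n))" for n
        proof (cases "s (k n) = v")
          case True
          then show ?thesis using F(2) M.mu_root L.mu_root by simp
        next
          case False
          then show ?thesis
            using F(5)[OF s(1)] \<alpha>(1,2)[OF legpos[OF s(1)]] L.mu_nonneg[OF s(1)]
            by (simp add: abs_mult mult_right_mono less_imp_le)
        qed
        have "(\<lambda>n. B * L.mu (s (k n))) \<longlonglongrightarrow> 0"
          using tendsto_mult_left[OF mu_sk, of B] True L.mu_root by simp
        then have "(\<lambda>n. M.mu (F (s (k n)))) \<longlonglongrightarrow> 0"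
          by (rule Lim_null_comparison[OF always_eventually[OF allI[OF bound]]])
        then have "M.mu y = 0"
          using LIMSEQ_unique mu_y by blast
        then show ?thesis
          using M.mu_pos[OF y] F(2) True by force
      next
        case False
        define c where "c = L.leg x"
        have c: "0 < L.leg_length c"
          using legpos x False by (simp add: c_def)
        have near: "\<forall>\<^sub>F n in sequentially. s (k n) \<noteq> v \<and> agree m c (L.leg (s (k n)))" for m
        proof -
          obtain d where d: "0 < d" "\<And>z. z \<in> X \<Longrightarrow> dist z x < d \<Longrightarrow> z \<noteq> v \<and> agree m (L.leg x) (L.leg z)"
            using L.leg_locally_constant[OF x False] by blast
          show ?thesis
            using tendstoD[OF sk d(1)] by eventually_elim (use d(2) s(1) c_def in blast)
        qed
        have \<alpha>_lim: "(\<lambda>n. \<alpha> (L.leg (s (k n)))) \<longlonglongrightarrow> \<alpha> c"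
        proof (rule tendstoI)
          fix e :: real assume "0 < e"
          then obtain m where m: "\<And>c'. 0 < L.leg_length c' \<Longrightarrow> agree m c c' \<Longrightarrow> \<bar>\<alpha> c' - \<alpha> c\<bar> < e"
            using \<alpha>_cont[OF c] by blast
          show "\<forall>\<^sub>F n in sequentially. dist (\<alpha> (L.leg (s (k n)))) (\<alpha> c) < e"
            using near[of m] by eventually_elim (use m legpos s(1) in \<open>simp add: dist_real_def\<close>)
        qed
        have "(\<lambda>n. \<alpha> (L.leg (s (k n))) * L.mu (s (k n))) \<longlonglongrightarrow> \<alpha> c * L.mu x"
          by (intro tendsto_mult \<alpha>_lim mu_sk)
        moreover have "\<forall>\<^sub>F n in sequentially. \<alpha> (L.leg (s (k n))) * L.mu (s (k n)) = M.mu (F (s (k n)))"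
          using near[of 0] by eventually_elim (use F(5) s(1) in simp)
        ultimately have "(\<lambda>n. M.mu (F (s (k n)))) \<longlonglongrightarrow> \<alpha> c * L.mu x"
          by (rule Lim_transform_eventually)
        then have mu_eq: "M.mu y = M.mu (F x)"
          using LIMSEQ_unique[OF mu_y] F(5)[OF x False] by (simp add: c_def)
        then have yv: "y \<noteq> v'"
          using M.mu_pos[OF F(1)[OF x] F(3)[OF x False]] M.mu_root by auto
        \<comment> \<open>Both digits agree with that of \<open>M.leg (F (s (k n)))\<close> for
          large \<open>n\<close>: the left one by local constancy of codes near \<open>y\<close>,
          the right one by continuity of \<open>h\<close> at \<open>c\<close>. The condition
          \<open>y \<noteq> v'\<close> came from the heights.\<close>
        have "M.leg y i = h c i" for i
        proof -
          obtain m where m: "\<And>c'. 0 < L.leg_length c' \<Longrightarrow> agree m c c' \<Longrightarrow> agree (Suc i) (h c) (h c')"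
            using h_cont[OF c] by blast
          obtain d where d: "0 < d" "\<And>z. z \<in> X' \<Longrightarrow> dist z y < d \<Longrightarrow> z \<noteq> v' \<and> agree (Suc i) (M.leg y) (M.leg z)"
            using M.leg_locally_constant[OF y yv] by blast
          have "\<forall>\<^sub>F n in sequentially. dist ((F \<circ> s \<circ> k) n) y < d"
            using tendstoD[OF lim d(1)] .
          then have "\<forall>\<^sub>F n in sequentially. M.leg y i = h c i"
            using near[of m]
          proof eventually_elim
            case (elim n)
            have "agree (Suc i) (M.leg y) (M.leg (F (s (k n))))"
              using d(2)[of "F (s (k n))"] elim F(1) s(1) by simp
            moreover have "M.leg (F (s (k n))) = h (L.leg (s (k n)))"
              using F(4) s(1) elim by blast
            moreover have "agree (Suc i) (h c) (h (L.leg (s (k n))))"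
              using m legpos s(1) elim by blast
            ultimately show ?case
              by (simp add: agree_def)
          qed
          then show ?thesis
            by simp
        qed
        then have "M.leg y = M.leg (F x)"
          using F(4)[OF x False] by (auto simp: c_def)
        then show ?thesis
          using M.leg_mu_inj[OF y yv F(1)[OF x] F(3)[OF x False]] mu_eq by blast
      qed
    qed
  qed
  ultimately show ?thesis
    by blast
qed

section \<open>Fans and arcs\<close>

lemma arc_reparametrize:
  fixes k :: "real \<Rightarrow> 'a::metric_space"
  assumes k: "continuous_on {a..b} k" "inj_on k {a..b}" and ab: "a < b"
  shows "\<exists>g. arc g \<and> pathstart g = k a \<and> pathfinish g = k b \<and> path_image g = k ` {a..b}"
proof -
  define l where "l t = a + t * (b - a)" for t
  have l_im: "l ` {0..1} = {a..b}"
  proof (intro set_eqI iffI)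
    fix s assume "s \<in> l ` {0..1}"
    then obtain t where t: "0 \<le> t" "t \<le> 1" "s = l t"
      by auto
    then have "0 \<le> t * (b - a)" "t * (b - a) \<le> b - a"
      using ab by (auto intro: mult_left_le_one_le)
    then show "s \<in> {a..b}"
      using t by (auto simp: l_def)
  next
    fix s assume "s \<in> {a..b}"
    then show "s \<in> l ` {0..1}"
      using ab by (intro image_eqI[of _ _ "(s - a) / (b - a)"]) (auto simp: l_def)
  qed
  have "continuous_on {0..1} l"
    unfolding l_def by (intro continuous_intros)
  then have "path (k \<circ> l)"
    unfolding path_def using k(1) l_im by (metis continuous_on_compose)
  moreover have "inj_on l {0..1}"
    using ab by (auto simp: l_def inj_on_def)
  then have "inj_on (k \<circ> l) {0..1}"
    using k(2) l_im by (intro comp_inj_on) auto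
  moreover have "path_image (k \<circ> l) = k ` {a..b}"
    unfolding path_image_def image_comp[symmetric] l_im ..
  moreover have "pathstart (k \<circ> l) = k a" "pathfinish (k \<circ> l) = k b"
    by (simp_all add: pathstart_def pathfinish_def l_def)
  ultimately show ?thesis
    unfolding arc_def by blast
qed

lemma arc_restrict:
  fixes g :: "real \<Rightarrow> 'a::metric_space"
  assumes g: "arc g" and ab: "0 \<le> a" "a < b" "b \<le> 1"
  shows "\<exists>k. arc k \<and> pathstart k = g a \<and> pathfinish k = g b \<and> path_image k = g ` {a..b}"
proof (rule arc_reparametrize[OF _ _ ab(2)])
  have "{a..b} \<subseteq> {0..1}"
    using ab by auto
  then show "continuous_on {a..b} g" "inj_on g {a..b}"
    using g unfolding arc_def path_def by (blast intro: continuous_on_subset inj_on_subset)+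
qed

lemma arc_halves_meet:
  assumes g: "arc g" and t: "0 \<le> t" "t \<le> 1"
  shows "g ` {0..t} \<inter> g ` {t..1} = {g t}"
proof
  have inj: "inj_on g {0..1}"
    using g by (simp add: arc_def)
  show "g ` {0..t} \<inter> g ` {t..1} \<subseteq> {g t}"
  proof
    fix p assume "p \<in> g ` {0..t} \<inter> g ` {t..1}"
    then obtain a b where ab: "a \<in> {0..t}" "b \<in> {t..1}" "p = g a" "p = g b"
      by blast
    then have "a = b"
      using t by (intro inj_onD[OF inj]) auto
    then show "p \<in> {g t}"
      using ab by auto
  qed
qed (use t in auto)

lemma arc_connected_between:
  fixes g :: "real \<Rightarrow> 'a::metric_space"
  assumes g: "arc g" and T: "connected T" "T \<subseteq> path_image g" and ab: "g a \<in> T" "g b \<in> T"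
    and t: "0 \<le> a" "a \<le> t" "t \<le> b" "b \<le> 1"
  shows "g t \<in> T"
proof -
  obtain h where h: "homeomorphism {0..1} (path_image g) g h"
    using homeomorphism_arc[OF g] .
  have "connected (h ` T)"
    using connected_continuous_image[OF continuous_on_subset[OF _ T(2)] T(1)] h by (auto simp: homeomorphism_def)
  moreover have "h (g a) = a" "h (g b) = b"
    using homeomorphism_apply1[OF h] t by auto
  ultimately have "t \<in> h ` T"
    using ab t by (metis connectedD_interval imageI)
  then obtain y where "y \<in> T" "t = h y"
    by blast
  then show ?thesis
    using homeomorphism_apply2[OF h, of y] T(2) by auto
qed

lemma arc_connected_subset:
  fixes g :: "real \<Rightarrow> 'a::metric_space"
  assumes "arc g" "connected T" "T \<subseteq> path_image g" "pathstart g \<in> T" "pathfinish g \<in> T"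
  shows "T = path_image g"
  using arc_connected_between[OF assms(1-3), of 0 1] assms
  by (auto simp: path_image_def pathstart_def pathfinish_def)

lemma continuum_path_image: "arc (g :: real \<Rightarrow> 'a::metric_space) \<Longrightarrow> continuum (path_image g)"
  by (simp add: continuum_def arc_imp_path compact_path_image connected_path_image path_image_nonempty)

section \<open>Uniqueness of arcs under hereditary unicoherence\<close>

lemma arc_in_continuum: "v \<in> X \<Longrightarrow> arc_in X v x P \<Longrightarrow> continuum P \<and> P \<subseteq> X \<and> v \<in> P \<and> x \<in> P"
  unfolding arc_in_def using continuum_path_image
  by (auto simp: continuum_def split: if_splits)

lemma hereditarily_unicoherentD:
  "\<lbrakk>hereditarily_unicoherent X; continuum P; P \<subseteq> X; continuum Q; Q \<subseteq> X\<rbrakk> \<Longrightarrow> connected (P \<inter> Q)"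
  unfolding hereditarily_unicoherent_def by blast

text \<open>Unicoherence makes the intersection of the arc with \<open>Q\<close> connected, and a
  connected subset of an arc that contains both ends is the whole arc. Applied to two arcs this
  gives uniqueness, which makes \<open>arc_from\<close> meaningful.\<close>

lemma arc_in_subset_unique:
  assumes hu: "hereditarily_unicoherent X" and v: "v \<in> X" and P: "arc_in X v x P"
    and Q: "continuum Q" "Q \<subseteq> X" "v \<in> Q" "x \<in> Q"
  shows "P \<subseteq> Q"
proof (cases "x = v")
  case True
  then show ?thesis
    using P Q by (auto simp: arc_in_def)
next
  case False
  then obtain g where g: "arc g" "path_image g = P" "pathstart g = v" "pathfinish g = x"
    using P by (auto simp: arc_in_def)
  have "connected (P \<inter> Q)"
    using hu arc_in_continuum[OF v P] Q unfolding hereditarily_unicoherent_def by blast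
  then have "P \<inter> Q = P"
    using arc_connected_subset[OF g(1), of "P \<inter> Q"] g Q arc_in_continuum[OF v P] by auto
  then show ?thesis
    by blast
qed

lemma arc_from_eq:
  assumes hu: "hereditarily_unicoherent X" and v: "v \<in> X" and P: "arc_in X v x P"
  shows "arc_from X v x = P"
  unfolding arc_from_def
proof (rule the_equality)
  show "arc_in X v x P"
    by (rule P)
  fix Q assume Q: "arc_in X v x Q"
  show "Q = P"
    using arc_in_subset_unique[OF hu v P] arc_in_subset_unique[OF hu v Q]
      arc_in_continuum[OF v P] arc_in_continuum[OF v Q] by blast
qed

lemma arc_from_on_arc:
  assumes hu: "hereditarily_unicoherent X" and g: "arc g" "path_image g \<subseteq> X" and t: "0 \<le> t" "t \<le> 1"
  shows "arc_from X (pathstart g) (g t) = g ` {0..t}"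
proof (rule arc_from_eq[OF hu])
  have g0: "pathstart g = g 0"
    by (simp add: pathstart_def)
  show "pathstart g \<in> X"
    using g by auto
  have sub: "g ` {0..t} \<subseteq> X"
    using g t by (auto simp: path_image_def)
  show "arc_in X (pathstart g) (g t) (g ` {0..t})"
  proof (cases "t = 0")
    case True
    then show ?thesis
      using sub g0 by (simp add: arc_in_def)
  next
    case False
    then have "g t \<noteq> g 0"
      using g(1) t by (auto simp: arc_def dest: inj_onD)
    moreover obtain k where "arc k" "pathstart k = g 0" "pathfinish k = g t" "path_image k = g ` {0..t}"
      using arc_restrict[OF g(1), of 0 t] False t by auto
    ultimately show ?thesis
      using sub g0 unfolding arc_in_def by auto
  qed
qed

lemma infdist_le_hausdorff_dist:
  fixes P Q :: "'a::metric_space set"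
  assumes "compact P" "compact Q"
  shows "p \<in> P \<Longrightarrow> infdist p Q \<le> hausdorff_dist P Q" "q \<in> Q \<Longrightarrow> infdist q P \<le> hausdorff_dist P Q"
proof -
  have *: "bdd_above ((\<lambda>a. infdist a S) ` R)" if "compact R" for R S :: "'a set"
    using compact_imp_bounded[OF compact_continuous_image[OF continuous_on_infdist[OF continuous_on_id] that]]
    by (rule bounded_imp_bdd_above)
  show "p \<in> P \<Longrightarrow> infdist p Q \<le> hausdorff_dist P Q"
    unfolding hausdorff_dist_def using cSUP_upper[OF _ *[OF assms(1)]] by (simp add: le_max_iff_disj)
  show "q \<in> Q \<Longrightarrow> infdist q P \<le> hausdorff_dist P Q"
    unfolding hausdorff_dist_def using cSUP_upper[OF _ *[OF assms(2)]] by (simp add: le_max_iff_disj)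
qed

lemma hausdorff_dist_le:
  assumes "P \<noteq> {}" "Q \<noteq> {}" "\<And>p. p \<in> P \<Longrightarrow> infdist p Q \<le> e" "\<And>q. q \<in> Q \<Longrightarrow> infdist q P \<le> e"
  shows "hausdorff_dist P Q \<le> e"
  unfolding hausdorff_dist_def using assms by (auto intro!: cSUP_least)

text \<open>The two semicontinuity axioms are the two halves of Hausdorff convergence, given by
  smoothness. The linear order on each \<open>A x\<close> is read off from a parametrization; the
  chain axiom combines unicoherence with the absence of ramification points other than
  \<open>v\<close>.\<close>

lemma lelek_fan_imp_rooted:
  fixes X :: "'a::metric_space set"
  assumes "lelek_fan X"
  shows "\<exists>v. lelek_rooted_fan X v (arc_from X v)"
proof -
  have fan: "fan X" and dens: "closure {x. end_point X x} = X"
    using assms by (auto simp: lelek_fan_def smooth_fan_def)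
  obtain v where ram: "ramification_point X v"
    and smooth: "\<And>x s. x \<in> X \<Longrightarrow> (\<And>n. s n \<in> X) \<Longrightarrow> s \<longlonglongrightarrow> x \<Longrightarrow>
      (\<lambda>n. hausdorff_dist (arc_from X v (s n)) (arc_from X v x)) \<longlonglongrightarrow> 0"
    using assms unfolding lelek_fan_def smooth_fan_def by blast
  have ram_unique: "\<And>z. ramification_point X z \<Longrightarrow> z = v"
    using fan ram unfolding fan_def by blast
  have X: "continuum X" "arcwise_connected X" and hu: "hereditarily_unicoherent X"
    using fan by (auto simp: fan_def dendroid_def)
  have Xc: "compact X"
    using X by (simp add: continuum_def)
  obtain g1 g2 where g12: "arc g1" "arc g2" "pathstart g1 = v" "pathstart g2 = v"
    "path_image g1 \<subseteq> X" "path_image g2 \<subseteq> X" "path_image g1 \<inter> path_image g2 = {v}"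
    using ram unfolding ramification_point_def by blast
  have v: "v \<in> X"
    using g12 by blast
  define A where "A = arc_from X v"
  have Av: "A v = {v}"
    unfolding A_def by (rule arc_from_eq[OF hu v]) (use v in \<open>simp add: arc_in_def\<close>)
  have arcE: "\<exists>g. arc g \<and> path_image g = A x \<and> A x \<subseteq> X \<and> g 0 = v \<and> g 1 = x \<and> (\<forall>t\<in>{0..1}. A (g t) = g ` {0..t})"
    if x: "x \<in> X" "x \<noteq> v" for x
  proof -
    obtain g where g: "arc g" "path_image g \<subseteq> X" "pathstart g = v" "pathfinish g = x"
      using X(2) v x unfolding arcwise_connected_def by metis
    have "A (g t) = g ` {0..t}" if "t \<in> {0..1}" for t
      using arc_from_on_arc[OF hu g(1,2), of t] g(3) that by (simp add: A_def)
    moreover from this[of 1] have "A x = path_image g"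
      using g by (simp add: path_image_def pathfinish_def)
    ultimately show ?thesis
      using g by (intro exI[of _ g]) (auto simp: pathstart_def pathfinish_def)
  qed
  have A_arc_in: "arc_in X v x (A x)" if x: "x \<in> X" for x
  proof (cases "x = v")
    case True
    then show ?thesis using Av v by (simp add: arc_in_def)
  next
    case False
    then show ?thesis
      using arcE[OF x False] unfolding arc_in_def pathstart_def pathfinish_def by auto
  qed
  have A_cont: "continuum (A x)" "A x \<subseteq> X" "v \<in> A x" "x \<in> A x" if x: "x \<in> X" for x
    using arc_in_continuum[OF v A_arc_in[OF x]] by auto
  have A_comp: "compact (A x)" "A x \<noteq> {}" if x: "x \<in> X" for x
    using A_cont[OF x] by (auto simp: continuum_def)
  have haus: "infdist p (A y) \<le> hausdorff_dist (A x) (A y)" "infdist q (A x) \<le> hausdorff_dist (A x) (A y)"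
    if "x \<in> X" "y \<in> X" "p \<in> A x" "q \<in> A y" for x y p q
    using infdist_le_hausdorff_dist[OF A_comp(1) A_comp(1)] that by auto
  \<comment> \<open>\<open>z\<close> is the last point of \<open>A x\<close> that lies on
    \<open>A y\<close>. If it were not \<open>v\<close>, the arc back to \<open>v\<close> and the
    remainders of the two arcs would form a triod with top \<open>z\<close>.\<close>
  have meet: "A x \<inter> A y = {v}" if x: "x \<in> X" and y: "y \<in> X" and no: "x \<notin> A y" "y \<notin> A x" for x y
  proof -
    have xv: "x \<noteq> v" and yv: "y \<noteq> v"
      using no A_cont(3)[OF x] A_cont(3)[OF y] by auto
    obtain g where g: "arc g" "path_image g = A x" "g 0 = v" "g 1 = x" "\<And>t. t \<in> {0..1} \<Longrightarrow> A (g t) = g ` {0..t}"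
      using arcE[OF x xv] by blast
    obtain h where h: "arc h" "path_image h = A y" "h 0 = v" "h 1 = y" "\<And>t. t \<in> {0..1} \<Longrightarrow> A (h t) = h ` {0..t}"
      using arcE[OF y yv] by blast
    have conn: "connected (A x \<inter> A y)"
      using hu A_cont(1,2)[OF x] A_cont(1,2)[OF y] unfolding hereditarily_unicoherent_def by blast
    define T where "T = {t \<in> {0..1}. g t \<in> A y}"
    have gc: "continuous_on {0..1} g"
      using g(1) by (simp add: arc_def path_def)
    have "compact T"
      unfolding T_def by (rule compact_level_Icc[OF gc compact_imp_closed[OF A_comp(1)[OF y]]])
    moreover have "0 \<in> T"
      using g(3) A_cont(3)[OF y] by (simp add: T_def)
    ultimately obtain \<tau> where \<tau>: "\<tau> \<in> T" "\<And>t. t \<in> T \<Longrightarrow> t \<le> \<tau>"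
      using compact_attains_sup by (metis empty_iff)
    define z where "z = g \<tau>"
    have \<tau>1: "0 \<le> \<tau>" "\<tau> \<le> 1" and zy: "z \<in> A y"
      using \<tau>(1) by (auto simp: T_def z_def)
    have zx: "z \<in> A x"
      using g(2) \<tau>1 by (auto simp: path_image_def z_def)
    have Az: "A z = g ` {0..\<tau>}"
      using g(5) \<tau>1 by (simp add: z_def)
    have meet_z: "A x \<inter> A y \<subseteq> A z"
    proof
      fix p assume p: "p \<in> A x \<inter> A y"
      then obtain t where "t \<in> {0..1}" "p = g t"
        using g(2) unfolding path_image_def by blast
      then show "p \<in> A z"
        unfolding Az using \<tau>(2)[of t] p by (auto simp: T_def)
    qed
    obtain \<sigma> where \<sigma>: "\<sigma> \<in> {0..1}" "z = h \<sigma>"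
      using zy h(2) unfolding path_image_def by blast
    have Az': "A z = h ` {0..\<sigma>}"
      using h(5) \<sigma> by simp
    have "\<tau> < 1"
      using \<tau>1 no(1) zy g(4) by (metis less_le z_def)
    have "\<sigma> < 1"
      using \<sigma> no(2) zx h(4) by (metis atLeastAtMost_iff less_le)
    have "z = v"
    proof (rule ccontr)
      assume zv: "z \<noteq> v"
      then have pos: "0 < \<tau>" "0 < \<sigma>"
        using \<tau>1 \<sigma> g(3) h(3) by (auto simp: z_def less_le)
      obtain k where k: "arc k" "pathfinish k = g \<tau>" "path_image k = g ` {0..\<tau>}"
        using arc_restrict[OF g(1), of 0 \<tau>] pos \<tau>1 by auto
      define k1 where "k1 = reversepath k"
      obtain k2 where k2: "arc k2" "pathstart k2 = g \<tau>" "path_image k2 = g ` {\<tau>..1}"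
        using arc_restrict[OF g(1), of \<tau> 1] \<open>\<tau> < 1\<close> \<tau>1 by auto
      obtain k3 where k3: "arc k3" "pathstart k3 = h \<sigma>" "path_image k3 = h ` {\<sigma>..1}"
        using arc_restrict[OF h(1), of \<sigma> 1] \<open>\<sigma> < 1\<close> \<sigma> by auto
      have arcs: "arc k1" "arc k2" "arc k3"
        using k k2 k3 by (auto simp: k1_def arc_reversepath)
      have starts: "pathstart k1 = z" "pathstart k2 = z" "pathstart k3 = z"
        using k k2 k3 by (auto simp: k1_def z_def \<sigma>(2)[symmetric])
      have im: "path_image k1 = A z" "path_image k2 = g ` {\<tau>..1}" "path_image k3 = h ` {\<sigma>..1}"
        using k k2 k3 Az by (auto simp: k1_def)
      have sub: "g ` {\<tau>..1} \<subseteq> A x" "h ` {\<sigma>..1} \<subseteq> A y"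
        using g(2) h(2) \<tau>1 \<sigma> by (auto simp: path_image_def)
      have i12: "A z \<inter> g ` {\<tau>..1} = {z}" and i13: "A z \<inter> h ` {\<sigma>..1} = {z}"
        using arc_halves_meet[OF g(1) \<tau>1] arc_halves_meet[OF h(1), of \<sigma>] Az Az' \<sigma> by (auto simp: z_def)
      have i23: "g ` {\<tau>..1} \<inter> h ` {\<sigma>..1} = {z}"
        using meet_z sub i12 i13 by blast
      have zX: "z \<in> X"
        using zx A_cont(2)[OF x] by blast
      have subs: "path_image k1 \<subseteq> X" "path_image k2 \<subseteq> X" "path_image k3 \<subseteq> X"
        unfolding im using sub A_cont(2)[OF x] A_cont(2)[OF y] A_cont(2)[OF zX] by blast+
      have meets: "path_image k1 \<inter> path_image k2 = {z}" "path_image k1 \<inter> path_image k3 = {z}"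
        "path_image k2 \<inter> path_image k3 = {z}"
        unfolding im using i12 i13 i23 .
      have "ramification_point X z"
        unfolding ramification_point_def
        by (intro exI[of _ k1] exI[of _ k2] exI[of _ k3] conjI arcs starts subs meets)
      then show False
        using ram_unique zv by blast
    qed
    then show ?thesis
      using meet_z Av A_cont(3)[OF x] A_cont(3)[OF y] by auto
  qed
  have "rooted_fan X v A"
  proof
    show "compact X" "v \<in> X" "A v = {v}"
      using Xc v Av by auto
    show "A x \<subseteq> X" "compact (A x)" "connected (A x)" "x \<in> A x" "v \<in> A x" if "x \<in> X" for x
      using A_cont[OF that] by (auto simp: continuum_def)
    fix x assume x: "x \<in> X"
    show "A y \<subseteq> A x" if y: "y \<in> A x" for y
    proof (cases "x = v")
      case True
      then show ?thesis using y Av by auto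
    next
      case False
      then obtain g where g: "path_image g = A x" "\<And>t. t \<in> {0..1} \<Longrightarrow> A (g t) = g ` {0..t}"
        using arcE[OF x] by blast
      obtain t where t: "t \<in> {0..1}" "y = g t"
        using y g(1) unfolding path_image_def by blast
      have "g ` {0..t} \<subseteq> path_image g"
        unfolding path_image_def using t by (intro image_mono) auto
      then show ?thesis
        using g(1) g(2)[OF t(1)] t(2) by simp
    qed
    show "y \<in> A z \<or> z \<in> A y" if yz: "y \<in> A x" "z \<in> A x" for y z
    proof (cases "x = v")
      case True
      then show ?thesis using yz Av by auto
    next
      case False
      then obtain g where g: "path_image g = A x" "\<And>t. t \<in> {0..1} \<Longrightarrow> A (g t) = g ` {0..t}"
        using arcE[OF x] by blast
      obtain s t where st: "s \<in> {0..1}" "t \<in> {0..1}" "y = g s" "z = g t"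
        using yz g(1) unfolding path_image_def by blast
      then show ?thesis
        using g(2)[of s] g(2)[of t] by (cases "s \<le> t") auto
    qed
    show "x = y" if xy: "y \<in> A x" "x \<in> A y" for y
    proof (cases "x = v")
      case True
      then show ?thesis using xy Av by auto
    next
      case False
      then obtain g where g: "arc g" "path_image g = A x" "g 1 = x" "\<And>t. t \<in> {0..1} \<Longrightarrow> A (g t) = g ` {0..t}"
        using arcE[OF x] by blast
      obtain s where s: "s \<in> {0..1}" "y = g s"
        using xy(1) g(2) unfolding path_image_def by blast
      then obtain t where t: "t \<in> {0..s}" "x = g t"
        using xy(2) g(4)[OF s(1)] by auto
      have "t = 1"
        using g(1,3) s t by (auto simp: arc_def dest: inj_onD)
      then show ?thesis
        using s t by simp
    qed
  next
    fix F :: "'a set" assume F: "closed F"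
    show "closed {x \<in> X. A x \<inter> F \<noteq> {}}"
      unfolding closed_sequential_limits
    proof (intro allI impI)
      fix s l assume "(\<forall>n. s n \<in> {x \<in> X. A x \<inter> F \<noteq> {}}) \<and> s \<longlonglongrightarrow> l"
      then have s: "\<And>n. s n \<in> X" "\<forall>n. \<exists>t. t \<in> A (s n) \<and> t \<in> F" "s \<longlonglongrightarrow> l"
        by auto
      have l: "l \<in> X"
        using closed_sequentially[OF compact_imp_closed[OF Xc]] s by blast
      obtain t where t: "\<And>n. t n \<in> A (s n)" "\<And>n. t n \<in> F"
        using s(2) by metis
      have "t n \<in> X" for n
        using t(1) A_cont(2)[OF s(1)] by blast
      then obtain y k where k: "strict_mono k" "(t \<circ> k) \<longlonglongrightarrow> y"
        using Xc unfolding compact_eq_seq_compact_metric seq_compact_def by metis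
      have "y \<in> F"
        using closed_sequentially[OF F _ k(2)] t(2) by simp
      have "(\<lambda>n. hausdorff_dist (A (s n)) (A l)) \<longlonglongrightarrow> 0"
        using smooth[OF l s(1) s(3)] by (simp add: A_def)
      then have "((\<lambda>n. hausdorff_dist (A (s n)) (A l)) \<circ> k) \<longlonglongrightarrow> 0"
        by (rule LIMSEQ_subseq_LIMSEQ[OF _ k(1)])
      then have "(\<lambda>n. infdist ((t \<circ> k) n) (A l)) \<longlonglongrightarrow> 0"
        by (rule Lim_null_comparison[rotated])
          (use haus(1)[OF s(1) l t(1) A_cont(4)[OF l]] in \<open>simp add: infdist_nonneg\<close>)
      moreover have "(\<lambda>n. infdist ((t \<circ> k) n) (A l)) \<longlonglongrightarrow> infdist y (A l)"
        by (rule tendsto_infdist[OF k(2)])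
      ultimately have "infdist y (A l) = 0"
        using LIMSEQ_unique by blast
      then have "y \<in> A l"
        using in_closed_iff_infdist_zero[OF compact_imp_closed[OF A_comp(1)[OF l]] A_comp(2)[OF l]] by simp
      then show "l \<in> {x \<in> X. A x \<inter> F \<noteq> {}}"
        using l \<open>y \<in> F\<close> by blast
    qed
  next
    fix U :: "'a set" assume U: "open U"
    have cl: "closed {x \<in> X. A x \<inter> U = {}}"
      unfolding closed_sequential_limits
    proof (intro allI impI)
      fix s l assume "(\<forall>n. s n \<in> {x \<in> X. A x \<inter> U = {}}) \<and> s \<longlonglongrightarrow> l"
      then have s: "\<And>n. s n \<in> X" "\<And>n. A (s n) \<inter> U = {}" "s \<longlonglongrightarrow> l"
        by auto
      have l: "l \<in> X"
        using closed_sequentially[OF compact_imp_closed[OF Xc]] s by blast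
      have "y \<notin> U" if y: "y \<in> A l" for y
      proof
        assume "y \<in> U"
        then obtain e where e: "0 < e" "ball y e \<subseteq> U"
          using U open_contains_ball by blast
        have "(\<lambda>n. hausdorff_dist (A (s n)) (A l)) \<longlonglongrightarrow> 0"
          using smooth[OF l s(1) s(3)] by (simp add: A_def)
        then have "\<forall>\<^sub>F n in sequentially. hausdorff_dist (A (s n)) (A l) < e"
          using e(1) by (rule order_tendstoD)
        then obtain n where n: "hausdorff_dist (A (s n)) (A l) < e"
          using eventually_happens by (metis eventually_sequentially order_refl)
        have "infdist y (A (s n)) < e"
          using haus(2)[OF s(1) l A_cont(4)[OF s(1)] y] n by (rule le_less_trans)
        then obtain c where "c \<in> A (s n)" "dist y c < e"
          using infdist_attained[of "A (s n)" y] A_comp[OF s(1)] by metis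
        then show False
          using e s(2)[of n] by auto
      qed
      then show "l \<in> {x \<in> X. A x \<inter> U = {}}"
        using l by blast
    qed
    have eq: "{x \<in> X. A x \<inter> U \<noteq> {}} = X \<inter> - {x \<in> X. A x \<inter> U = {}}"
      by blast
    show "openin (top_of_set X) {x \<in> X. A x \<inter> U \<noteq> {}}"
      unfolding eq by (intro openin_open_Int open_Compl cl)
  next
    fix K x assume "continuum K" "K \<subseteq> X" "v \<in> K" "x \<in> K"
    then show "A x \<subseteq> K"
      using arc_in_subset_unique[OF hu v A_arc_in] by blast
  next
    fix K x y assume K: "continuum K" "K \<subseteq> X" "v \<notin> K" "x \<in> K" "y \<in> K"
    show "x \<in> A y \<or> y \<in> A x"
    proof (rule ccontr)
      assume no: "\<not> ?thesis"
      have x: "x \<in> X" and y: "y \<in> X"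
        using K by auto
      have m: "A x \<inter> A y = {v}"
        using meet[OF x y] no by blast
      \<comment> \<open>By unicoherence \<open>K\<close> meets this continuum in a connected set,
        but the closed sets \<open>A x\<close> and \<open>A y\<close> would split it, as their only
        common point \<open>v\<close> is not in \<open>K\<close>.\<close>
      have "continuum (A x \<union> A y)"
        using A_cont(1)[OF x] A_cont(1)[OF y] m unfolding continuum_def by (auto intro!: connected_Un)
      then have "connected (K \<inter> (A x \<union> A y))"
        using hereditarily_unicoherentD[OF hu K(1,2)] A_cont(2)[OF x] A_cont(2)[OF y] by simp
      moreover have "closed (A x)" "closed (A y)"
        using A_comp x y compact_imp_closed by auto
      moreover have "A x \<inter> A y \<inter> (K \<inter> (A x \<union> A y)) = {}"
        unfolding m using K(3) by blast
      moreover have "x \<in> A x \<inter> (K \<inter> (A x \<union> A y))" "y \<in> A y \<inter> (K \<inter> (A x \<union> A y))"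
        using K(4,5) A_cont(4)[OF x] A_cont(4)[OF y] by simp_all
      ultimately show False
        using connected_closedD[of "K \<inter> (A x \<union> A y)" "A x" "A y"] by (metis empty_iff inf_le2)
    qed
  qed
  then interpret rooted_fan X v A .
  \<comment> \<open>Two arms of the triod at \<open>v\<close> join to an arc with \<open>v\<close>
    in its interior. Thus an end point on an arc from \<open>v\<close> can only be the far
    end.\<close>
  have v_no_end: "\<not> end_point X v"
  proof
    assume e: "end_point X v"
    have "arc (reversepath g1 +++ g2)"
      using arc_join[of "reversepath g1" g2] g12 by (simp add: arc_reversepath)
    moreover have "path_image (reversepath g1 +++ g2) = path_image g1 \<union> path_image g2"
      using g12 by (simp add: path_image_join)
    ultimately have "v = pathstart (reversepath g1 +++ g2) \<or> v = pathfinish (reversepath g1 +++ g2)"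
      using e g12 unfolding end_point_def by blast
    then have "v = pathfinish g1 \<or> v = pathfinish g2"
      by simp
    then show False
      using arc_distinct_ends[OF g12(1)] arc_distinct_ends[OF g12(2)] g12 by auto
  qed
  have "{x. end_point X x} \<subseteq> maxs"
  proof
    fix x assume "x \<in> {x. end_point X x}"
    then have e: "end_point X x" and x: "x \<in> X"
      by (auto simp: end_point_def)
    have "y = x" if y: "y \<in> X" "x \<in> A y" for y
    proof (cases "y = v")
      case True
      then show ?thesis using y Av by auto
    next
      case False
      then obtain g where g: "arc g" "path_image g = A y" "A y \<subseteq> X" "g 0 = v" "g 1 = y"
        using arcE[OF y(1)] by blast
      then have "x = pathstart g \<or> x = pathfinish g"
        using e y(2) unfolding end_point_def by blast
      then show ?thesis
        using g e v_no_end by (auto simp: pathstart_def pathfinish_def)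
    qed
    then show "x \<in> maxs"
      using x by (auto simp: maxs_def)
  qed
  then have "X \<subseteq> closure maxs"
    using dens closure_mono by metis
  moreover have "X \<noteq> {v}"
  proof
    assume "X = {v}"
    then show False
      using g12 arc_distinct_ends[OF g12(1)] pathfinish_in_path_image[of g1] by auto
  qed
  ultimately have "lelek_rooted_fan X v A"
    by unfold_locales
  then show ?thesis
    unfolding A_def by blast
qed


text \<open>A continuous injection of a compact connected set into the reals is a homeomorphism onto
  an interval, and its inverse parametrizes the arc.\<close>

lemma arc_of_injection:
  fixes \<sigma> :: "'a::metric_space \<Rightarrow> real"
  assumes K: "compact K" "connected K" and \<sigma>: "continuous_on K \<sigma>" "inj_on \<sigma> K"
    and ab: "a \<in> K" "b \<in> K" "\<sigma> a < \<sigma> b"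
  shows "\<exists>g. arc g \<and> pathstart g = a \<and> pathfinish g = b \<and> path_image g = {z \<in> K. \<sigma> a \<le> \<sigma> z \<and> \<sigma> z \<le> \<sigma> b}"
proof -
  define k where "k = the_inv_into K \<sigma>"
  have k: "k (\<sigma> z) = z" if "z \<in> K" for z
    unfolding k_def using the_inv_into_f_f[OF \<sigma>(2) that] .
  have "connected (\<sigma> ` K)"
    using connected_continuous_image[OF \<sigma>(1) K(2)] .
  then have sub: "{\<sigma> a..\<sigma> b} \<subseteq> \<sigma> ` K"
    using ab by (intro connected_contains_Icc) auto
  have contk: "continuous_on (\<sigma> ` K) k"
    using continuous_on_inv[OF \<sigma>(1) K(1)] k by blast
  have "k ` {\<sigma> a..\<sigma> b} = {z \<in> K. \<sigma> a \<le> \<sigma> z \<and> \<sigma> z \<le> \<sigma> b}"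
  proof (intro set_eqI iffI)
    fix z assume "z \<in> k ` {\<sigma> a..\<sigma> b}"
    then obtain s where s: "s \<in> {\<sigma> a..\<sigma> b}" "z = k s" by blast
    then obtain y where "y \<in> K" "s = \<sigma> y" using sub by blast
    then show "z \<in> {z \<in> K. \<sigma> a \<le> \<sigma> z \<and> \<sigma> z \<le> \<sigma> b}"
      using s k by auto
  next
    fix z assume "z \<in> {z \<in> K. \<sigma> a \<le> \<sigma> z \<and> \<sigma> z \<le> \<sigma> b}"
    then show "z \<in> k ` {\<sigma> a..\<sigma> b}"
      using k by (intro image_eqI[of _ _ "\<sigma> z"]) auto
  qed
  moreover have "inj_on k {\<sigma> a..\<sigma> b}"
    using sub k by (intro inj_onI) (metis imageE subsetD)
  ultimately show ?thesis
    using arc_reparametrize[OF continuous_on_subset[OF contk sub] _ ab(3)] k ab by simp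
qed

section \<open>Recovering arcs, end points and smoothness from the order\<close>

context rooted_fan
begin

lemma seg_is_arc:
  assumes x: "x \<in> X" and y: "y \<in> A x" "y \<noteq> x"
  shows "\<exists>g. arc g \<and> pathstart g = y \<and> pathfinish g = x \<and> path_image g = seg y x"
proof -
  have "{z \<in> A x. mu y \<le> mu z \<and> mu z \<le> mu x} = seg y x"
    using mu_le_iff[OF x y(1)] mu_le[OF x] by (auto simp: seg_def)
  then show ?thesis
    using arc_of_injection[OF A_compact[OF x] A_connected[OF x] continuous_on_subset[OF mu_continuous A_sub[OF x]]
        mu_inj[OF x] y(1) A_self[OF x] mu_less[OF x y]] by simp
qed

lemma seg_root_eq: "x \<in> X \<Longrightarrow> seg v x = A x"
  using A_root A_in by (auto simp: seg_def)

lemma A_is_arc: "x \<in> X \<Longrightarrow> x \<noteq> v \<Longrightarrow> \<exists>g. arc g \<and> pathstart g = v \<and> pathfinish g = x \<and> path_image g = A x"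
  using seg_is_arc[OF _ A_root] seg_root_eq by metis

lemma A_meet: "\<lbrakk>x \<in> X; y \<in> X; x \<notin> A y; y \<notin> A x\<rbrakk> \<Longrightarrow> A x \<inter> A y = {v}"
  using comparable_of_meet A_root by blast

lemma X_arcwise_connected: "arcwise_connected X"
  unfolding arcwise_connected_def
proof (intro ballI impI)
  fix x y assume x: "x \<in> X" and y: "y \<in> X" and ne: "x \<noteq> y"
  consider "x \<in> A y" | "y \<in> A x" | "x \<notin> A y" "y \<notin> A x"
    by blast
  then show "\<exists>g. arc g \<and> path_image g \<subseteq> X \<and> pathstart g = x \<and> pathfinish g = y"
  proof cases
    case 1
    then show ?thesis
      using seg_is_arc[OF y 1 ne] seg_sub(1)[OF y] by metis
  next
    case 2
    then obtain g where "arc g" "pathstart g = y" "pathfinish g = x" "path_image g = seg y x"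
      using seg_is_arc[OF x 2] ne by blast
    then show ?thesis
      using seg_sub(1)[OF x] by (intro exI[of _ "reversepath g"]) (auto simp: arc_reversepath)
  next
    case 3
    then have "x \<noteq> v" "y \<noteq> v"
      using A_root x y by blast+
    then obtain g h where g: "arc g" "pathstart g = v" "pathfinish g = x" "path_image g = A x"
      and h: "arc h" "pathstart h = v" "pathfinish h = y" "path_image h = A y"
      using A_is_arc x y by metis
    have "arc (reversepath g +++ h)"
      using g h A_meet[OF x y 3] by (intro arc_join) (auto simp: arc_reversepath)
    moreover have "path_image (reversepath g +++ h) \<subseteq> X"
      using g h A_sub[OF x] A_sub[OF y] by (simp add: path_image_join)
    ultimately show ?thesis
      using g h by (intro exI[of _ "reversepath g +++ h"]) auto
  qed
qed

text \<open>Subcontinua are convex for the order, so \<open>P \<inter> Q\<close> contains the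
  segment between any two of its comparable points. Two points are comparable if \<open>v\<close> is
  missing from \<open>P\<close> or from \<open>Q\<close>, and otherwise they are joined through
  \<open>v\<close>.\<close>

lemma X_hereditarily_unicoherent: "hereditarily_unicoherent X"
  unfolding hereditarily_unicoherent_def
proof (intro allI impI)
  fix P Q assume "P \<subseteq> X \<and> Q \<subseteq> X \<and> continuum P \<and> continuum Q"
  then have P: "continuum P" "P \<subseteq> X" and Q: "continuum Q" "Q \<subseteq> X"
    by auto
  have chain: "connected_component (P \<inter> Q) a b" if ab: "a \<in> P \<inter> Q" "b \<in> P \<inter> Q" "a \<in> A b" for a b
  proof -
    have bX: "b \<in> X"
      using ab P by blast
    have "seg a b \<subseteq> P \<inter> Q"
      using continuum_convex[OF P] continuum_convex[OF Q] ab unfolding seg_def by blast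
    then show ?thesis
      unfolding connected_component_def
      using seg_continuum[OF bX ab(3)] seg_ends[OF bX ab(3)] by (auto simp: continuum_def)
  qed
  show "connected (P \<inter> Q)"
    unfolding connected_iff_connected_component
  proof (intro ballI)
    fix a b assume ab: "a \<in> P \<inter> Q" "b \<in> P \<inter> Q"
    show "connected_component (P \<inter> Q) a b"
    proof (cases "v \<in> P \<inter> Q")
      case True
      then have "connected_component (P \<inter> Q) v a" "connected_component (P \<inter> Q) v b"
        using chain[of v a] chain[of v b] ab A_root P by blast+
      then show ?thesis
        using connected_component_sym connected_component_trans by metis
    next
      case False
      then have "a \<in> A b \<or> b \<in> A a"
        using continuum_chain[OF P, of a b] continuum_chain[OF Q, of a b] ab by blast
      then show ?thesis
        using chain ab connected_component_sym by metis
    qed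
  qed
qed

text \<open>A short initial piece of an arc leaving \<open>x \<noteq> v\<close> misses
  \<open>v\<close>, so its points are comparable with \<open>x\<close>: the arc sets out upwards or
  downwards.\<close>

lemma arc_germ:
  assumes g: "arc g" "path_image g \<subseteq> X" and x: "pathstart g = x" "x \<noteq> v"
  shows "\<exists>C y. continuum C \<and> C \<subseteq> X \<and> C \<subseteq> path_image g \<and> x \<in> C \<and> y \<in> C \<and> y \<noteq> x \<and> (x \<in> A y \<or> y \<in> A x)"
proof -
  have gc: "continuous_on {0..1} g" and gi: "inj_on g {0..1}" and g0: "g 0 = x"
    using g x by (auto simp: arc_def path_def pathstart_def)
  have "0 < dist x v"
    using x by simp
  then obtain d where d: "0 < d" "\<And>t. t \<in> {0..1} \<Longrightarrow> dist t 0 < d \<Longrightarrow> dist (g t) (g 0) < dist x v"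
    using gc unfolding continuous_on_iff by (metis atLeastAtMost_iff order_refl zero_le_one)
  define t where "t = min 1 (d/2)"
  have t: "0 < t" "t \<le> 1" "t < d"
    using d(1) by (auto simp: t_def)
  define C where "C = g ` {0..t}"
  have "continuous_on {0..t} g"
    by (rule continuous_on_subset[OF gc]) (use t in auto)
  then have "continuum C"
    unfolding continuum_def C_def using t by (auto intro!: compact_continuous_image connected_continuous_image)
  moreover have sub: "C \<subseteq> path_image g"
    unfolding C_def path_image_def using t by (intro image_mono) auto
  moreover have vC: "v \<notin> C"
  proof
    assume "v \<in> C"
    then obtain s where "s \<in> {0..t}" "v = g s"
      by (auto simp: C_def)
    then show False
      using d(2)[of s] t g0 by (auto simp: dist_commute)
  qed
  moreover have "x \<in> C" "g t \<in> C"
    using t g0 by (auto simp: C_def)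
  moreover have "g t \<noteq> x"
    using gi t g0 by (auto dest: inj_onD)
  moreover have "x \<in> A (g t) \<or> g t \<in> A x"
    by (rule continuum_chain[OF \<open>continuum C\<close>]) (use calculation g(2) in auto)
  ultimately show ?thesis
    using g(2) by (intro exI[of _ C] exI[of _ "g t"]) auto
qed

text \<open>Two germs in the same direction overlap. Upwards, \<open>y\<close> and \<open>z\<close>
  are comparable because their legs share \<open>x \<noteq> v\<close>; downwards, because both lie
  on \<open>A x\<close>. By convexity the one nearer to \<open>x\<close> belongs to both
  continua.\<close>

lemma germs_opposite:
  assumes C: "continuum C" "C \<subseteq> X" "x \<in> C" "y \<in> C" "y \<noteq> x"
    and D: "continuum D" "D \<subseteq> X" "x \<in> D" "z \<in> D" "z \<noteq> x"
    and CD: "C \<inter> D \<subseteq> {x}" and xv: "x \<noteq> v"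
  shows "\<not> (x \<in> A y \<and> x \<in> A z)" "\<not> (y \<in> A x \<and> z \<in> A x)"
proof -
  have X: "x \<in> X" "y \<in> X" "z \<in> X"
    using C D by auto
  show "\<not> (x \<in> A y \<and> x \<in> A z)"
  proof
    assume up: "x \<in> A y \<and> x \<in> A z"
    then have "y \<in> A z \<or> z \<in> A y"
      using comparable_of_meet[OF X(2,3)] xv by blast
    then show False
      using continuum_convex[OF D(1,2,3) _ D(4), of y] continuum_convex[OF C(1,2,3) _ C(4), of z] up C D CD by blast
  qed
  show "\<not> (y \<in> A x \<and> z \<in> A x)"
  proof
    assume down: "y \<in> A x \<and> z \<in> A x"
    then have "y \<in> A z \<or> z \<in> A y"
      using A_linear[OF X(1)] by blast
    then show False
      using continuum_convex[OF C(1,2,4) _ C(3), of z] continuum_convex[OF D(1,2,4) _ D(3), of y] down C D CD by blast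
  qed
qed

text \<open>Pigeonhole: three germs at \<open>x\<close>, but only the directions up and
  down.\<close>

lemma ramification_only_root:
  assumes "ramification_point X x"
  shows "x = v"
proof (rule ccontr)
  assume xv: "x \<noteq> v"
  obtain g1 g2 g3 where g: "arc g1" "arc g2" "arc g3"
        "pathstart g1 = x" "pathstart g2 = x" "pathstart g3 = x"
        "path_image g1 \<subseteq> X" "path_image g2 \<subseteq> X" "path_image g3 \<subseteq> X"
    and meets: "path_image g1 \<inter> path_image g2 = {x}" "path_image g1 \<inter> path_image g3 = {x}"
        "path_image g2 \<inter> path_image g3 = {x}"
    using assms unfolding ramification_point_def by blast
  obtain C1 y1 where C1: "continuum C1" "C1 \<subseteq> X" "x \<in> C1" "y1 \<in> C1" "y1 \<noteq> x"
    and 1: "C1 \<subseteq> path_image g1" "x \<in> A y1 \<or> y1 \<in> A x"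
    using arc_germ[OF g(1,7,4) xv] by blast
  obtain C2 y2 where C2: "continuum C2" "C2 \<subseteq> X" "x \<in> C2" "y2 \<in> C2" "y2 \<noteq> x"
    and 2: "C2 \<subseteq> path_image g2" "x \<in> A y2 \<or> y2 \<in> A x"
    using arc_germ[OF g(2,8,5) xv] by blast
  obtain C3 y3 where C3: "continuum C3" "C3 \<subseteq> X" "x \<in> C3" "y3 \<in> C3" "y3 \<noteq> x"
    and 3: "C3 \<subseteq> path_image g3" "x \<in> A y3 \<or> y3 \<in> A x"
    using arc_germ[OF g(3,9,6) xv] by blast
  have "C1 \<inter> C2 \<subseteq> {x}" "C1 \<inter> C3 \<subseteq> {x}" "C2 \<inter> C3 \<subseteq> {x}"
    using 1 2 3 meets by blast+
  then show False
    using germs_opposite[OF C1 C2 _ xv] germs_opposite[OF C1 C3 _ xv] germs_opposite[OF C2 C3 _ xv] 1 2 3 by blast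
qed

text \<open>If \<open>e\<close> were interior to an arc, the two halves of the arc would give two
  germs meeting only in \<open>e\<close>; at a maximal point both must go down.\<close>

lemma maxs_end_point:
  assumes e: "e \<in> maxs" and ev: "e \<noteq> v"
  shows "end_point X e"
  unfolding end_point_def
proof (intro conjI allI impI)
  show "e \<in> X"
    using e maxsD by blast
  fix g assume "arc g \<and> path_image g \<subseteq> X \<and> e \<in> path_image g"
  then have g: "arc g" "path_image g \<subseteq> X" "e \<in> path_image g"
    by auto
  then obtain t where t: "0 \<le> t" "t \<le> 1" "e = g t"
    by (auto simp: path_image_def)
  show "e = pathstart g \<or> e = pathfinish g"
  proof (rule ccontr)
    assume "\<not> ?thesis"
    then have t': "0 < t" "t < 1"
      using t by (auto simp: pathstart_def pathfinish_def less_le)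
    obtain k where k: "arc k" "pathfinish k = g t" "path_image k = g ` {0..t}"
      using arc_restrict[OF g(1), of 0 t] t' by auto
    obtain h where h: "arc h" "pathstart h = g t" "path_image h = g ` {t..1}"
      using arc_restrict[OF g(1), of t 1] t' by auto
    have sub: "path_image (reversepath k) \<subseteq> X" "path_image h \<subseteq> X"
    proof -
      have "g ` {0..t} \<subseteq> path_image g" "g ` {t..1} \<subseteq> path_image g"
        unfolding path_image_def using t' by (auto intro!: image_mono)
      then show "path_image (reversepath k) \<subseteq> X" "path_image h \<subseteq> X"
        using k(3) h(3) g(2) by auto
    qed
    have st: "pathstart (reversepath k) = e" "pathstart h = e"
      using k h t by auto
    obtain C y where C: "continuum C" "C \<subseteq> X" "e \<in> C" "y \<in> C" "y \<noteq> e"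
      and 1: "C \<subseteq> g ` {0..t}" "e \<in> A y \<or> y \<in> A e"
      using arc_germ[OF arc_reversepath[OF k(1)] sub(1) st(1) ev] k(3) by auto
    obtain D z where D: "continuum D" "D \<subseteq> X" "e \<in> D" "z \<in> D" "z \<noteq> e"
      and 2: "D \<subseteq> g ` {t..1}" "e \<in> A z \<or> z \<in> A e"
      using arc_germ[OF h(1) sub(2) st(2) ev] h(3) by auto
    have "g ` {0..t} \<inter> g ` {t..1} = {e}"
      using arc_halves_meet[OF g(1) t(1,2)] t(3) by simp
    then have "C \<inter> D \<subseteq> {e}"
      using 1 2 by blast
    moreover have "y \<in> A e" "z \<in> A e"
      using 1 2 C D maxsD(2)[OF e] by blast+
    ultimately show False
      using germs_opposite(2)[OF C D _ ev] by blast
  qed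
qed

lemma A_eq_arc_from: "x \<in> X \<Longrightarrow> arc_from X v x = A x"
proof (rule arc_from_eq[OF X_hereditarily_unicoherent root_in])
  assume x: "x \<in> X"
  show "arc_in X v x (A x)"
    using A_is_arc[OF x] A_sub[OF x] A_of_root unfolding arc_in_def by auto
qed

text \<open>Upper semicontinuity keeps \<open>A (s n)\<close> away from the closed set
  \<open>F\<close> of points far from \<open>A x\<close>. Lower semicontinuity is applied to the
  finitely many points of an \<open>e/2\<close>-net of \<open>A x\<close>, so that one index serves
  all of \<open>A x\<close>.\<close>

lemma A_hausdorff_continuous:
  assumes x: "x \<in> X" and s: "\<And>n. s n \<in> X" "s \<longlonglongrightarrow> x"
  shows "(\<lambda>n. hausdorff_dist (A (s n)) (A x)) \<longlonglongrightarrow> 0"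
proof (rule LIMSEQ_I)
  fix r :: real assume r: "0 < r"
  define e where "e = r/2"
  have e: "0 < e" "e < r"
    using r by (auto simp: e_def)
  define F where "F = {z. e \<le> infdist z (A x)}"
  have "closed F"
    unfolding F_def by (intro closed_Collect_le continuous_intros continuous_on_infdist)
  then have cl: "closed {y \<in> X. A y \<inter> F \<noteq> {}}"
    by (rule A_usc)
  have "x \<in> - {y \<in> X. A y \<inter> F \<noteq> {}}"
    using e by (auto simp: F_def)
  then have "\<forall>\<^sub>F n in sequentially. s n \<in> - {y \<in> X. A y \<inter> F \<noteq> {}}"
    using topological_tendstoD[OF s(2) open_Compl[OF cl]] by blast
  then have 1: "\<forall>\<^sub>F n in sequentially. \<forall>a\<in>A (s n). infdist a (A x) \<le> e"
    by eventually_elim (use s(1) in \<open>force simp: F_def\<close>)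
  obtain N where N: "finite N" "N \<subseteq> A x" "A x \<subseteq> (\<Union>b\<in>N. ball b (e/2))"
    using seq_compact_imp_totally_bounded[of "A x"] A_compact[OF x] e(1) compact_eq_seq_compact_metric
    by (metis half_gt_zero)
  have "\<forall>\<^sub>F n in sequentially. \<exists>c\<in>A (s n). dist c b < e/2" if b: "b \<in> N" for b
  proof -
    obtain d where d: "0 < d" "\<And>y. y \<in> X \<Longrightarrow> dist y x < d \<Longrightarrow> \<exists>c\<in>A y. dist c b < e/2"
      using lsc_dist[OF x, of b "e/2"] b N(2) half_gt_zero[OF e(1)] by blast
    have "\<forall>\<^sub>F n in sequentially. dist (s n) x < d"
      using tendstoD[OF s(2) d(1)] .
    then show ?thesis
      by eventually_elim (use d(2) s(1) in blast)
  qed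
  then have "\<forall>\<^sub>F n in sequentially. \<forall>b\<in>N. \<exists>c\<in>A (s n). dist c b < e/2"
    using N(1) by (simp add: eventually_ball_finite)
  then have 2: "\<forall>\<^sub>F n in sequentially. \<forall>b\<in>A x. infdist b (A (s n)) \<le> e"
  proof eventually_elim
    case (elim n)
    show ?case
    proof
      fix b assume "b \<in> A x"
      then obtain b' where b': "b' \<in> N" "dist b' b < e/2"
        using N(3) by auto
      then obtain c where c: "c \<in> A (s n)" "dist c b' < e/2"
        using elim by blast
      have "dist b c \<le> dist b' b + dist c b'"
        by (metis dist_commute dist_triangle add.commute)
      then show "infdist b (A (s n)) \<le> e"
        using infdist_le[OF c(1), of b] b' c by linarith
    qed
  qed
  have "\<forall>\<^sub>F n in sequentially. norm (hausdorff_dist (A (s n)) (A x) - 0) < r"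
    using 1 2
  proof eventually_elim
    case (elim n)
    have "A (s n) \<noteq> {}" "A x \<noteq> {}"
      using A_self x s(1) by blast+
    then have "hausdorff_dist (A (s n)) (A x) \<le> e"
      using hausdorff_dist_le elim by blast
    moreover have "0 \<le> hausdorff_dist (A (s n)) (A x)"
      using infdist_le_hausdorff_dist(2)[OF A_compact[OF s(1)] A_compact[OF x] A_self[OF x]] infdist_nonneg
      by (rule order_trans[rotated])
    ultimately show ?case
      using e by simp
  qed
  then show "\<exists>no. \<forall>n\<ge>no. norm (hausdorff_dist (A (s n)) (A x) - 0) < r"
    by (simp add: eventually_sequentially)
qed

end

context lelek_rooted_fan
begin

text \<open>Finitely many maximal points, being dense, would make the continuum \<open>X\<close>
  finite and hence a single point. Any three maximal points give the arms of a triod, as their legs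
  meet only in \<open>v\<close>.\<close>

lemma root_ramification: "ramification_point X v"
proof -
  have "infinite maxs"
  proof
    assume fin: "finite maxs"
    then have "finite X"
      using maxs_dense finite_imp_closed closure_closed finite_subset by metis
    then obtain p where "X = {p}"
      using X_continuum connected_finite_iff_sing unfolding continuum_def by blast
    then show False
      using root_in nontrivial by blast
  qed
  then obtain M where "M \<subseteq> maxs" "card M = 3"
    using infinite_arbitrarily_large by blast
  then obtain a b c where abc: "a \<in> maxs" "b \<in> maxs" "c \<in> maxs" "a \<noteq> b" "b \<noteq> c" "a \<noteq> c"
    by (auto simp: card_3_iff)
  have ex: "\<exists>g. arc g \<and> pathstart g = v \<and> path_image g = A e" if "e \<in> maxs" for e
    using A_is_arc[OF maxsD(1)[OF that] maxs_not_root[OF that]] by blast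
  have meet: "A e \<inter> A e' = {v}" if "e \<in> maxs" "e' \<in> maxs" "e \<noteq> e'" for e e'
    using that maxsD A_meet by metis
  obtain g1 g2 g3 where g: "arc g1" "pathstart g1 = v" "path_image g1 = A a"
    "arc g2" "pathstart g2 = v" "path_image g2 = A b" "arc g3" "pathstart g3 = v" "path_image g3 = A c"
    using ex abc by metis
  have "path_image g1 \<subseteq> X" "path_image g2 \<subseteq> X" "path_image g3 \<subseteq> X"
    using g A_sub abc maxsD by auto
  moreover have "path_image g1 \<inter> path_image g2 = {v}" "path_image g1 \<inter> path_image g3 = {v}"
    "path_image g2 \<inter> path_image g3 = {v}"
    unfolding g using meet abc by auto
  ultimately show ?thesis
    unfolding ramification_point_def using g by blast
qed

lemma X_lelek_fan: "lelek_fan X"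
proof -
  have "dendroid X"
    unfolding dendroid_def using X_continuum X_arcwise_connected X_hereditarily_unicoherent by blast
  then have "fan X"
    unfolding fan_def using ramification_only_root by blast
  moreover have "(\<lambda>n. hausdorff_dist (arc_from X v (s n)) (arc_from X v x)) \<longlonglongrightarrow> 0"
    if "x \<in> X" "\<forall>n. s n \<in> X" "s \<longlonglongrightarrow> x" for x s
    using A_hausdorff_continuous[of x s] A_eq_arc_from that by simp
  ultimately have "smooth_fan X"
    unfolding smooth_fan_def using root_ramification by blast
  moreover have "closure {x. end_point X x} = X"
  proof
    show "closure {x. end_point X x} \<subseteq> X"
      by (rule closure_minimal) (use X_compact compact_imp_closed in \<open>auto simp: end_point_def\<close>)
    have "maxs \<subseteq> {x. end_point X x}"
      using maxs_end_point maxs_not_root by blast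
    then show "X \<subseteq> closure {x. end_point X x}"
      using maxs_dense closure_mono by (metis subset_trans)
  qed
  ultimately show ?thesis
    unfolding lelek_fan_def by blast
qed

end

section \<open>The equivalence\<close>

theorem mainTheorem12:
  fixes L :: "'a::metric_space set" and Y :: "'b::metric_space set"
  assumes "lelek_fan L" and "continuum Y" and "nondegenerate Y"
  shows "((\<exists>e r. embedding_into Y L e \<and> retraction L (e ` Y) r \<and> open_map_on L r)
            \<longleftrightarrow> (\<exists>f. continuous_on L f \<and> f ` L = Y \<and> open_map_on L f))
       \<and> ((\<exists>f. continuous_on L f \<and> f ` L = Y \<and> open_map_on L f) \<longleftrightarrow> lelek_fan Y)"
proof -
  obtain v where L: "lelek_rooted_fan L v (arc_from L v)"
    using lelek_fan_imp_rooted[OF assms(1)] by blast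
  have embed_open: "\<exists>f. continuous_on L f \<and> f ` L = Y \<and> open_map_on L f"
    if er: "embedding_into Y L e" "retraction L (e ` Y) r" "open_map_on L r" for e r
  proof -
    obtain e' where e': "homeomorphism Y (e ` Y) e e'"
      using er(1) by (auto simp: embedding_into_def)
    have rL: "r ` L = e ` Y" and r: "continuous_on L r"
      using er(2) unfolding retraction_def by force+
    have "continuous_on L (e' \<circ> r)"
      using r e' rL by (intro continuous_on_compose) (auto simp: homeomorphism_def)
    moreover have im: "(e' \<circ> r) ` L = Y"
      unfolding image_comp[symmetric] rL using e' by (simp add: homeomorphism_def)
    moreover have "open_map_on L (e' \<circ> r)"
      unfolding open_map_on_def im
    proof (intro allI impI)
      fix U assume "openin (top_of_set L) U"
      then have "openin (top_of_set (e ` Y)) (r ` U)"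
        using er(3) rL by (simp add: open_map_on_def)
      then show "openin (top_of_set Y) ((e' \<circ> r) ` U)"
        unfolding image_comp[symmetric] by (rule homeomorphism_imp_open_map[OF homeomorphism_symD[OF e']])
    qed
    ultimately show ?thesis
      by blast
  qed
  have open_lelek: "lelek_fan Y" if "continuous_on L f" "f ` L = Y" "open_map_on L f" for f
  proof -
    interpret L: lelek_rooted_fan L v "arc_from L v"
      by (rule L)
    interpret open_image L v "arc_from L v" f Y
      by unfold_locales (use that assms(3) in auto)
    show ?thesis
      using lelek_rooted_fan.X_lelek_fan[OF image_lelek_rooted_fan] .
  qed
  \<comment> \<open>By uniqueness of the Lelek fan the embedding can be taken onto \<open>L\<close>,
    with the identity as the open retraction.\<close>
  have lelek_embed: "\<exists>e r. embedding_into Y L e \<and> retraction L (e ` Y) r \<and> open_map_on L r"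
    if Y: "lelek_fan Y"
  proof -
    obtain w where "lelek_rooted_fan Y w (arc_from Y w)"
      using lelek_fan_imp_rooted[OF Y] by blast
    then obtain F where F: "continuous_on Y F" "inj_on F Y" "F ` Y = L"
      using lelek_rooted_fans_homeomorphic[OF _ L] by blast
    have "compact Y"
      using assms(2) by (simp add: continuum_def)
    then have "embedding_into Y L F"
      using homeomorphism_compact[OF _ F(1,3,2)] F(3) by (simp add: embedding_into_def)
    moreover have "retraction L (F ` Y) id"
      by (simp add: F(3) retraction_def)
    moreover have "open_map_on L id"
      by (simp add: open_map_on_def)
    ultimately show ?thesis
      by blast
  qed
  show ?thesis
    using embed_open open_lelek lelek_embed by blast
qed

end
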